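(* Let $c<0$ and $\theta<0$ be real numbers, and let $\varepsilon>0$ be arbitrary. Then $$\mathrm{E}(z;c,\theta)=A_1\exp\left(A_2(\log z)^{\frac{\theta}{\theta-1}}\right)(\log z)^{\frac{\theta}{2(1-\theta)}}\cos\left(A_3(\log z)^{\frac{\theta}{\theta-1}}+A_4\right)+\mathrm{O}\left(\exp\left(A_2(\log z)^{\frac{\theta}{\theta-1}}\right)(\log z)^{\frac{\theta}{2(1-\theta)}-\mu}\right)$$ as $z\to\infty$ in an arbitrary sector with vertex at zero that does not contain the negative real axis. The constants are $$A_1=-(c\theta)^{\frac{1}{2(\theta-1)}}\sqrt{\tfrac{2}{\pi(1-\theta)}},\qquad A_2=(1-\theta^{-1})(c\theta)^{\frac{1}{1-\theta}}\cos\tfrac{\pi}{1-\theta},$$ $$A_3=(1-\theta^{-1})(c\theta)^{\frac{1}{1-\theta}}\sin\tfrac{\pi}{1-\theta},\qquad A_4=\tfrac{\pi}{2(\theta-1)},$$ so that $A_2$ is negative for $-1<\theta<0$, zero for $\theta=-1$, and positive for $\theta<-1$. The exponent $\mu$ is $$\mu=\begin{cases}\frac{\theta}{2(\theta-1)}-\varepsilon, & \theta\ge -2,\\[2pt] \frac{1}{1-\theta}, & \theta<-2.\end{cases}$$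
   Context: For $c\in\mathbb{R}$ and $\theta<0$, $\mathrm{E}(z;c,\theta)=\sum_{n=1}^\infty \mathrm{e}^{c n^\theta}(-z)^n$ for $|z|<1$, and $\mathrm{E}(z;c,\theta)$ also denotes the analytic continuation of this function to $\mathbb{C}\setminus(-\infty,-1]$. The logarithm and powers are principal branches. *)

theory Defs
  imports "HOL-Complex_Analysis.Complex_Analysis" "HOL-Library.Landau_Symbols"
begin

definition E_series :: "complex \<Rightarrow> real \<Rightarrow> real \<Rightarrow> complex" where
  "E_series z c \<theta> =
     (\<Sum>n. complex_of_real (exp (c * real (Suc n) powr \<theta>)) * (- z) ^ Suc n)"

definition slit_plane :: "complex set" where
  "slit_plane = - (complex_of_real ` {..-1})"

definition is_continuation :: "real \<Rightarrow> real \<Rightarrow> (complex \<Rightarrow> complex) \<Rightarrow> bool" where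
  "is_continuation c \<theta> f \<longleftrightarrow>
     f holomorphic_on slit_plane \<and> (\<forall>z. norm z < 1 \<longrightarrow> f z = E_series z c \<theta>)"

text \<open>The continuation chosen below is unique on the slit plane by lemma \<open>E_unique\<close>; on the cut itself the
  value is unspecified. If no continuation existed, nothing could be derived about the chosen
  function, so results about \<open>E\<close> depend on a proof that the continuation exists.\<close>

definition E :: "complex \<Rightarrow> real \<Rightarrow> real \<Rightarrow> complex" where
  "E z c \<theta> = (SOME f. is_continuation c \<theta> f) z"

lemma open_slit_plane: "open slit_plane"
proof -
  have "closed (complex_of_real ` {..-1})"
    by (intro closed_injective_linear_image)
       (auto intro: bounded_linear.linear bounded_linear_of_real simp: inj_def)
  thus ?thesis
    by (simp add: slit_plane_def open_Compl)
qed

lemma starlike_slit_plane: "starlike slit_plane"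
  unfolding starlike_def
proof (intro bexI[of _ 0] ballI subsetI)
  show "(0 :: complex) \<in> slit_plane"
    by (auto simp: slit_plane_def)
next
  fix z w assume z: "z \<in> slit_plane" and w: "w \<in> closed_segment 0 z"
  from w obtain u where u: "0 \<le> u" "u \<le> 1" "w = of_real u * z"
    by (auto simp: closed_segment_def scaleR_conv_of_real)
  show "w \<in> slit_plane"
  proof (rule ccontr)
    assume "w \<notin> slit_plane"
    then obtain x where x: "x \<le> -1" "of_real u * z = complex_of_real x"
      using u by (auto simp: slit_plane_def)
    have "u \<noteq> 0" using x by auto
    hence "z = complex_of_real (x / u)"
      using x(2) by (simp add: field_simps)
    moreover have "x / u \<le> -1"
      using u \<open>u \<noteq> 0\<close> x(1) by (simp add: field_simps)
    ultimately have "z \<in> complex_of_real ` {..-1}"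
      by blast
    thus False
      using z by (simp add: slit_plane_def)
  qed
qed

lemma E_unique:
  assumes f: "is_continuation c \<theta> f" and z: "z \<in> slit_plane"
  shows "E z c \<theta> = f z"
proof -
  define g where "g = (SOME f. is_continuation c \<theta> f)"
  have g: "is_continuation c \<theta> g"
    unfolding g_def using f by (rule someI[of "is_continuation c \<theta>"])
  have sub: "ball 0 1 \<subseteq> slit_plane"
  proof
    fix w :: complex assume "w \<in> ball 0 1"
    thus "w \<in> slit_plane" by (auto simp: slit_plane_def)
  qed
  have "g z = f z"
  proof (rule analytic_continuation_open[of "ball 0 1" slit_plane g f])
    show "connected slit_plane"
      by (rule starlike_imp_connected[OF starlike_slit_plane])
  next
    show "g w = f w" if "w \<in> ball 0 1" for w
      using that f g by (simp add: is_continuation_def)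
    qed (use f g sub z open_slit_plane in \<open>simp_all add: is_continuation_def\<close>)
  thus ?thesis
    by (simp add: E_def g_def)
qed

text \<open>Open sectors with vertex \<open>0\<close>. Closed sectors off the negative real axis are contained in
  open ones off it, so nothing is lost by considering only open sectors.\<close>

definition sector :: "real \<Rightarrow> real \<Rightarrow> complex set" where
  "sector \<alpha> \<beta> = {complex_of_real r * cis t | r t. 0 < r \<and> \<alpha> < t \<and> t < \<beta>}"

definition A1 :: "real \<Rightarrow> real \<Rightarrow> real" where
  "A1 c \<theta> = - ((c * \<theta>) powr (1 / (2 * (\<theta> - 1)))) * sqrt (2 / (pi * (1 - \<theta>)))"

definition A2 :: "real \<Rightarrow> real \<Rightarrow> real" where
  "A2 c \<theta> = (1 - inverse \<theta>) * (c * \<theta>) powr (1 / (1 - \<theta>)) * cos (pi / (1 - \<theta>))"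

definition A3 :: "real \<Rightarrow> real \<Rightarrow> real" where
  "A3 c \<theta> = (1 - inverse \<theta>) * (c * \<theta>) powr (1 / (1 - \<theta>)) * sin (pi / (1 - \<theta>))"

definition A4 :: "real \<Rightarrow> real" where
  "A4 \<theta> = pi / (2 * (\<theta> - 1))"

definition \<mu> :: "real \<Rightarrow> real \<Rightarrow> real" where
  "\<mu> \<theta> \<epsilon> = (if \<theta> \<ge> -2 then \<theta> / (2 * (\<theta> - 1)) - \<epsilon> else 1 / (1 - \<theta>))"

end

theory Submission
  imports Defs "HOL-Probability.Distributions"
begin

text \<open>Write \<open>a = -\<theta>\<close>, \<open>L = Ln z\<close> and \<open>l = Re L\<close>.

The residue of \<open>exp (c s powr \<theta>) z^s \<pi> / sin (\<pi> s)\<close> at a positive integer \<open>n\<close> is the \<open>n\<close>-th term of the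
series, so for \<open>\<bar>z\<bar> < 1\<close> the series is \<open>-1/(2\<pi>i)\<close> times the integral of this function over the line
\<open>Re s = 1/2\<close>. That integral converges and is holomorphic for all \<open>z\<close> off the negative axis, hence it is the
continuation (\<open>E_eq_line_integral\<close>).

For large \<open>z\<close> the exponent \<open>c s powr \<theta> + s l\<close> is stationary at points \<open>s = \<sigma> u\<close> with \<open>u powr (-a - 1) = -1\<close>
and \<open>\<sigma> = (l / (c \<theta>)) powr (-1 / (1 + a))\<close>, and it equals \<open>N (u - u powr (-a) / a)\<close> with \<open>N = \<sigma> l\<close>. The two
highest saddle points are \<open>u = exp (\<plusminus>i\<psi>)\<close>, \<open>\<psi> = \<pi> / (1 + a)\<close>; they are conjugate and together produce the
cosine. Since \<open>\<sigma>\<close> tends to \<open>0\<close>, the whole factor \<open>exp (i s Im L) \<pi> / sin (\<pi> s)\<close> is \<open>(1 + O(\<sigma>)) / s\<close> there.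
This makes the estimate uniform in the argument of \<open>z\<close>, up to the negative axis itself.

The contour runs through the saddle along a logarithmic spiral on which the real part of the exponent has
its only maximum at the saddle, whatever the value of \<open>a\<close> (\<open>Re_phase_drop_neg\<close>). Laplace's method on the
spiral has relative error \<open>O(1 / sqrt N + \<sigma>)\<close> (\<open>spiral_integral_estimate\<close>). The spiral is left soon after
the saddle; from there on the integrand stays exponentially smaller, along a vertical line if \<open>a > 1\<close> and
along a horizontal line if \<open>a \<le> 1\<close> (\<open>tail_estimate_steep\<close>, \<open>tail_estimate_flat\<close>). Of the contour through the
saddle only the spiral has to be integrated over: the other pieces enter through differences of a primitive
of the integrand and the mean value inequality, so that contours never have to be joined.

With \<open>p = a / (1 + a)\<close> one has \<open>N = const l powr p\<close> and \<open>\<sigma> = const l powr (p - 1)\<close>, so the relative error is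
\<open>l powr (-p/2) + l powr (p - 1)\<close>. Replacing \<open>l\<close> by \<open>L\<close> in the main term costs another \<open>l powr (p - 1)\<close>
(\<open>main_term_near_real\<close>), and \<open>\<mu>\<close> is at most both \<open>p/2\<close> and \<open>1 - p\<close>.\<close>

section \<open>The Lindeloef integrand\<close>

definition damp :: "real \<Rightarrow> real \<Rightarrow> complex \<Rightarrow> complex" where
  "damp c \<theta> s = exp (of_real c * s powr of_real \<theta>)"

definition lindelof :: "real \<Rightarrow> real \<Rightarrow> complex \<Rightarrow> complex \<Rightarrow> complex" where
  "lindelof c \<theta> L s = damp c \<theta> s * exp (s * L) * (of_real pi / sin (of_real pi * s))"

text \<open>The integrand has a branch cut on the negative axis and poles at the positive integers. Removing both
half lines leaves a domain that is star-shaped about \<open>1/2\<close>, on which the integrand has a primitive.\<close>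

definition gapped_plane :: "complex set" where
  "gapped_plane = {s. Im s \<noteq> 0 \<or> 0 < Re s \<and> Re s < 1}"

lemma open_gapped_plane: "open gapped_plane"
proof -
  have eq: "gapped_plane = {s. Im s \<noteq> 0} \<union> ({s. 0 < Re s} \<inter> {s. Re s < 1})"
    by (auto simp: gapped_plane_def)
  show ?thesis unfolding eq
    by (intro open_Un open_Int open_halfspace_Re_gt open_halfspace_Re_lt open_Collect_neq continuous_intros)
qed

lemma starlike_gapped_plane: "starlike gapped_plane"
  unfolding starlike_def
proof (intro bexI[of _ "1/2"] ballI subsetI)
  show "1/2 \<in> gapped_plane" by (simp add: gapped_plane_def)
next
  fix z w :: complex assume z: "z \<in> gapped_plane" and w: "w \<in> closed_segment (1/2) z"
  from w obtain u where u: "0 \<le> u" "u \<le> 1" "w = (1 - u) *\<^sub>R (1/2) + u *\<^sub>R z"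
    by (auto simp: closed_segment_def)
  show "w \<in> gapped_plane"
  proof (cases "u = 0 \<or> Im z \<noteq> 0")
    case True thus ?thesis using u by (auto simp: gapped_plane_def)
  next
    case False
    hence z': "Im z = 0" "0 < Re z" "Re z < 1" "0 < u" using z u by (auto simp: gapped_plane_def)
    have "Re w = 1/2 - u/2 + u * Re z" unfolding u(3) by (simp add: algebra_simps)
    moreover have "0 < u * Re z" using z' by simp
    moreover have "u * Re z < u" using z' by simp
    ultimately have "0 < Re w" "Re w < 1" using u(1,2) by linarith+
    thus ?thesis by (simp add: gapped_plane_def)
  qed
qed

lemma sin_pi_eq_0_imp_int:
  assumes "sin (of_real pi * s) = (0::complex)"
  shows "Im s = 0 \<and> Re s \<in> \<int>"
proof -
  from assms obtain n where "of_real pi * s = of_real (of_int n * pi)"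
    using sin_eq_0 by (metis mult.commute of_real_mult)
  hence "s = of_real (of_int n)" by (simp add: mult.commute)
  thus ?thesis by simp
qed

lemma real_not_Ints_between_0_1: "0 < x \<Longrightarrow> x < 1 \<Longrightarrow> (x::real) \<notin> \<int>"
  by (auto elim!: Ints_cases)

lemma sin_pi_nonzero_gapped: "s \<in> gapped_plane \<Longrightarrow> sin (of_real pi * s) \<noteq> 0"
  using sin_pi_eq_0_imp_int real_not_Ints_between_0_1 by (auto simp: gapped_plane_def)

lemma damp_holomorphic: 
  assumes "\<And>s. s \<in> S \<Longrightarrow> s \<notin> \<real>\<^sub>\<le>\<^sub>0"
  shows "damp c \<theta> holomorphic_on S"
  unfolding damp_def by (intro holomorphic_intros) (use assms in auto)

lemma lindelof_holomorphic:
  assumes "\<And>s. s \<in> S \<Longrightarrow> s \<notin> \<real>\<^sub>\<le>\<^sub>0" "\<And>s. s \<in> S \<Longrightarrow> sin (of_real pi * s) \<noteq> 0"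
  shows "lindelof c \<theta> L holomorphic_on S"
  unfolding lindelof_def 
  by (intro holomorphic_intros damp_holomorphic) (use assms in auto)

lemma gapped_plane_nonpos: "s \<in> gapped_plane \<Longrightarrow> s \<notin> \<real>\<^sub>\<le>\<^sub>0"
  by (auto simp: gapped_plane_def complex_nonpos_Reals_iff)

lemma lindelof_holomorphic_gapped: "lindelof c \<theta> L holomorphic_on gapped_plane"
  by (intro lindelof_holomorphic gapped_plane_nonpos sin_pi_nonzero_gapped)

lemma lindelof_primitive:
  obtains \<Phi> where "\<And>s. s \<in> gapped_plane \<Longrightarrow> (\<Phi> has_field_derivative lindelof c \<theta> L s) (at s)"
proof -
  have "\<exists>g. \<forall>x\<in>gapped_plane. (g has_field_derivative lindelof c \<theta> L x) (at x)"
    by (rule holomorphic_starlike_primitive[OF _ starlike_gapped_plane open_gapped_plane finite.emptyI])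
       (use lindelof_holomorphic_gapped open_gapped_plane in
         \<open>auto intro: holomorphic_on_imp_continuous_on holomorphic_on_imp_differentiable_at\<close>)
  thus ?thesis using that by blast
qed

lemma norm_damp_le:
  shows "norm (damp c \<theta> s) \<le> exp (\<bar>c\<bar> * norm s powr \<theta>)"
proof -
  have "Re (of_real c * s powr of_real \<theta>) \<le> norm (of_real c * s powr of_real \<theta>)" by (rule complex_Re_le_cmod)
  also have "\<dots> = \<bar>c\<bar> * norm s powr \<theta>" by (simp add: norm_mult norm_powr_real_powr')
  finally show ?thesis by (simp add: damp_def)
qed

definition damp_bound :: "real \<Rightarrow> real \<Rightarrow> real" where
  "damp_bound c \<theta> = exp (\<bar>c\<bar> * (1/2) powr \<theta>)"

lemma damp_bound_pos: "damp_bound c \<theta> > 0" by (simp add: damp_bound_def)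

lemma norm_damp_le_bound:
  assumes "\<theta> < 0" "norm s \<ge> 1/2"
  shows "norm (damp c \<theta> s) \<le> damp_bound c \<theta>"
proof -
  have "norm s powr \<theta> \<le> (1/2) powr \<theta>"
    using assms by (intro powr_mono2') auto
  thus ?thesis unfolding damp_bound_def
    by (intro order.trans[OF norm_damp_le]) (auto intro: mult_left_mono)
qed

lemma norm_sin_squared_sinh: "norm (sin z) ^ 2 = (sin (Re z))\<^sup>2 + (sinh (Im z))\<^sup>2"
proof -
  have e: "exp (2 * Im z) = (exp (Im z))\<^sup>2" by (simp add: exp_double)
  have "cos (2 * Re z) = 1 - 2 * (sin (Re z))\<^sup>2" by (simp add: cos_double_sin)
  moreover have "(sinh (Im z))\<^sup>2 = (exp (2 * Im z) + inverse (exp (2 * Im z)) - 2) / 4"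
    unfolding e sinh_def by (simp add: power2_eq_square field_simps exp_minus)
  ultimately show ?thesis by (simp add: norm_sin_squared)
qed

text \<open>The two situations that occur on the contours: points away from the real axis, and points on the
vertical lines through half-integers, where \<open>\<bar>sin (\<pi> s)\<bar> = cosh (\<pi> Im s)\<close>.\<close>

lemma norm_sin_pi_ge:
  assumes "\<bar>Im s\<bar> \<ge> 1/2 \<or> cos (pi * Re s) = 0"
  shows "norm (sin (of_real pi * s)) \<ge> exp (pi * \<bar>Im s\<bar>) / 4"
proof -
  define y where "y = pi * \<bar>Im s\<bar>"
  have y0: "y \<ge> 0" by (simp add: y_def)
  have sh: "(sinh (pi * Im s))\<^sup>2 = (sinh y)\<^sup>2" by (cases "Im s \<ge> 0") (auto simp: y_def)
  have n: "norm (sin (of_real pi * s)) ^ 2 = (sin (pi * Re s))\<^sup>2 + (sinh y)\<^sup>2"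
    using sh by (simp add: norm_sin_squared_sinh)
  have "(exp y / 4)\<^sup>2 \<le> norm (sin (of_real pi * s)) ^ 2"
  proof (cases "cos (pi * Re s) = 0")
    case True
    hence "(sin (pi * Re s))\<^sup>2 = 1" using sin_cos_squared_add[of "pi * Re s"] by simp
    hence "norm (sin (of_real pi * s)) ^ 2 = (cosh y)\<^sup>2"
      using n cosh_square_eq[of y] by simp
    moreover have "exp y / 4 \<le> cosh y" by (simp add: cosh_def) 
    ultimately show ?thesis by (simp add: power_mono)
  next
    case False
    hence "\<bar>Im s\<bar> \<ge> 1/2" using assms by blast
    hence "pi/2 \<le> y" unfolding y_def using mult_left_mono[of "1/2" "\<bar>Im s\<bar>" pi] by simp
    hence "1 \<le> y" using pi_gt3 by linarith
    hence "exp 1 \<le> exp y" by simp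
    hence "2 \<le> exp y" using exp_ge_add_one_self[of 1] by linarith
    hence "2 * 1 \<le> exp y * exp y" by (intro mult_mono) (use y0 in auto)
    hence "exp (-y) \<le> exp y / 2" unfolding exp_minus by (simp add: field_simps)
    hence "exp y / 4 \<le> sinh y" unfolding sinh_def by simp
    hence "(exp y / 4)\<^sup>2 \<le> (sinh y)\<^sup>2" by (rule power_mono) (use y0 in simp)
    thus ?thesis using n zero_le_power2[of "sin (pi * Re s)"] by linarith
  qed
  thus ?thesis unfolding y_def using power2_le_imp_le norm_ge_zero by blast
qed

text \<open>The growth \<open>exp (\<bar>Im L\<bar> \<bar>Im s\<bar>)\<close> of \<open>exp (s L)\<close> is beaten by the decay \<open>exp (-\<pi> \<bar>Im s\<bar>)\<close> of the sine
factor as long as \<open>\<bar>Im L\<bar> < \<pi>\<close>. For \<open>\<bar>Im L\<bar> = \<pi>\<close> boundedness remains, and this is what the bounds uniform in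
\<open>L\<close> rest on.\<close>

lemma norm_lindelof_le:
  assumes "\<theta> < 0" "norm s \<ge> 1/2" "\<bar>Im s\<bar> \<ge> 1/2 \<or> cos (pi * Re s) = 0"
  shows "norm (lindelof c \<theta> L s) \<le> 4 * pi * damp_bound c \<theta> * exp (Re s * Re L) * exp (- (pi - \<bar>Im L\<bar>) * \<bar>Im s\<bar>)"
proof -
  have "- Im s * Im L \<le> \<bar>Im s\<bar> * \<bar>Im L\<bar>" using abs_ge_minus_self[of "Im s * Im L"] by (simp add: abs_mult)
  hence 1: "norm (exp (s * L)) \<le> exp (Re s * Re L + \<bar>Im s\<bar> * \<bar>Im L\<bar>)" by simp
  have "pi / norm (sin (of_real pi * s)) \<le> pi / (exp (pi * \<bar>Im s\<bar>) / 4)"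
    by (intro divide_left_mono norm_sin_pi_ge assms mult_pos_pos order.strict_trans2[OF _ norm_sin_pi_ge]) auto
  hence 2: "norm (of_real pi / sin (of_real pi * s)) \<le> 4 * pi * exp (- pi * \<bar>Im s\<bar>)"
    by (simp add: norm_divide exp_minus field_simps)
  have "norm (lindelof c \<theta> L s) \<le> damp_bound c \<theta> * exp (Re s * Re L + \<bar>Im s\<bar> * \<bar>Im L\<bar>) * (4 * pi * exp (- pi
    * \<bar>Im s\<bar>))"
    unfolding lindelof_def norm_mult
    by (intro mult_mono 1 2 norm_damp_le_bound assms) (use damp_bound_pos in \<open>auto intro: less_imp_le\<close>)
  also have "\<dots> = 4 * pi * damp_bound c \<theta> * exp (Re s * Re L) * exp (- (pi - \<bar>Im L\<bar>) * \<bar>Im s\<bar>)"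
    by (simp add: exp_add[symmetric] algebra_simps)
  finally show ?thesis .
qed

text \<open>A complex Jordan inequality: \<open>\<bar>sin (x + iy)\<bar>\<^sup>2 = sin\<^sup>2 x + sinh\<^sup>2 y\<close>, where the first term is bounded
below by concavity of the sine.\<close>

lemma norm_sin_ge:
  assumes "\<bar>Re w\<bar> \<le> pi/2"
  shows "norm (sin w) \<ge> (2/pi) * norm w"
proof -
  have a: "(2/pi * x)\<^sup>2 \<le> (sin x)\<^sup>2" if "\<bar>x\<bar> \<le> pi/2" for x :: real
  proof -
    have "2/pi * \<bar>x\<bar> \<le> sin \<bar>x\<bar>"
    proof (cases "x = 0")
      case False
      define u where "u = 2/pi * \<bar>x\<bar>"
      have u: "0 \<le> u" "u \<le> 1" using that by (auto simp: u_def field_simps)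
      have "concave_on {0..pi} (sin :: real \<Rightarrow> real)"
        by (rule f''_le0_imp_concave[where f' = cos and f'' = "\<lambda>x. - sin x"])
           (auto intro!: derivative_eq_intros simp: sin_ge_zero)
      hence "sin ((1-u) *\<^sub>R 0 + u *\<^sub>R (pi/2)) \<ge> (1-u) * sin 0 + u * sin (pi/2)"
        by (intro concave_onD) (use u in auto)
      thus ?thesis by (simp add: u_def)
    qed auto
    moreover have "(sin \<bar>x\<bar>)\<^sup>2 = (sin x)\<^sup>2" by (cases "x \<ge> 0") auto
    moreover have "(2/pi*x)\<^sup>2 = (2/pi*\<bar>x\<bar>)\<^sup>2" unfolding power_mult_distrib by simp
    moreover have "(2/pi*\<bar>x\<bar>)\<^sup>2 \<le> (sin \<bar>x\<bar>)\<^sup>2" by (intro power_mono) (use calculation in auto)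
    ultimately show ?thesis by simp
  qed
  have b: "y\<^sup>2 \<le> (sinh y)\<^sup>2" for y :: real
  proof -
    have "\<bar>y\<bar> \<le> sinh \<bar>y\<bar>"
    proof -
      have "sinh 0 - 0 \<le> sinh \<bar>y\<bar> - \<bar>y\<bar>"
        by (rule DERIV_nonneg_imp_nondecreasing[where f = "\<lambda>y::real. sinh y - y"])
           (auto intro!: exI derivative_eq_intros cosh_real_ge_1)
      thus ?thesis by simp
    qed
    moreover have "(sinh \<bar>y\<bar>)\<^sup>2 = (sinh y)\<^sup>2" by (cases "y \<ge> 0") auto
    moreover have "\<bar>y\<bar>\<^sup>2 \<le> (sinh \<bar>y\<bar>)\<^sup>2" by (intro power_mono) (use calculation in auto)
    ultimately show ?thesis by simp
  qed
  have "(2/pi)^2 \<le> 1" using pi_gt3 by (intro power_le_one) (auto simp: field_simps)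
  hence "(2/pi * Im w)^2 \<le> (Im w)^2" unfolding power_mult_distrib
    by (intro mult_left_le_one_le) auto
  also have "\<dots> \<le> (sinh (Im w))\<^sup>2" by (rule b)
  finally have "(2/pi * Im w)^2 \<le> (sinh (Im w))\<^sup>2" .
  hence "(2/pi * norm w)\<^sup>2 \<le> (norm (sin w))\<^sup>2"
    using a[OF assms] unfolding norm_sin_squared_sinh power_mult_distrib cmod_power2[of w]
      by (simp add: distrib_left)
  thus ?thesis using power2_le_imp_le norm_ge_zero by blast
qed

lemma norm_pi_over_sin_le:
  assumes "\<bar>Re s\<bar> \<le> 1/2" "s \<noteq> 0"
  shows "norm (of_real pi / sin (of_real pi * s)) \<le> pi / (2 * norm s)"
proof -
  have "\<bar>Re (of_real pi * s)\<bar> = pi * \<bar>Re s\<bar>" by (simp add: abs_mult)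
  hence "norm (sin (of_real pi * s)) \<ge> 2 / pi * norm (of_real pi * s)"
    by (intro norm_sin_ge) (use assms in \<open>auto simp: field_simps\<close>)
  hence "norm (sin (of_real pi * s)) \<ge> 2 * norm s" by (simp add: norm_mult)
  moreover from this have "0 < norm (sin (of_real pi * s))" by (rule less_le_trans[rotated]) (use assms in simp)
  ultimately have "pi / norm (sin (of_real pi * s)) \<le> pi / (2 * norm s)"
    using assms by (intro divide_left_mono mult_pos_pos) auto
  thus ?thesis by (simp add: norm_divide)
qed

text \<open>With \<open>\<phi> = Im L\<close> this is \<open>s\<close> times the part of the integrand other than \<open>exp (c s powr \<theta> + s Re L)\<close>.\<close>

definition sine_factor :: "real \<Rightarrow> complex \<Rightarrow> complex" where
  "sine_factor \<phi> s = exp (\<i> * s * of_real \<phi>) * (of_real pi * s / sin (of_real pi * s))"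

lemma sine_factor_near_1:
  obtains C where "C \<ge> 0" "\<And>s \<phi>. s \<noteq> 0 \<Longrightarrow> norm s \<le> 1/2 \<Longrightarrow> \<bar>\<phi>\<bar> \<le> pi \<Longrightarrow> norm (sine_factor \<phi> s - 1) \<le> C * norm s"
proof -
  define C where "C = exp (pi/2) * pi * pi"
  show ?thesis
  proof (rule that[of C])
    show "C \<ge> 0" by (simp add: C_def)
    fix s :: complex and \<phi> :: real assume s: "s \<noteq> 0" "norm s \<le> 1/2" "\<bar>\<phi>\<bar> \<le> pi"
    define w where "w = of_real pi * s"
    have w: "norm w = pi * norm s" by (simp add: w_def norm_mult)
    have re: "\<bar>Re s\<bar> \<le> 1/2" using s abs_Re_le_cmod[of s] by linarith
    have im: "\<bar>Im s\<bar> \<le> 1/2" using s abs_Im_le_cmod[of s] by linarith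
    have "norm (sin w - (\<Sum>k\<le>1. complex_of_real (sin_coeff k) * w ^ k)) \<le> exp \<bar>Im w\<bar> * norm w ^ Suc 1 / fact 1"
      by (rule Taylor_sin)
    hence "norm (sin w - w) \<le> exp \<bar>Im w\<bar> * (norm w)\<^sup>2"
      by (simp add: sin_coeff_def numeral_2_eq_2)
    also have "\<dots> \<le> exp (pi/2) * (pi * norm s)\<^sup>2"
      unfolding w using im by (intro mult_right_mono) (auto simp: w_def abs_mult)
    finally have t: "norm (sin w - w) \<le> exp (pi/2) * (pi * norm s)\<^sup>2" .
    have n0: "sin w \<noteq> 0" 
    proof
      assume "sin w = 0"
      hence "Im s = 0 \<and> Re s \<in> \<int>" unfolding w_def by (rule sin_pi_eq_0_imp_int)
      then obtain n where "Im s = 0" "Re s = of_int n" by (auto elim: Ints_cases)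
      with re have "n = 0" by auto
      thus False using \<open>Im s = 0\<close> \<open>Re s = _\<close> s(1) by (simp add: complex_eq_iff)
    qed
    have p: "norm (of_real pi / sin w) \<le> pi / (2 * norm s)" unfolding w_def
      by (rule norm_pi_over_sin_le) (use re s in auto)
    have "w / sin w - 1 = (w - sin w) / of_real pi * (of_real pi / sin w)" using n0 by (simp add: field_simps)
    hence "norm (w / sin w - 1) = norm (sin w - w) / pi * norm (of_real pi / sin w)"
      by (simp add: norm_mult norm_divide norm_minus_commute)
    also have "\<dots> \<le> exp (pi/2) * (pi * norm s)\<^sup>2 / pi * (pi / (2 * norm s))"
      by (intro mult_mono divide_right_mono t p) auto
    also have "\<dots> = exp (pi/2) * pi * (pi/2) * norm s" using s by (simp add: power2_eq_square field_simps)
    finally have A: "norm (w / sin w - 1) \<le> exp (pi/2) * pi * (pi/2) * norm s" .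
    define x where "x = \<i> * s * of_real \<phi>"
    have nx: "norm x \<le> pi * norm s" using s unfolding x_def by (simp add: norm_mult mult.commute mult_mono)
    have rx: "\<bar>Re x\<bar> \<le> pi/2"
    proof -
      have "\<bar>Re x\<bar> = \<bar>Im s\<bar> * \<bar>\<phi>\<bar>" unfolding x_def by (simp add: abs_mult)
      also have "\<dots> \<le> 1/2 * pi" by (intro mult_mono im s) auto
      finally show ?thesis by simp
    qed
    have "norm (exp x - (\<Sum>k\<le>0. x^k / fact k)) \<le> exp \<bar>Re x\<bar> * norm x ^ Suc 0 / fact 0" by (rule Taylor_exp)
    hence "norm (exp x - 1) \<le> exp \<bar>Re x\<bar> * norm x" by simp
    also have "\<dots> \<le> exp (pi/2) * (pi * norm s)" by (intro mult_mono nx) (use rx in auto)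
    finally have B: "norm (exp x - 1) \<le> exp (pi/2) * (pi * norm s)" .
    have E: "norm (exp x) \<le> exp (pi/2)" using rx by simp
    have F: "norm (w / sin w) \<le> pi/2"
    proof -
      have "norm (w / sin w) = norm s * norm (of_real pi / sin w)" by (simp add: w_def norm_mult norm_divide)
      also have "\<dots> \<le> norm s * (pi / (2 * norm s))" by (intro mult_left_mono p) auto
      finally show ?thesis using s by simp
    qed
    have "sine_factor \<phi> s - 1 = (exp x - 1) * (w / sin w) + (w / sin w - 1)"
      unfolding sine_factor_def x_def[symmetric] w_def[symmetric] by (simp only: ring_distribs) simp
    also have "norm \<dots> \<le> norm (exp x - 1) * norm (w / sin w) + norm (w / sin w - 1)"
      by (metis norm_mult norm_triangle_ineq)
    also have "\<dots> \<le> exp (pi/2) * (pi * norm s) * (pi/2) + exp (pi/2) * pi * (pi/2) * norm s"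
      by (intro add_mono mult_mono A B F) auto
    also have "\<dots> = C * norm s" by (simp add: C_def)
    finally show "norm (sine_factor \<phi> s - 1) \<le> C * norm s" .
  qed
qed

section \<open>Integrals over vertical lines\<close>

text \<open>Improper integrals over vertical lines are limits of integrals over \<open>[-T, T]\<close>. The bounds below are
explicit in the constants so that the limits are locally uniform in \<open>L\<close>.\<close>

lemma integral_exp_decay_bound:
  fixes f :: "real \<Rightarrow> complex"
  assumes "continuous_on UNIV f" and "\<And>t. norm (f t) \<le> C * exp (- \<delta> * \<bar>t\<bar>)" and "\<delta> > 0"
    and "0 \<le> A" "A \<le> B"
  shows "norm (integral {A..B} f) \<le> C / \<delta> * exp (- \<delta> * A)"
proof -
  have C: "C \<ge> 0" using order.trans[OF norm_ge_zero assms(2)[of 0]] by simp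
  have "((\<lambda>t. C * exp (- \<delta> * t)) has_integral (- C / \<delta> * exp (- \<delta> * B) - (- C / \<delta> * exp (- \<delta> * A)))) {A..B}"
    by (rule fundamental_theorem_of_calculus)
       (use assms in \<open>auto intro!: derivative_eq_intros simp flip: has_real_derivative_iff_has_vector_derivative\<close>)
  note hi = this
  have "norm (integral {A..B} f) \<le> integral {A..B} (\<lambda>t. C * exp (- \<delta> * t))"
  proof (rule integral_norm_bound_integral)
    show "f integrable_on {A..B}"
      by (intro integrable_continuous_real continuous_on_subset[OF assms(1)]) auto
    show "(\<lambda>t. C * exp (- \<delta> * t)) integrable_on {A..B}" using hi by blast
    show "norm (f t) \<le> C * exp (- \<delta> * t)" if "t \<in> {A..B}" for t
      using assms(2)[of t] that assms(4) by simp
  qed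
  also have "\<dots> = C / \<delta> * exp (- \<delta> * A) - C / \<delta> * exp (- \<delta> * B)"
    using integral_unique[OF hi] by simp
  also have "\<dots> \<le> C / \<delta> * exp (- \<delta> * A)" using C assms by simp
  finally show ?thesis .
qed

lemma symmetric_integral_tail:
  fixes f :: "real \<Rightarrow> complex"
  assumes f: "continuous_on UNIV f" and b: "\<And>t. norm (f t) \<le> C * exp (- \<delta> * \<bar>t\<bar>)" and "\<delta> > 0"
    and "0 \<le> A" "A \<le> B"
  shows "norm (integral {-B..B} f - integral {-A..A} f) \<le> 2 * C / \<delta> * exp (- \<delta> * A)"
proof -
  have int: "f integrable_on {x..y}" for x y
    by (intro integrable_continuous_real continuous_on_subset[OF f]) auto
  have "integral {-B..B} f = integral {-B..-A} f + integral {-A..B} f"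
    by (rule Henstock_Kurzweil_Integration.integral_combine[symmetric]) (use assms int in auto)
  also have "integral {-A..B} f = integral {-A..A} f + integral {A..B} f"
    by (rule Henstock_Kurzweil_Integration.integral_combine[symmetric]) (use assms int in auto)
  also have "integral {-B..-A} f = integral {A..B} (\<lambda>x. f (-x))"
    using Henstock_Kurzweil_Integration.integral_reflect_real[of B A "\<lambda>x. f (-x)"] by simp
  finally have eq: "integral {-B..B} f - integral {-A..A} f
    = integral {A..B} (\<lambda>x. f (-x)) + integral {A..B} f" by simp
  have 1: "norm (integral {A..B} f) \<le> C / \<delta> * exp (- \<delta> * A)"
    by (rule integral_exp_decay_bound) (use assms in auto)
  have 2: "norm (integral {A..B} (\<lambda>x. f (-x))) \<le> C / \<delta> * exp (- \<delta> * A)"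
  proof (rule integral_exp_decay_bound)
    show "continuous_on UNIV (\<lambda>x. f (- x))"
      by (rule continuous_on_compose2[OF f]) (auto intro!: continuous_intros)
    show "norm (f (- t)) \<le> C * exp (- \<delta> * \<bar>t\<bar>)" for t using b[of "-t"] by simp
  qed (use assms in auto)
  have "norm (integral {A..B} (\<lambda>x. f (-x)) + integral {A..B} f) \<le> C / \<delta> * exp (- \<delta> * A) + C / \<delta> * exp (- \<delta> * A)"
    by (rule order.trans[OF norm_triangle_ineq add_mono[OF 2 1]])
  also have "\<dots> = 2 * C / \<delta> * exp (- \<delta> * A)" by simp
  finally show ?thesis unfolding eq .
qed

definition line_integral_limit :: "(real \<Rightarrow> complex) \<Rightarrow> complex" where
  "line_integral_limit f = lim (\<lambda>n::nat. integral {-real n..real n} f)"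

lemma line_integral_limit_bound:
  fixes f :: "real \<Rightarrow> complex"
  assumes f: "continuous_on UNIV f" and b: "\<And>t. norm (f t) \<le> C * exp (- \<delta> * \<bar>t\<bar>)" and d: "\<delta> > 0"
    and A: "0 \<le> A"
  shows "norm (line_integral_limit f - integral {-A..A} f) \<le> 2 * C / \<delta> * exp (- \<delta> * A)"
proof -
  have C: "C \<ge> 0" using order.trans[OF norm_ge_zero b[of 0]] by simp
  have ten: "(\<lambda>n::nat. 2 * C / \<delta> * exp (- \<delta> * real n)) \<longlonglongrightarrow> 0"
    using d by real_asymp
  have "Cauchy (\<lambda>n::nat. integral {-real n..real n} f)"
  proof (rule CauchyI)
    fix e :: real assume "e > 0"
    with ten obtain N where N: "\<And>n. n \<ge> N \<Longrightarrow> \<bar>2 * C / \<delta> * exp (- \<delta> * real n)\<bar> < e"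
      by (fastforce simp: LIMSEQ_iff)
    show "\<exists>M. \<forall>m\<ge>M. \<forall>n\<ge>M. norm (integral {- real m..real m} f - integral {- real n..real n} f) < e"
    proof (intro exI[of _ N] allI impI)
      fix m n assume mn: "m \<ge> N" "n \<ge> N"
      have *: "norm (integral {- real m..real m} f - integral {- real n..real n} f) < e" if "m \<ge> n" "n \<ge> N" for m n
        using order.strict_trans1[OF order.trans[OF symmetric_integral_tail[OF f b d, of "real n" "real m"]
          abs_ge_self] N[of n]] that by simp
      show "norm (integral {- real m..real m} f - integral {- real n..real n} f) < e"
        using *[of m n] *[of n m] mn by (cases "m \<ge> n") (auto simp: norm_minus_commute)
    qed
  qed
  hence "(\<lambda>n::nat. integral {-real n..real n} f) \<longlonglongrightarrow> line_integral_limit f"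
    unfolding line_integral_limit_def by (simp add: Cauchy_convergent convergent_LIMSEQ_iff[symmetric])
  hence "(\<lambda>n::nat. norm (integral {-real n..real n} f - integral {-A..A} f)) \<longlonglongrightarrow> norm (line_integral_limit f
    - integral {-A..A} f)"
    by (intro tendsto_intros)
  thus ?thesis
  proof (rule tendsto_upperbound)
    have "\<forall>\<^sub>F n::nat in sequentially. real n \<ge> A" by real_asymp
    thus "\<forall>\<^sub>F n in sequentially. norm (integral {- real n..real n} f - integral {- A..A} f)
      \<le> 2 * C / \<delta> * exp (- \<delta> * A)"
      by eventually_elim (use symmetric_integral_tail[OF f b d A] in auto)
  qed auto
qed

lemma line_integral_limit_tendsto:
  fixes f :: "real \<Rightarrow> complex"
  assumes f: "continuous_on UNIV f" and b: "\<And>t. norm (f t) \<le> C * exp (- \<delta> * \<bar>t\<bar>)" and d: "\<delta> > 0"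
  shows "((\<lambda>T. integral {-T..T} f) \<longlongrightarrow> line_integral_limit f) at_top"
proof (rule Lim_transform_eventually[OF _ eventually_mono[OF eventually_ge_at_top[of 0]]])
  have ten: "((\<lambda>T. 2 * C / \<delta> * exp (- \<delta> * T)) \<longlongrightarrow> 0) at_top" using d by real_asymp
  have "((\<lambda>T. integral {-T..T} f - line_integral_limit f) \<longlongrightarrow> 0) at_top"
    by (rule Lim_null_comparison[OF _ ten], rule eventually_mono[OF eventually_ge_at_top[of 0]])
       (use line_integral_limit_bound[OF f b d] in \<open>simp add: norm_minus_commute\<close>)
  thus "((\<lambda>T. integral {-T..T} f) \<longlongrightarrow> line_integral_limit f) at_top" by (simp add: LIM_zero_iff)
qed auto

definition lindelof_on_line :: "real \<Rightarrow> real \<Rightarrow> complex \<Rightarrow> real \<Rightarrow> real \<Rightarrow> complex" where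
  "lindelof_on_line c \<theta> L x t = lindelof c \<theta> L (Complex x t)"

lemma cos_half_integer_line: "cos (pi * (real n + 1/2)) = 0"
  by (simp add: distrib_left cos_add)

lemma half_integer_nonint: "real n + 1/2 \<notin> \<int>"
proof
  assume "real n + 1/2 \<in> \<int>"
  then obtain k where "real n + 1/2 = of_int k" by (auto elim: Ints_cases)
  hence "2 * int n + 1 = 2 * k" by linarith
  thus False by presburger
qed

lemma continuous_on_lindelof_on_line: "continuous_on UNIV (lindelof_on_line c \<theta> L (real n + 1/2))"
proof -
  have "lindelof c \<theta> L holomorphic_on {s. Re s = real n + 1/2}"
  proof (rule lindelof_holomorphic)
    fix s :: complex assume s: "s \<in> {s. Re s = real n + 1/2}"
    thus "s \<notin> \<real>\<^sub>\<le>\<^sub>0" by (auto simp: complex_nonpos_Reals_iff)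
    show "sin (of_real pi * s) \<noteq> 0" using half_integer_nonint[of n] sin_pi_eq_0_imp_int[of s] s by fastforce
  qed
  hence "continuous_on {s. Re s = real n + 1/2} (lindelof c \<theta> L)" by (rule holomorphic_on_imp_continuous_on)
  thus ?thesis unfolding lindelof_on_line_def
    by (rule continuous_on_compose2) (auto intro!: continuous_intros simp: Complex_eq)
qed

lemma norm_lindelof_on_line_le:
  assumes "\<theta> < 0"
  shows "norm (lindelof_on_line c \<theta> L (real n + 1/2) t) \<le>
           4 * pi * damp_bound c \<theta> * exp ((real n + 1/2) * Re L) * exp (- (pi - \<bar>Im L\<bar>) * \<bar>t\<bar>)"
proof -
  have "1/2 \<le> \<bar>Re (Complex (real n + 1/2) t)\<bar>" by simp
  also have "\<dots> \<le> norm (Complex (real n + 1/2) t)" by (rule abs_Re_le_cmod)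
  finally show ?thesis unfolding lindelof_on_line_def
    using norm_lindelof_le[of \<theta> "Complex (real n + 1/2) t" c L] assms cos_half_integer_line[of n] by simp
qed

definition lindelof_line_integral :: "real \<Rightarrow> real \<Rightarrow> nat \<Rightarrow> complex \<Rightarrow> complex" where
  "lindelof_line_integral c \<theta> n L = line_integral_limit (lindelof_on_line c \<theta> L (real n + 1/2))"

text \<open>The image of the plane cut along the negative axis under \<open>Ln\<close>. Working with \<open>L = Ln z\<close> instead of \<open>z\<close>
turns \<open>z^s\<close> into \<open>exp (s L)\<close>, and the strip is convex.\<close>

definition log_strip :: "complex set" where "log_strip = {L. \<bar>Im L\<bar> < pi}"

lemma open_log_strip: "open log_strip"
proof -
  have eq: "log_strip = {L. Im L < pi} \<inter> {L. Im L > - pi}" by (auto simp: log_strip_def)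
  show ?thesis unfolding eq by (intro open_Int open_halfspace_Im_lt open_halfspace_Im_gt)
qed

lemma convex_log_strip: "convex log_strip"
proof -
  have eq: "log_strip = {L. Im L < pi} \<inter> {L. Im L > - pi}" by (auto simp: log_strip_def)
  show ?thesis unfolding eq by (intro convex_Int convex_halfspace_Im_lt convex_halfspace_Im_gt)
qed

lemma Ln_in_log_strip:
  assumes "z \<notin> \<real>\<^sub>\<le>\<^sub>0"
  shows "Ln z \<in> log_strip"
proof -
  have nz: "z \<noteq> 0" using assms by auto
  have "Im (Ln z) \<noteq> pi" using assms nz Im_Ln_eq_pi[of z] by (auto simp: complex_nonpos_Reals_iff)
  moreover have "- pi < Im (Ln z)" "Im (Ln z) \<le> pi" using nz by (auto intro: mpi_less_Im_Ln Im_Ln_le_pi)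
  ultimately show ?thesis by (simp add: log_strip_def)
qed

lemma lindelof_line_integral_holomorphic:
  assumes "\<theta> < 0"
  shows "lindelof_line_integral c \<theta> 0 holomorphic_on log_strip"
proof (rule holomorphic_uniform_sequence[OF open_log_strip])
  fix N :: nat
  have cd: "continuous_on UNIV (\<lambda>t. damp c \<theta> (Complex (1/2) t))"
  proof -
    have "damp c \<theta> holomorphic_on {s. Re s = 1/2}"
      by (rule damp_holomorphic) (auto simp: complex_nonpos_Reals_iff)
    hence "continuous_on {s. Re s = 1/2} (damp c \<theta>)" by (rule holomorphic_on_imp_continuous_on)
    thus ?thesis
      by (rule continuous_on_compose2) (auto intro!: continuous_intros simp: Complex_eq)
  qed
  have sn: "sin (of_real pi * Complex (1/2) t) \<noteq> 0" for t
    by (rule sin_pi_nonzero_gapped, unfold gapped_plane_def, simp)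
  have "(\<lambda>L. integral (cbox (-real N) (real N)) (\<lambda>t. lindelof_on_line c \<theta> L (1/2) t)) holomorphic_on log_strip"
  proof (rule leibniz_rule_holomorphic[where fx = "\<lambda>L t. Complex (1/2) t * lindelof c \<theta> L (Complex (1/2) t)"])
    show "((\<lambda>x. lindelof_on_line c \<theta> x (1/2) t) has_field_derivative
         Complex (1/2) t * lindelof c \<theta> L (Complex (1/2) t)) (at L within log_strip)" for L t
      unfolding lindelof_on_line_def lindelof_def
      by (auto intro!: derivative_eq_intros simp: sn)
    show "lindelof_on_line c \<theta> L (1/2) integrable_on cbox (- real N) (real N)" for L
      using integrable_continuous_real[OF continuous_on_subset[OF continuous_on_lindelof_on_line[of c \<theta> L 0]
        subset_UNIV]]
      by simp
    show "continuous_on (log_strip \<times> cbox (- real N) (real N))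
     (\<lambda>(L, t). Complex (1 / 2) t * lindelof c \<theta> L (Complex (1 / 2) t))"
      unfolding lindelof_def case_prod_unfold
      by (intro continuous_intros continuous_on_compose2[OF cd] ballI) (auto simp: sn simp flip: Complex_eq
        intro!: continuous_intros)
  qed (rule convex_log_strip)
  thus "(\<lambda>L. integral {-real N..real N} (lindelof_on_line c \<theta> L (real 0 + 1/2))) holomorphic_on log_strip" by simp
next
  fix L0 assume "L0 \<in> log_strip"
  \<comment> \<open>Half the distance of \<open>L0\<close> to the boundary of the strip: on this disc the decay rate is at least \<open>d\<close>.\<close>
  define d where "d = (pi - \<bar>Im L0\<bar>) / 2"
  have d: "d > 0" using \<open>L0 \<in> log_strip\<close> by (simp add: d_def log_strip_def)
  have im: "pi - \<bar>Im L\<bar> \<ge> d" and re: "Re L \<le> Re L0 + d" if "L \<in> cball L0 d" for L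
  proof -
    have "norm (L - L0) \<le> d" using that by (simp add: dist_norm norm_minus_commute)
    hence "\<bar>Im (L - L0)\<bar> \<le> d" "\<bar>Re (L - L0)\<bar> \<le> d" using abs_Im_le_cmod abs_Re_le_cmod order.trans by blast+
    hence *: "\<bar>Im L - Im L0\<bar> \<le> d" "\<bar>Re L - Re L0\<bar> \<le> d" by simp_all
    have "2 * d = pi - \<bar>Im L0\<bar>" by (simp only: d_def) simp
    thus "pi - \<bar>Im L\<bar> \<ge> d" using *(1) by linarith
    show "Re L \<le> Re L0 + d" using *(2) by linarith
  qed
  define C where "C = 4 * pi * damp_bound c \<theta> * exp (1/2 * (Re L0 + d))"
  have C: "C > 0" by (simp add: C_def damp_bound_pos)
  have b: "norm (lindelof_on_line c \<theta> L (real 0 + 1/2) t) \<le> C * exp (- d * \<bar>t\<bar>)" if "L \<in> cball L0 d" for L t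
  proof -
    have "norm (lindelof_on_line c \<theta> L (real 0 + 1/2) t) \<le>
           4 * pi * damp_bound c \<theta> * exp ((real 0 + 1/2) * Re L) * exp (- (pi - \<bar>Im L\<bar>) * \<bar>t\<bar>)"
      by (rule norm_lindelof_on_line_le) fact
    also have "\<dots> \<le> C * exp (- d * \<bar>t\<bar>)"
    proof -
      have "- (pi - \<bar>Im L\<bar>) * \<bar>t\<bar> \<le> - d * \<bar>t\<bar>" using im[OF that] by (intro mult_right_mono) auto
      moreover have "(real 0 + 1/2) * Re L \<le> 1/2 * (Re L0 + d)" using re[OF that] by simp
      ultimately show ?thesis unfolding C_def
        using damp_bound_pos[of c \<theta>] by (intro mult_mono order.refl) (auto simp del: mult_minus_left)
    qed
    finally show ?thesis .
  qed
  have bb: "norm (lindelof_line_integral c \<theta> 0 L - integral {-real N..real N} (lindelof_on_line c \<theta> L (real 0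
    + 1/2))) \<le> 2 * C / d * exp (- d * real N)"
    if "L \<in> cball L0 d" for L N
    unfolding lindelof_line_integral_def
    by (rule line_integral_limit_bound[OF continuous_on_lindelof_on_line b[OF that] d]) simp
  have ten: "(\<lambda>n::nat. 2 * C / d * exp (- d * real n)) \<longlonglongrightarrow> 0"
    using d by real_asymp
  have "uniform_limit (cball L0 d) (\<lambda>N L. integral {-real N..real N} (lindelof_on_line c \<theta> L (real 0
    + 1/2))) (lindelof_line_integral c \<theta> 0) sequentially"
  proof (rule uniform_limitI)
    fix e :: real assume "e > 0"
    hence "\<forall>\<^sub>F n::nat in sequentially. 2 * C / d * exp (- d * real n) < e"
      by (rule order_tendstoD(2)[OF ten])
    thus "\<forall>\<^sub>F n in sequentially. \<forall>L\<in>cball L0 d. dist (integral {- real n..real n} (lindelof_on_line c \<theta> L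
      (real 0 + 1 / 2))) (lindelof_line_integral c \<theta> 0 L) < e"
    proof (eventually_elim, intro ballI)
      fix n :: nat and L assume "2 * C / d * exp (- d * real n) < e" and "L \<in> cball L0 d"
      with bb[of L n] show "dist (integral {- real n..real n} (lindelof_on_line c \<theta> L (real 0
        + 1 / 2))) (lindelof_line_integral c \<theta> 0 L) < e"
        unfolding dist_norm norm_minus_commute[of "integral _ _"] by (meson le_less_trans)
    qed
  qed
  moreover have "cball L0 d \<subseteq> log_strip" using im d by (force simp: log_strip_def)
  ultimately show "\<exists>d>0. cball L0 d \<subseteq> log_strip \<and> uniform_limit (cball L0 d) (\<lambda>N L. integral {-real N..real N}
    (lindelof_on_line c \<theta> L (real 0 + 1/2))) (lindelof_line_integral c \<theta> 0) sequentially"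
    using d by blast
qed

section \<open>The continuation as a line integral\<close>

lemma has_contour_integral_vertical_lindelof:
  assumes "T > 0"
  shows "(lindelof c \<theta> L has_contour_integral \<i> * integral {-T..T} (lindelof_on_line c \<theta> L (real n + 1/2)))
           (linepath (Complex (real n + 1/2) (-T)) (Complex (real n + 1/2) T))"
proof -
  have "(lindelof_on_line c \<theta> L (real n + 1/2)) integrable_on {-T..T}"
    using integrable_continuous_real[OF continuous_on_subset[OF continuous_on_lindelof_on_line subset_UNIV]] .
  hence "(lindelof_on_line c \<theta> L (real n + 1/2) has_integral - \<i> * (\<i>
    * integral {-T..T} (lindelof_on_line c \<theta> L (real n + 1/2)))) {-T..T}"
    by (simp add: integrable_integral flip: mult.assoc)
  thus ?thesis unfolding lindelof_on_line_def
    by (subst has_contour_integral_linepath_same_Re_iff) (use assms in auto)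
qed

lemma residue_lindelof:
  fixes n :: nat
  assumes "n \<ge> 1"
  defines "S \<equiv> {s. real n - 1 < Re s \<and> Re s < real n + 1}"
  shows "residue (lindelof c \<theta> L) (of_nat n) = (-1) ^ n * damp c \<theta> (of_nat n) * exp (of_nat n * L)"
    and "lindelof c \<theta> L holomorphic_on S - {of_nat n}"
    and "open S" and "convex S" and "of_nat n \<in> S"
proof -
  have eq: "S = {s. Re s > real n - 1} \<inter> {s. Re s < real n + 1}" by (auto simp: S_def)
  show op: "open S" unfolding eq by (intro open_Int open_halfspace_Re_gt open_halfspace_Re_lt)
  show "convex S" unfolding eq by (intro convex_Int convex_halfspace_Re_gt convex_halfspace_Re_lt)
  show nS: "of_nat n \<in> S" by (simp add: S_def)
  have np: "s \<notin> \<real>\<^sub>\<le>\<^sub>0" if "s \<in> S" for s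
    using that assms(1) by (auto simp: S_def complex_nonpos_Reals_iff)
  show hol: "lindelof c \<theta> L holomorphic_on S - {of_nat n}"
  proof (rule lindelof_holomorphic)
    fix s assume s: "s \<in> S - {of_nat n}"
    thus "s \<notin> \<real>\<^sub>\<le>\<^sub>0" using np by blast
    show "sin (of_real pi * s) \<noteq> 0"
    proof
      assume "sin (of_real pi * s) = 0"
      from sin_pi_eq_0_imp_int[OF this] obtain k where k: "Im s = 0" "Re s = of_int k" by (auto elim: Ints_cases)
      with s have "k = int n" unfolding S_def by auto
      with k s show False by (auto simp: complex_eq_iff)
    qed
  qed
  show "residue (lindelof c \<theta> L) (of_nat n) = (-1) ^ n * damp c \<theta> (of_nat n) * exp (of_nat n * L)"
  proof (rule residue_simple'[OF op nS hol])
    have cs: "cos (of_real pi * of_nat n) = ((-1) ^ n :: complex)"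
      by (metis cos_npi2 cos_of_real of_real_minus of_real_1 of_real_mult of_real_of_nat_eq of_real_power)
    have sn: "sin (of_real pi * of_nat n) = (0 :: complex)"
      by (metis of_real_0 of_real_mult of_real_of_nat_eq sin_npi2 sin_of_real)
    have "((\<lambda>s. sin (of_real pi * s)) has_field_derivative cos (of_real pi * of_nat n)
      * (of_real pi)) (at (of_nat n :: complex))"
      by (auto intro!: derivative_eq_intros)
    hence "((\<lambda>s. sin (of_real pi * s) / (s - of_nat n)) \<longlongrightarrow> (-1)^n * of_real pi) (at (of_nat n :: complex))"
      unfolding has_field_derivative_iff cs sn by simp
    hence 1: "((\<lambda>s. of_real pi / (sin (of_real pi * s) / (s - of_nat n))) \<longlongrightarrow> of_real pi / ((-1)^n
      * of_real pi)) (at (of_nat n :: complex))"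
      by (intro tendsto_intros) auto
    have "continuous_on S (\<lambda>s. damp c \<theta> s * exp (s * L))"
      by (intro continuous_intros holomorphic_on_imp_continuous_on damp_holomorphic np)
    hence "isCont (\<lambda>s. damp c \<theta> s * exp (s * L)) (of_nat n)"
      using op nS by (simp add: continuous_on_eq_continuous_at)
    hence 2: "((\<lambda>s. damp c \<theta> s * exp (s * L)) \<longlongrightarrow> damp c \<theta> (of_nat n) * exp (of_nat n * L)) (at (of_nat n))"
      by (simp add: isCont_def)
    have "of_real pi / ((-1)^n * of_real pi) = ((-1)^n :: complex)"
      by (cases "even n") auto
    thus "((\<lambda>w. lindelof c \<theta> L w * (w - of_nat n)) \<longlongrightarrow> (-1) ^ n * damp c \<theta> (of_nat n) * exp (of_nat n
      * L)) (at (of_nat n))"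
      using tendsto_mult[OF 2 1] by (simp add: lindelof_def mult_ac)
  qed
qed

text \<open>The residue theorem for the rectangle with vertical sides through \<open>n + 1/2\<close> and \<open>n + 3/2\<close>. Moving the
line by one unit at a time keeps a single pole inside; the series then arises by telescoping.\<close>

lemma lindelof_rectangle:
  fixes n :: nat
  assumes "T > 0"
  shows "contour_integral (linepath (Complex (real n + 1/2) (-T)) (Complex (real n + 3/2) (-T))) (lindelof c \<theta> L)
    + \<i> * integral {-T..T} (lindelof_on_line c \<theta> L (real (Suc n) + 1/2))
    + contour_integral (linepath (Complex (real n + 3/2) T) (Complex (real n + 1/2) T)) (lindelof c \<theta> L)
    - \<i> * integral {-T..T} (lindelof_on_line c \<theta> L (real n + 1/2))
    = 2 * pi * \<i> * ((-1) ^ Suc n * damp c \<theta> (of_nat (Suc n)) * exp (of_nat (Suc n) * L))"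
proof -
  define S where "S = {s. real (Suc n) - 1 < Re s \<and> Re s < real (Suc n) + 1}"
  define g where "g = lindelof c \<theta> L"
  define a1 where "a1 = Complex (real n + 1/2) (-T)"
  define a2 where "a2 = Complex (real n + 3/2) (-T)"
  define a3 where "a3 = Complex (real n + 3/2) T"
  define a4 where "a4 = Complex (real n + 1/2) T"
  note a_defs = a1_def a2_def a3_def a4_def
  note res = residue_lindelof[where n = "Suc n", folded S_def]
  have pim: "path_image (rectpath a1 a3) \<subseteq> S - {of_nat (Suc n)}"
    by (subst path_image_rectpath) (use assms in \<open>auto simp: a_defs S_def complex_eq_iff\<close>)
  have rp: "rectpath a1 a3 = linepath a1 a2 +++ linepath a2 a3 +++ linepath a3 a4 +++ linepath a4 a1"
    by (simp add: rectpath_def Let_def a_defs)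
  have w: "winding_number (rectpath a1 a3) (of_nat (Suc n)) = 1"
    by (rule winding_number_rectpath) (use assms in \<open>auto simp: a_defs in_box_complex_iff\<close>)
  have "contour_integral (rectpath a1 a3) g = 2 * pi * \<i>
    * (\<Sum>p\<in>{of_nat (Suc n)}. winding_number (rectpath a1 a3) p * residue g p)"
  proof (rule Residue_theorem[where S = S])
    show "g holomorphic_on S - {of_nat (Suc n)}" unfolding g_def by (rule res(2)) simp
    show "\<forall>z. z \<notin> S \<longrightarrow> winding_number (rectpath a1 a3) z = 0"
      using pim res(4) by (auto intro!: winding_number_zero_outside[of _ S])
    show "open S" using res by simp
    show "connected S" using res by (simp add: convex_connected)
  qed (use pim in auto)
  hence eq: "contour_integral (rectpath a1 a3) g = 2 * pi * \<i> * ((-1) ^ Suc n * damp c \<theta> (of_nat (Suc n))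
    * exp (of_nat (Suc n) * L))"
    using w res(1) unfolding g_def by simp
  have cg: "continuous_on (S - {of_nat (Suc n)}) g"
    unfolding g_def by (intro holomorphic_on_imp_continuous_on res) simp
  have ci: "g contour_integrable_on linepath a b" if "closed_segment a b \<subseteq> path_image (rectpath a1 a3)" for a b
    by (intro contour_integrable_continuous_linepath continuous_on_subset[OF cg]) (use that pim in auto)
  have pi': "path_image (rectpath a1 a3) = closed_segment a1 a2 \<union> (closed_segment a2 a3 \<union> (closed_segment a3
    a4 \<union> closed_segment a4 a1))"
    unfolding rp by (simp add: path_image_join)
  have ci1: "g contour_integrable_on linepath a1 a2" "g contour_integrable_on linepath a2 a3"
     "g contour_integrable_on linepath a3 a4" "g contour_integrable_on linepath a4 a1"
    by (intro ci, use pi' in blast)+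
  have "contour_integral (rectpath a1 a3) g = contour_integral (linepath a1 a2) g
    + (contour_integral (linepath a2 a3) g
     + (contour_integral (linepath a3 a4) g + contour_integral (linepath a4 a1) g))"
    unfolding rp using ci1
    by (simp add: contour_integral_join contour_integrable_joinI valid_path_join)
  moreover have "contour_integral (linepath a4 a1) g = - contour_integral (linepath a1 a4) g"
    using contour_integral_reverse_linepath[of a4 a1]
      continuous_on_subset[OF cg, of "closed_segment a4 a1"] pi' pim by fastforce
  moreover have "contour_integral (linepath a1 a4) g
    = \<i> * integral {-T..T} (lindelof_on_line c \<theta> L (real n + 1/2))"
    unfolding g_def a_defs using has_contour_integral_vertical_lindelof[OF assms] by (rule contour_integral_unique)
  moreover have "contour_integral (linepath a2 a3) g
    = \<i> * integral {-T..T} (lindelof_on_line c \<theta> L (real (Suc n) + 1/2))"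
  proof -
    have "real n + 3/2 = real (Suc n) + 1/2" by simp
    thus ?thesis unfolding g_def a_defs using has_contour_integral_vertical_lindelof[OF assms, of c \<theta> L "Suc n"]
      by (simp only:) (rule contour_integral_unique)
  qed
  ultimately show ?thesis using eq unfolding g_def a_defs by (simp add: algebra_simps)
qed

lemma horizontal_lindelof_tendsto_0:
  assumes "\<theta> < 0" "L \<in> log_strip" and x: "0 < x1" "0 < x2" and s: "\<And>T. T > 0 \<Longrightarrow> \<bar>y T\<bar> = T"
  shows "((\<lambda>T. contour_integral (linepath (Complex x1 (y T)) (Complex x2 (y T))) (lindelof c \<theta> L)) \<longlongrightarrow> 0) at_top"
proof -
  define K where "K = 4 * pi * damp_bound c \<theta> * exp (max x1 x2 * \<bar>Re L\<bar>)"
  have K: "K > 0" by (simp add: K_def damp_bound_pos)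
  have d: "pi - \<bar>Im L\<bar> > 0" using assms by (simp add: log_strip_def)
  have "norm (contour_integral (linepath (Complex x1 (y T)) (Complex x2 (y T))) (lindelof c \<theta> L)) \<le> 
          K * exp (- (pi - \<bar>Im L\<bar>) * T) * \<bar>x2 - x1\<bar>" if T: "T \<ge> 1" for T
  proof -
    have seg: "Im s = y T \<and> min x1 x2 \<le> Re s \<and> Re s \<le> max x1 x2"
      if "s \<in> closed_segment (Complex x1 (y T)) (Complex x2 (y T))" for s
      using that by (auto simp: closed_segment_same_Im closed_segment_eq_real_ivl split: if_splits)
    have "norm (contour_integral (linepath (Complex x1 (y T)) (Complex x2 (y T))) (lindelof c \<theta> L)) \<le> 
       K * exp (- (pi - \<bar>Im L\<bar>) * T) * norm (Complex x2 (y T) - Complex x1 (y T))"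
    proof (rule contour_integral_bound_linepath)
      show "lindelof c \<theta> L contour_integrable_on linepath (Complex x1 (y T)) (Complex x2 (y T))"
        by (intro contour_integrable_continuous_linepath continuous_on_subset[OF
          holomorphic_on_imp_continuous_on[OF lindelof_holomorphic_gapped]])
           (use seg s[of T] T in \<open>force simp: gapped_plane_def\<close>)
      fix s assume "s \<in> closed_segment (Complex x1 (y T)) (Complex x2 (y T))"
      note sg = seg[OF this]
      have i: "\<bar>Im s\<bar> = T" using sg s T by simp
      have "norm (lindelof c \<theta> L s) \<le> 4 * pi * damp_bound c \<theta> * exp (Re s * Re L) * exp (- (pi - \<bar>Im L\<bar>) * \<bar>Im s\<bar>)"
        by (rule norm_lindelof_le) (use assms i T abs_Im_le_cmod[of s] in auto)
      also have "\<dots> \<le> K * exp (- (pi - \<bar>Im L\<bar>) * T)"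
      proof -
        have "Re s * Re L \<le> \<bar>Re s\<bar> * \<bar>Re L\<bar>" by (metis abs_ge_self abs_mult)
        also have "\<dots> \<le> max x1 x2 * \<bar>Re L\<bar>" using sg x by (intro mult_right_mono) auto
        finally show ?thesis unfolding K_def i using damp_bound_pos[of c \<theta>] by (auto intro!: mult_left_mono)
      qed
      finally show "norm (lindelof c \<theta> L s) \<le> K * exp (- (pi - \<bar>Im L\<bar>) * T)" .
    qed (use K in auto)
    thus ?thesis by (simp add: Complex_eq norm_mult flip: of_real_diff)
  qed
  note b = this
  have ten: "((\<lambda>T. K * exp (- (pi - \<bar>Im L\<bar>) * T) * \<bar>x2 - x1\<bar>) \<longlongrightarrow> 0) at_top" 
    using d by real_asymp
  show ?thesis
    by (rule Lim_null_comparison[OF eventually_mono[OF eventually_ge_at_top[of 1]] ten]) (rule b)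
qed

lemma lindelof_on_line_tendsto:
  assumes "\<theta> < 0" "L \<in> log_strip"
  shows "((\<lambda>T. integral {-T..T} (lindelof_on_line c \<theta> L (real n + 1/2))) \<longlongrightarrow> lindelof_line_integral c \<theta> n L) at_top"
  unfolding lindelof_line_integral_def
  by (rule line_integral_limit_tendsto[OF continuous_on_lindelof_on_line norm_lindelof_on_line_le[OF assms(1)]])
     (use assms(2) in \<open>auto simp: log_strip_def\<close>)

text \<open>For \<open>T \<rightarrow> \<infinity>\<close> the horizontal sides of the rectangle drop out.\<close>

lemma lindelof_line_integral_Suc:
  assumes "\<theta> < 0" "L \<in> log_strip"
  shows "lindelof_line_integral c \<theta> (Suc n) L - lindelof_line_integral c \<theta> n L =
           2 * pi * ((-1) ^ Suc n * damp c \<theta> (of_nat (Suc n)) * exp (of_nat (Suc n) * L))"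
proof -
  define R where "R = (-1) ^ Suc n * damp c \<theta> (of_nat (Suc n)) * exp (of_nat (Suc n) * L)"
  define J where "J = (\<lambda>m T. integral {-T..T} (lindelof_on_line c \<theta> L (real m + 1/2)))"
  define bot where "bot = (\<lambda>T. contour_integral (linepath (Complex (real n + 1/2) (-T)) (Complex (real n
    + 3/2) (-T))) (lindelof c \<theta> L))"
  define top where "top = (\<lambda>T. contour_integral (linepath (Complex (real n + 3/2) T) (Complex (real n
    + 1/2) T)) (lindelof c \<theta> L))"
  have "(bot \<longlongrightarrow> 0) at_top" "(top \<longlongrightarrow> 0) at_top"
    unfolding bot_def top_def by (rule horizontal_lindelof_tendsto_0[OF assms]; simp)+
  moreover have "(J m \<longlongrightarrow> lindelof_line_integral c \<theta> m L) at_top" for m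
    unfolding J_def by (rule lindelof_on_line_tendsto[OF assms])
  ultimately have "((\<lambda>T. bot T + \<i> * J (Suc n) T + top T - \<i> * J n T) \<longlongrightarrow>
      0 + \<i> * lindelof_line_integral c \<theta> (Suc n) L + 0 - \<i> * lindelof_line_integral c \<theta> n L) at_top"
    by (intro tendsto_intros)
  moreover have "eventually (\<lambda>T. bot T + \<i> * J (Suc n) T + top T - \<i> * J n T = 2 * pi * \<i> * R) at_top"
    using eventually_gt_at_top[of 0]
    by eventually_elim (unfold bot_def top_def J_def R_def, rule lindelof_rectangle)
  hence "((\<lambda>T. bot T + \<i> * J (Suc n) T + top T - \<i> * J n T) \<longlongrightarrow> 2 * pi * \<i> * R) at_top"
    by (rule tendsto_eventually)
  ultimately have "0 + \<i> * lindelof_line_integral c \<theta> (Suc n) L + 0 - \<i> * lindelof_line_integral c \<theta> n L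
    = 2 * pi * \<i> * R"
    by (rule tendsto_unique[OF trivial_limit_at_top_linorder])
  hence "\<i> * (lindelof_line_integral c \<theta> (Suc n) L - lindelof_line_integral c \<theta> n L) = \<i> * (2 * pi * R)"
    by (simp add: algebra_simps)
  thus ?thesis unfolding R_def[symmetric] mult_cancel_left by simp
qed

lemma norm_lindelof_line_integral_le:
  assumes "\<theta> < 0" "L \<in> log_strip"
  shows "norm (lindelof_line_integral c \<theta> n L) \<le>
           2 * (4 * pi * damp_bound c \<theta> * exp ((real n + 1/2) * Re L)) / (pi - \<bar>Im L\<bar>)"
  unfolding lindelof_line_integral_def
  using line_integral_limit_bound[OF continuous_on_lindelof_on_line norm_lindelof_on_line_le[OF assms(1)], of
    L 0 c n] assms(2)
  by (simp add: log_strip_def)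

lemma damp_of_nat: "damp c \<theta> (of_nat n) = of_real (exp (c * real n powr \<theta>))"
proof -
  have "(of_nat n :: complex) powr of_real \<theta> = of_real (real n powr \<theta>)"
    by (metis of_nat_0_le_iff of_real_of_nat_eq powr_of_real)
  thus ?thesis unfolding damp_def by (simp only: flip: of_real_mult exp_of_real)
qed

text \<open>For \<open>Re L < 0\<close> the integral over the line through \<open>n + 1/2\<close> decays like \<open>exp (n Re L)\<close>, so nothing is
left of it after infinitely many poles have been crossed.\<close>

lemma E_series_eq_line_integral:
  assumes "\<theta> < 0" "L \<in> log_strip" "Re L < 0"
  shows "E_series (exp L) c \<theta> = - lindelof_line_integral c \<theta> 0 L / (2 * pi)"
proof -
  define a where "a = (\<lambda>n. complex_of_real (exp (c * real (Suc n) powr \<theta>)) * (- exp L) ^ Suc n)"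
  have step: "lindelof_line_integral c \<theta> (Suc n) L - lindelof_line_integral c \<theta> n L = 2 * pi * a n" for n
    unfolding lindelof_line_integral_Suc[OF assms(1,2)] a_def damp_of_nat
    by (simp only: exp_of_nat_mult power_minus[of "exp L"]) (simp only: mult_ac of_real_mult of_real_numeral)
  have "(\<Sum>i<n. 2 * pi * a i) = lindelof_line_integral c \<theta> n L - lindelof_line_integral c \<theta> 0 L" for n
    unfolding step[symmetric] by (rule sum_lessThan_telescope)
  moreover have "(\<lambda>n. lindelof_line_integral c \<theta> n L - lindelof_line_integral c \<theta> 0 L) \<longlonglongrightarrow> 0
    - lindelof_line_integral c \<theta> 0 L"
  proof (intro tendsto_intros)
    define K where "K = 8 * pi * damp_bound c \<theta> / (pi - \<bar>Im L\<bar>)"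
    define x where "x = Re L"
    have "x < 0" using assms(3) by (simp add: x_def)
    hence "(\<lambda>n. K * exp ((real n + 1/2) * x)) \<longlonglongrightarrow> 0" by real_asymp
    hence lim: "(\<lambda>n. K * exp ((real n + 1/2) * Re L)) \<longlonglongrightarrow> 0" by (simp only: x_def)
    have bd: "norm (lindelof_line_integral c \<theta> n L) \<le> K * exp ((real n + 1/2) * Re L)" for n
      using norm_lindelof_line_integral_le[OF assms(1,2), of c n] by (simp add: K_def)
    show "(\<lambda>n. lindelof_line_integral c \<theta> n L) \<longlonglongrightarrow> 0"
      by (rule Lim_null_comparison[OF _ lim], rule always_eventually, rule allI, rule bd)
  qed
  ultimately have "(\<lambda>i. 2 * pi * a i) sums (- lindelof_line_integral c \<theta> 0 L)"
    by (simp add: sums_def)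
  hence "(\<lambda>i. (2 * pi * a i) / (2 * pi)) sums (- lindelof_line_integral c \<theta> 0 L / (2 * pi))"
    by (rule sums_divide)
  hence "a sums (- lindelof_line_integral c \<theta> 0 L / (2 * pi))" by simp
  thus ?thesis unfolding E_series_def a_def by (simp add: sums_iff)
qed

lemma E_series_holomorphic:
  assumes "\<theta> < 0"
  shows "(\<lambda>z. E_series z c \<theta>) holomorphic_on ball 0 1"
proof -
  define b where "b = (\<lambda>n. if n = 0 then 0 else complex_of_real (exp (c * real n powr \<theta>)) * (-1) ^ n)"
  have nb: "norm (b n) \<le> exp \<bar>c\<bar>" for n
  proof (cases "n = 0")
    case False
    hence "real n powr \<theta> \<le> 1 powr \<theta>" using assms by (intro powr_mono2') auto
    hence "\<bar>c\<bar> * real n powr \<theta> \<le> \<bar>c\<bar> * 1" by (intro mult_left_mono) auto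
    moreover have "c * real n powr \<theta> \<le> \<bar>c\<bar> * real n powr \<theta>" by (intro mult_right_mono) auto
    ultimately have "c * real n powr \<theta> \<le> \<bar>c\<bar>" by linarith
    thus ?thesis using False by (simp add: b_def norm_mult norm_power)
  qed (simp add: b_def)
  have eq: "(\<lambda>n. b n * (z - 0) ^ n) sums E_series z c \<theta>" if "z \<in> ball 0 1" for z
  proof -
    have z: "norm z < 1" using that by simp
    have "summable (\<lambda>n. exp \<bar>c\<bar> * norm z ^ n)" using z by (intro summable_mult summable_geometric) auto
    hence "summable (\<lambda>n. b n * z ^ n)"
      by (rule summable_comparison_test'[where N = 0]) (auto simp: norm_mult norm_power intro!: mult_right_mono nb)
    hence "(\<lambda>n. b n * z ^ n) sums (\<Sum>n. b n * z ^ n)" by (rule summable_sums)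
    hence "(\<lambda>n. b (Suc n) * z ^ Suc n) sums (\<Sum>n. b n * z ^ n)"
      by (subst sums_Suc_iff) (simp add: b_def)
    moreover have "b (Suc n) * z ^ Suc n = complex_of_real (exp (c * real (Suc n) powr \<theta>)) * (- z) ^ Suc n" for n
      by (simp only: b_def power_minus[of z] mult_ac) simp
    ultimately have "E_series z c \<theta> = (\<Sum>n. b n * z ^ n)" unfolding E_series_def by (simp only: sums_iff)
    with \<open>(\<lambda>n. b n * z ^ n) sums (\<Sum>n. b n * z ^ n)\<close> show ?thesis by simp
  qed
  show ?thesis by (rule power_series_holomorphic[OF eq])
qed

text \<open>The series on the unit disc and the line integral on the plane cut along the negative axis agree
where both are defined, hence glue to a continuation on the slit plane. The series is still needed near
\<open>(-1, 0]\<close>.\<close>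

lemma E_eq_line_integral:
  assumes "\<theta> < 0" and z: "z \<notin> \<real>\<^sub>\<le>\<^sub>0"
  shows "E z c \<theta> = - lindelof_line_integral c \<theta> 0 (Ln z) / (2 * pi)"
proof -
  define h where "h = (\<lambda>z. - lindelof_line_integral c \<theta> 0 (Ln z) / (2 * pi))"
  define f where "f = (\<lambda>z. if z \<in> ball 0 1 then E_series z c \<theta> else h z)"
  have hol_h: "h holomorphic_on - \<real>\<^sub>\<le>\<^sub>0"
  proof -
    have "(lindelof_line_integral c \<theta> 0 \<circ> Ln) holomorphic_on - \<real>\<^sub>\<le>\<^sub>0"
      by (rule holomorphic_on_compose_gen[OF _ lindelof_line_integral_holomorphic[OF assms(1)]])
         (auto intro!: holomorphic_intros Ln_in_log_strip)
    thus ?thesis unfolding h_def by (auto intro!: holomorphic_intros simp: o_def)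
  qed
  have agree: "E_series z c \<theta> = h z" if "z \<in> ball 0 1" "z \<notin> \<real>\<^sub>\<le>\<^sub>0" for z
  proof -
    have nz: "z \<noteq> 0" using that by auto
    have "Re (Ln z) < 0" using that nz by (simp add: ln_less_zero_iff)
    thus ?thesis using E_series_eq_line_integral[OF assms(1) Ln_in_log_strip[OF that(2)], of c] nz
      by (simp add: h_def)
  qed
  have un: "slit_plane \<subseteq> ball 0 1 \<union> - \<real>\<^sub>\<le>\<^sub>0"
  proof
    fix w assume w: "w \<in> slit_plane"
    show "w \<in> ball 0 1 \<union> - \<real>\<^sub>\<le>\<^sub>0"
    proof (rule ccontr)
      assume "\<not> ?thesis"
      hence "w \<in> \<real>\<^sub>\<le>\<^sub>0" "norm w \<ge> 1" by auto
      then obtain x where "w = of_real x" "x \<le> -1" by (auto elim!: nonpos_Reals_cases)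
      thus False using w by (auto simp: slit_plane_def)
    qed
  qed
  have "f holomorphic_on ball 0 1"
    by (rule holomorphic_transform[OF E_series_holomorphic[OF assms(1)]]) (simp add: f_def)
  moreover have "f holomorphic_on - \<real>\<^sub>\<le>\<^sub>0"
    by (rule holomorphic_transform[OF hol_h]) (auto simp: f_def agree)
  ultimately have "f holomorphic_on ball 0 1 \<union> - \<real>\<^sub>\<le>\<^sub>0"
    by (intro holomorphic_on_Un) auto
  hence "f holomorphic_on slit_plane" using un by (rule holomorphic_on_subset)
  hence ic: "is_continuation c \<theta> f" by (simp add: is_continuation_def f_def)
  have "z \<in> slit_plane" using z by (auto simp: slit_plane_def complex_nonpos_Reals_iff)
  from E_unique[OF ic this] show ?thesis using agree[OF _ z] by (auto simp: f_def h_def)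
qed

section \<open>Laplace's method\<close>

lemma has_integral_gaussian:
  fixes b :: real
  assumes "b > 0"
  shows "((\<lambda>x. exp (- b * x\<^sup>2)) has_integral sqrt (pi / b)) UNIV"
proof -
  define \<sigma> where "\<sigma> = sqrt (1 / (2 * b))"
  have s: "\<sigma> > 0" "\<sigma>\<^sup>2 = 1 / (2 * b)" using assms by (auto simp: \<sigma>_def)
  have eq: "normal_density 0 \<sigma> x * sqrt (pi / b) = exp (- b * x\<^sup>2)" for x
  proof -
    have 1: "2 * pi * \<sigma>\<^sup>2 = pi / b" using s by simp
    have 2: "- (x - 0)\<^sup>2 / (2 * \<sigma>\<^sup>2) = - b * x\<^sup>2" using s by simp
    show ?thesis unfolding normal_density_def 1 2 using assms by simp
  qed
  have "(normal_density 0 \<sigma> has_integral integral\<^sup>L lborel (normal_density 0 \<sigma>)) UNIV"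
    by (rule has_integral_integral_lborel) (use s in simp)
  hence "(normal_density 0 \<sigma> has_integral 1) UNIV" using s by simp
  from has_integral_mult_left[OF this, of "sqrt (pi / b)"] show ?thesis by (simp add: eq)
qed

text \<open>In the scale \<open>y = sqrt N \<bar>x\<bar>\<close> the cubic \<open>y^3\<close> is absorbed by half of the Gaussian, at the price of
the factor \<open>1 / sqrt N\<close>.\<close>

lemma cubic_gaussian_bound:
  fixes N m x :: real
  assumes "N > 0" "m > 0"
  shows "N * \<bar>x\<bar> ^ 3 * exp (- N * m * x\<^sup>2) \<le> (1 + 8 / m\<^sup>2) / sqrt N * exp (- (N * m / 2) * x\<^sup>2)"
proof -
  define y where "y = sqrt N * \<bar>x\<bar>"
  have y0: "y \<ge> 0" using assms by (simp add: y_def)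
  have y2: "y\<^sup>2 = N * x\<^sup>2" using assms by (simp add: y_def power_mult_distrib)
  have y3: "N * \<bar>x\<bar>^3 = y^3 / sqrt N"
  proof -
    have "sqrt N ^ 3 = sqrt N * N" using assms by (simp add: power3_eq_cube)
    hence "y^3 = sqrt N * N * \<bar>x\<bar>^3" by (simp add: y_def power_mult_distrib)
    thus ?thesis using assms by simp
  qed
  \<comment> \<open>\<open>y^4\<close> is a multiple of \<open>t\<^sup>2\<close>, and \<open>exp t\<close> dominates \<open>t\<^sup>2 / 2\<close>.\<close>
  define t where "t = m * y\<^sup>2 / 2"
  have t0: "t \<ge> 0" using assms by (simp add: t_def)
  have "y^3 \<le> 1 + y^4"
  proof (cases "y \<le> 1")
    case True thus ?thesis using y0 by (simp add: power_le_one add_increasing2)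
  next
    case False hence "y^3 \<le> y^4" by (intro power_increasing) auto
    thus ?thesis by simp
  qed
  also have "y^4 = 8 / m\<^sup>2 * (t\<^sup>2 / 2)"
    using assms by (simp add: t_def field_simps power2_eq_square power4_eq_xxxx)
  also have "1 + 8 / m\<^sup>2 * (t\<^sup>2 / 2) \<le> exp t + 8 / m\<^sup>2 * exp t"
    using t0 exp_lower_Taylor_quadratic[OF t0] by (intro add_mono mult_left_mono) auto
  finally have "y^3 \<le> (1 + 8 / m\<^sup>2) * exp t" by (simp add: algebra_simps)
  hence "y^3 * exp (- 2 * t) \<le> (1 + 8 / m\<^sup>2) * exp t * exp (- 2 * t)" by (intro mult_right_mono) auto
  also have "\<dots> = (1 + 8 / m\<^sup>2) * exp (- t)" by (simp add: mult.assoc flip: exp_add)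
  finally have "y^3 * exp (- 2 * t) / sqrt N \<le> (1 + 8 / m\<^sup>2) * exp (- t) / sqrt N"
    using assms by (intro divide_right_mono) auto
  moreover have "2 * t = N * m * x\<^sup>2" "t = N * m / 2 * x\<^sup>2" by (auto simp: t_def y2)
  ultimately show ?thesis unfolding y3 by simp
qed

text \<open>It suffices to be close to the Gaussian on \<open>[x1, x2]\<close>: outside, the Gaussian itself is dominated by
the same majorant, because \<open>\<bar>x\<bar>^3\<close> is bounded below there. Hence a single estimate over the whole line
covers the tails. The constant does not depend on \<open>f\<close>, \<open>N\<close>, \<open>\<rho>\<close>.\<close>

lemma laplace_method:
  fixes x1 x2 B m C1 :: real
  assumes x: "x1 < 0" "0 < x2" and m: "0 < m" "m \<le> B" and C1: "C1 \<ge> 0"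
  obtains C where "C \<ge> 0" 
    "\<And>(f :: real \<Rightarrow> complex) N \<rho>. \<lbrakk>N \<ge> 1; \<rho> \<ge> 0; continuous_on {x1..x2} f;
       \<And>x. x \<in> {x1..x2} \<Longrightarrow> norm (f x - of_real (exp (- (N * B) * x\<^sup>2)))
         \<le> (C1 * N * \<bar>x\<bar> ^ 3 + \<rho>) * exp (- N * m * x\<^sup>2)\<rbrakk>
      \<Longrightarrow> norm (integral {x1..x2} f - of_real (sqrt (pi / (N * B)))) \<le> C * (1 / sqrt N + \<rho>) / sqrt N"
proof -
  define d where "d = min (-x1) x2"
  have d: "d > 0" using x by (simp add: d_def)
  \<comment> \<open>Outside \<open>[x1, x2]\<close> one has \<open>\<bar>x\<bar> \<ge> d\<close>, hence \<open>1 \<le> C2 \<bar>x\<bar>^3\<close> there.\<close>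
  define C2 where "C2 = max C1 (1 / d^3)"
  have C2: "C2 \<ge> 0" "C1 \<le> C2" "1 / d^3 \<le> C2" using C1 by (auto simp: C2_def)
  define K where "K = C2 * (1 + 8 / m\<^sup>2) + 1"
  have K: "K \<ge> 1" unfolding K_def using C2 m by simp
  define C where "C = K * sqrt (2 * pi / m)"
  show ?thesis
  proof (rule that[of C])
    show "C \<ge> 0" using K m by (simp add: C_def)
    fix f :: "real \<Rightarrow> complex" and N \<rho> :: real
    assume N: "N \<ge> 1" and \<rho>: "\<rho> \<ge> 0" and cf: "continuous_on {x1..x2} f"
      and b: "\<And>x. x \<in> {x1..x2} \<Longrightarrow> norm (f x - of_real (exp (- (N * B) * x\<^sup>2)))
        \<le> (C1 * N * \<bar>x\<bar> ^ 3 + \<rho>) * exp (- N * m * x\<^sup>2)"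
    define g where "g = (\<lambda>x. if x \<in> {x1..x2} then f x else 0)"
    have ig: "(g has_integral integral {x1..x2} f) UNIV"
      unfolding g_def by (subst has_integral_restrict_UNIV) (use cf in \<open>auto intro!: integrable_integral
        integrable_continuous_real\<close>)
    have "((\<lambda>x. exp (- (N * B) * x\<^sup>2)) has_integral sqrt (pi / (N * B))) UNIV"
      by (rule has_integral_gaussian) (use N m in auto)
    hence ig2: "((\<lambda>x. complex_of_real (exp (- (N * B) * x\<^sup>2))) has_integral of_real (sqrt (pi / (N * B)))) UNIV"
      by (rule has_integral_of_real)
    have ig3: "((\<lambda>x. K * (1 / sqrt N + \<rho>) * exp (- (N * m / 2) * x\<^sup>2))
      has_integral K * (1 / sqrt N + \<rho>) * sqrt (pi / (N * m / 2))) UNIV"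
      by (intro has_integral_mult_right has_integral_gaussian) (use N m in auto)
    have bnd: "norm (g x - of_real (exp (- (N * B) * x\<^sup>2)))
      \<le> K * (1 / sqrt N + \<rho>) * exp (- (N * m / 2) * x\<^sup>2)" for x
    proof -
      have "norm (g x - of_real (exp (- (N * B) * x\<^sup>2))) \<le> (C2 * N * \<bar>x\<bar> ^ 3 + \<rho>) * exp (- N * m * x\<^sup>2)"
      proof (cases "x \<in> {x1..x2}")
        case True
        hence "norm (g x - of_real (exp (- (N * B) * x\<^sup>2))) \<le> (C1 * N * \<bar>x\<bar> ^ 3 + \<rho>) * exp (- N * m * x\<^sup>2)"
          using b by (simp add: g_def)
        also have "\<dots> \<le> (C2 * N * \<bar>x\<bar> ^ 3 + \<rho>) * exp (- N * m * x\<^sup>2)"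
          using C2 N by (intro mult_right_mono add_mono) auto
        finally show ?thesis .
      next
        case False
        hence dx: "d \<le> \<bar>x\<bar>" using x by (auto simp: d_def)
        have "1 \<le> C2 * d^3" using C2(3) d by (simp add: field_simps)
        also have "\<dots> \<le> C2 * \<bar>x\<bar>^3" using dx d C2 by (intro mult_left_mono power_mono) auto
        also have "C2 * \<bar>x\<bar>^3 = C2 * \<bar>x\<bar>^3 * 1" by simp
        also have "\<dots> \<le> C2 * \<bar>x\<bar>^3 * N" using N C2 by (intro mult_left_mono) auto
        finally have one: "1 \<le> C2 * N * \<bar>x\<bar>^3 + \<rho>" using \<rho> by (simp add: mult_ac)
        have "N * m * x\<^sup>2 \<le> N * B * x\<^sup>2" using N m by (intro mult_right_mono mult_left_mono) auto
        hence "exp (- (N * B) * x\<^sup>2) \<le> 1 * exp (- N * m * x\<^sup>2)" by simp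
        also have "\<dots> \<le> (C2 * N * \<bar>x\<bar> ^ 3 + \<rho>) * exp (- N * m * x\<^sup>2)" using one by (intro mult_right_mono) auto
        finally show ?thesis using False by (auto simp: g_def)
      qed
      also have "\<dots> = C2 * (N * \<bar>x\<bar> ^ 3 * exp (- N * m * x\<^sup>2)) + \<rho> * exp (- N * m * x\<^sup>2)"
        by (simp add: algebra_simps)
      also have "\<dots> \<le> C2 * ((1 + 8 / m\<^sup>2) / sqrt N * exp (- (N * m / 2) * x\<^sup>2)) + \<rho> * exp (- (N * m / 2) * x\<^sup>2)"
      proof (intro add_mono mult_left_mono cubic_gaussian_bound)
        have "N * m / 2 * x\<^sup>2 \<le> N * m * x\<^sup>2" using N m by (intro mult_right_mono) auto
        thus "exp (- N * m * x\<^sup>2) \<le> exp (- (N * m / 2) * x\<^sup>2)" by simp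
      qed (use N m C2 \<rho> in auto)
      also have "\<dots> = (C2 * (1 + 8 / m\<^sup>2) * (1 / sqrt N) + 1 * \<rho>) * exp (- (N * m / 2) * x\<^sup>2)"
      proof -
        have "C2 * (Q / sqrt N * E) + \<rho> * E = (C2 * Q * (1 / sqrt N) + 1 * \<rho>) * E" for Q E :: real
          by (simp add: algebra_simps)
        thus ?thesis .
      qed
      also have "\<dots> \<le> (K * (1 / sqrt N) + K * \<rho>) * exp (- (N * m / 2) * x\<^sup>2)"
        using K \<rho> N by (intro mult_right_mono add_mono) (auto simp: K_def)
      finally show ?thesis by (simp add: distrib_left)
    qed
    have "norm (integral {x1..x2} f - of_real (sqrt (pi / (N * B))))
      \<le> K * (1 / sqrt N + \<rho>) * sqrt (pi / (N * m / 2))"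
      using integral_norm_bound_integral[of "\<lambda>x. g x - of_real (exp (- (N * B) * x\<^sup>2))" UNIV, OF _ _ bnd]
        has_integral_diff[OF ig ig2] ig3
      by (metis (no_types, lifting) has_integral_iff)
    also have "sqrt (pi / (N * m / 2)) = sqrt (2 * pi / m) / sqrt N"
      by (simp add: real_sqrt_divide real_sqrt_mult mult.commute)
    finally show "norm (integral {x1..x2} f - of_real (sqrt (pi / (N * B)))) \<le> C * (1 / sqrt N + \<rho>) / sqrt N"
      by (simp add: C_def mult_ac)
  qed
qed

section \<open>The phase along the logarithmic spiral\<close>

definition saddle_angle :: "real \<Rightarrow> real" where "saddle_angle a = pi / (1 + a)"

text \<open>In the logarithmic coordinate \<open>u = exp (i\<psi> + x)\<close> the phase \<open>u - u powr (-a) / a\<close> becomes \<open>exp (i\<psi>)\<close>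
times this function, because \<open>exp (-i a \<psi>) = - exp (i\<psi>)\<close> for \<open>\<psi> = \<pi> / (1 + a)\<close>. The saddle is at \<open>x = 0\<close>.\<close>

definition spiral_phase :: "real \<Rightarrow> complex \<Rightarrow> complex" where
  "spiral_phase a x = exp x + exp (- of_real a * x) / of_real a"

text \<open>A straight line in the logarithmic coordinate is a logarithmic spiral in the plane. This direction is
the direction of steepest descent at the saddle: its square is a negative multiple of \<open>exp (-i\<psi>)\<close>.\<close>

definition spiral_dir :: "real \<Rightarrow> complex" where
  "spiral_dir a = Complex (tan (saddle_angle a / 2)) 1"

text \<open>The phase on the spiral relative to its value at the saddle.\<close>

definition phase_drop :: "real \<Rightarrow> real \<Rightarrow> complex" where
  "phase_drop a \<eta> = cis (saddle_angle a) * (spiral_phase a (spiral_dir a * of_real \<eta>) - spiral_phase a 0)"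

text \<open>The coefficient of \<open>-\<eta>\<^sup>2\<close> in the expansion of the phase along the spiral.\<close>

definition phase_curv :: "real \<Rightarrow> real" where
  "phase_curv a = (1 + a) / (2 * (cos (saddle_angle a / 2))\<^sup>2)"

lemma saddle_angle_bounds:
  assumes "a > 0"
  shows "0 < saddle_angle a" "saddle_angle a < pi" "a * saddle_angle a = pi - saddle_angle a"
    "cos (saddle_angle a / 2) > 0" "sin (saddle_angle a / 2) > 0" "tan (saddle_angle a / 2) > 0"
proof -
  show 1: "0 < saddle_angle a" "saddle_angle a < pi" "a * saddle_angle a = pi - saddle_angle a"
    using assms by (auto simp: saddle_angle_def field_simps)
  show "cos (saddle_angle a / 2) > 0" using 1 by (intro cos_gt_zero_pi) auto
  show "sin (saddle_angle a / 2) > 0" using 1 by (intro sin_gt_zero) auto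
  show "tan (saddle_angle a / 2) > 0" using 1 by (intro tan_gt_zero) auto
qed

lemma phase_curv_pos: "a > 0 \<Longrightarrow> phase_curv a > 0"
  using saddle_angle_bounds(4)[of a] by (simp add: phase_curv_def)

text \<open>The derivative of the real part of the phase along the spiral is, up to a positive factor, a
difference \<open>G (-a \<eta>) - G \<eta>\<close> of values of one function \<open>G x = exp (\<tau> x) sin (\<beta> + x)\<close>. This lemma and the next
separate these values by \<open>G 0 = sin \<beta>\<close>, on the two sides of \<open>0\<close>.\<close>

lemma exp_sin_ge:
  fixes \<beta> x \<tau> :: real
  assumes "0 < \<beta>" "\<beta> < pi/2" "0 \<le> \<tau>" "0 \<le> x" "x \<le> pi - 2 * \<beta>"
  shows "exp (\<tau> * x) * sin (\<beta> + x) \<ge> sin \<beta>"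
proof -
  have s: "sin \<beta> > 0" using assms by (intro sin_gt_zero) auto
  have "sin (\<beta> + x) \<ge> sin \<beta>"
  proof (cases "\<beta> + x \<le> pi/2")
    case True thus ?thesis using assms by (intro sin_monotone_2pi_le) auto
  next
    case False
    have "sin \<beta> \<le> sin (pi - (\<beta> + x))" using False assms by (intro sin_monotone_2pi_le) auto
    thus ?thesis by simp
  qed
  moreover have "exp (\<tau> * x) \<ge> 1" using assms by simp
  ultimately have "1 * sin \<beta> \<le> exp (\<tau> * x) * sin (\<beta> + x)" using s by (intro mult_mono) auto
  thus ?thesis by simp
qed

lemma exp_sin_less:
  fixes \<beta> x \<tau> :: real
  assumes "0 < \<beta>" "\<beta> < pi/2" "0 \<le> \<tau>" "x < 0" "- pi \<le> x"
  shows "exp (\<tau> * x) * sin (\<beta> + x) < sin \<beta>"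
proof -
  have s: "sin \<beta> > 0" using assms by (intro sin_gt_zero) auto
  show ?thesis
  proof (cases "\<beta> + x \<le> 0")
    case True
    have "sin (- (\<beta> + x)) \<ge> 0" using True assms by (intro sin_ge_zero) auto
    hence "sin (\<beta> + x) \<le> 0" by (simp only: sin_minus)
    hence "exp (\<tau> * x) * sin (\<beta> + x) \<le> 0" by (intro mult_nonneg_nonpos) auto
    thus ?thesis using s by linarith
  next
    case False
    have "sin (\<beta> + x) < sin \<beta>" using False assms by (intro sin_monotone_2pi) auto
    moreover have "sin (\<beta> + x) > 0" using False assms by (intro sin_gt_zero) auto
    moreover have "exp (\<tau> * x) \<le> 1" using assms by (simp add: mult_nonneg_nonpos)
    ultimately have "exp (\<tau> * x) * sin (\<beta> + x) \<le> 1 * sin (\<beta> + x)" by (intro mult_right_mono) auto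
    thus ?thesis using \<open>sin (\<beta> + x) < sin \<beta>\<close> by simp
  qed
qed

lemma Re_phase_drop:
  assumes "a > 0"
  shows "Re (phase_drop a \<eta>) = 
     exp (tan (saddle_angle a / 2) * \<eta>) * cos (saddle_angle a + \<eta>)
     + exp (- a * tan (saddle_angle a / 2) * \<eta>) * cos (saddle_angle a - a * \<eta>) / a
     - cos (saddle_angle a) * (1 + 1 / a)"
proof -
  define \<psi> where "\<psi> = saddle_angle a"
  define \<tau> where "\<tau> = tan (\<psi> / 2)"
  have e: "cis \<psi> * exp (of_real b * (spiral_dir a * of_real \<eta>))
    = of_real (exp (b * \<tau> * \<eta>)) * cis (\<psi> + b * \<eta>)" for b
  proof -
    have "of_real b * (spiral_dir a * of_real \<eta>) = of_real (b * \<tau> * \<eta>) + \<i> * of_real (b * \<eta>)"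
      by (simp add: spiral_dir_def \<tau>_def \<psi>_def complex_eq_iff)
    thus ?thesis by (simp add: exp_add cis_conv_exp algebra_simps flip: exp_of_real)
  qed
  have "phase_drop a \<eta> = cis \<psi> * exp (of_real 1 * (spiral_dir a * of_real \<eta>)) + 
      cis \<psi> * exp (of_real (-a) * (spiral_dir a * of_real \<eta>)) / of_real a - cis \<psi> * of_real (1 + 1/a)"
    unfolding phase_drop_def spiral_phase_def \<psi>_def using assms by (simp add: algebra_simps)
  thus ?thesis unfolding e using assms by (simp add: \<psi>_def \<tau>_def Re_divide_of_real)
qed

lemma tan_times_cos_minus_sin:
  fixes \<beta> x :: real
  assumes cb: "cos \<beta> > 0"
  shows "tan \<beta> * cos (2 * \<beta> + x) - sin (2 * \<beta> + x) = - sin (\<beta> + x) / cos \<beta>"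
proof -
  have "sin (2 * \<beta> + x - \<beta>) = sin (2 * \<beta> + x) * cos \<beta> - cos (2 * \<beta> + x) * sin \<beta>" by (rule sin_diff)
  hence eq: "- sin (\<beta> + x) = sin \<beta> * cos (2 * \<beta> + x) - sin (2 * \<beta> + x) * cos \<beta>" by (simp add: algebra_simps)
  have t: "tan \<beta> * cos \<beta> = sin \<beta>" using cb by (simp add: tan_def)
  have "(tan \<beta> * cos (2 * \<beta> + x) - sin (2 * \<beta> + x)) * cos \<beta>
    = (tan \<beta> * cos \<beta>) * cos (2 * \<beta> + x) - sin (2 * \<beta> + x) * cos \<beta>"
    by (simp only: left_diff_distrib) (simp only: mult_ac)
  also have "\<dots> = - sin (\<beta> + x)" unfolding t eq ..
  finally show ?thesis using cb by (simp only: eq_divide_eq) simp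
qed

lemma Re_phase_drop_has_derivative:
  assumes a: "a > 0"
  defines "\<beta> \<equiv> saddle_angle a / 2"
  defines "G \<equiv> \<lambda>x. exp (tan \<beta> * x) * sin (\<beta> + x)"
  shows "((\<lambda>\<eta>. Re (phase_drop a \<eta>)) has_real_derivative (G (- a * \<eta>) - G \<eta>) / cos \<beta>) (at \<eta>)"
proof -
  have psi: "saddle_angle a = 2 * \<beta>" by (simp add: \<beta>_def)
  have cb: "cos \<beta> > 0" using saddle_angle_bounds[OF a] by (simp add: \<beta>_def)
  note key = tan_times_cos_minus_sin[OF cb]
  have "((\<lambda>\<eta>. exp (tan \<beta> * \<eta>) * cos (2 * \<beta> + \<eta>) + exp (- a * tan \<beta> * \<eta>) * cos (2 * \<beta> - a * \<eta>) / a - cos (2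
    * \<beta>) * (1 + 1 / a))
     has_real_derivative exp (tan \<beta> * \<eta>) * (tan \<beta> * cos (2 * \<beta> + \<eta>) - sin (2 * \<beta> + \<eta>))
       - exp (tan \<beta> * (- a * \<eta>)) * (tan \<beta> * cos (2 * \<beta> + (- a * \<eta>)) - sin (2 * \<beta> + (- a * \<eta>)))) (at \<eta>)"
    using a by (auto intro!: derivative_eq_intros simp: field_simps)
  thus ?thesis unfolding key Re_phase_drop[OF a] \<beta>_def[symmetric] psi G_def
    by (simp add: diff_divide_distrib)
qed

text \<open>Of \<open>-a \<eta>\<close> and \<open>\<eta>\<close> one is positive and one negative, and each stays in the range where \<open>G\<close> lies on its
side of \<open>G 0\<close>: the identity \<open>a \<psi> = \<pi> - \<psi>\<close> is what makes the ranges fit. So the phase increases towards the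
saddle and decreases after it.\<close>

lemma Re_phase_drop_neg:
  assumes a: "a > 0" and e: "- saddle_angle a \<le> \<eta>" "\<eta> \<le> pi - saddle_angle a" "a * \<eta> \<le> pi" "\<eta> \<noteq> 0"
  shows "Re (phase_drop a \<eta>) < 0"
proof -
  define \<beta> where "\<beta> = saddle_angle a / 2"
  define G where "G = (\<lambda>x. exp (tan \<beta> * x) * sin (\<beta> + x))"
  note sa = saddle_angle_bounds[OF a]
  have b: "0 < \<beta>" "\<beta> < pi/2" "cos \<beta> > 0" "tan \<beta> \<ge> 0" using sa by (auto simp: \<beta>_def)
  have psi: "saddle_angle a = 2 * \<beta>" by (simp add: \<beta>_def)
  have der: "((\<lambda>\<eta>. Re (phase_drop a \<eta>)) has_real_derivative (G (- a * x) - G x) / cos \<beta>) (at x)" for x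
    unfolding G_def \<beta>_def by (rule Re_phase_drop_has_derivative[OF a])
  have cont: "continuous_on X (\<lambda>\<eta>. Re (phase_drop a \<eta>))" for X
    using der by (meson DERIV_isCont continuous_at_imp_continuous_on)
  have z: "Re (phase_drop a 0) = 0" by (simp add: phase_drop_def)
  show ?thesis
  proof (cases "\<eta> > 0")
    case True
    have "(G (- a * x) - G x) / cos \<beta> < 0" if "0 < x" "x < \<eta>" for x
    proof -
      have "a * x \<le> a * \<eta>" using that a by (intro mult_left_mono) auto
      hence "- pi \<le> - a * x" using e by simp
      hence "G (- a * x) < sin \<beta>" unfolding G_def using that a by (intro exp_sin_less b) (auto simp: mult_neg_pos)
      moreover have "G x \<ge> sin \<beta>" unfolding G_def using that e psi by (intro exp_sin_ge b) auto
      ultimately show ?thesis using b by (simp add: divide_neg_pos)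
    qed
    hence "Re (phase_drop a \<eta>) < Re (phase_drop a 0)"
      using der cont by (intro DERIV_neg_imp_decreasing_open[OF True]) blast+
    thus ?thesis using z by simp
  next
    case False
    hence neg: "\<eta> < 0" using e by simp
    have "(G (- a * x) - G x) / cos \<beta> > 0" if "\<eta> < x" "x < 0" for x
    proof -
      have "a * (- x) \<le> a * saddle_angle a" using that a e by (intro mult_left_mono) auto
      hence "- a * x \<le> pi - 2 * \<beta>" using sa psi by simp
      hence "G (- a * x) \<ge> sin \<beta>" unfolding G_def
        using that a by (intro exp_sin_ge b) (auto simp: mult_nonneg_nonpos)
      moreover have "G x < sin \<beta>" unfolding G_def using that e sa by (intro exp_sin_less b) auto
      ultimately show ?thesis using b by simp
    qed
    hence "Re (phase_drop a \<eta>) < Re (phase_drop a 0)"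
      using der cont by (intro DERIV_pos_imp_increasing_open[OF neg]) blast+
    thus ?thesis using z by simp
  qed
qed

lemma spiral_dir_polar:
  assumes "a > 0"
  shows "spiral_dir a = \<i> * cis (- saddle_angle a / 2) / of_real (cos (saddle_angle a / 2))"
  using saddle_angle_bounds(4)[OF assms]
  by (simp add: complex_eq_iff spiral_dir_def tan_def Re_divide_of_real Im_divide_of_real)

lemma phase_curv_eq:
  assumes "a > 0"
  shows "cis (saddle_angle a) * (of_real ((1 + a) / 2) * (spiral_dir a)\<^sup>2) = - of_real (phase_curv a)"
proof -
  have "cis (saddle_angle a) * (\<i> * cis (- saddle_angle a / 2))\<^sup>2 = -1"
    by (simp add: power_mult_distrib Complex.DeMoivre cis_mult)
  hence "cis (saddle_angle a) * (spiral_dir a)\<^sup>2 = - 1 / of_real ((cos (saddle_angle a / 2))\<^sup>2)"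
    unfolding spiral_dir_polar[OF assms] by (simp add: power_divide)
  hence "cis (saddle_angle a) * (of_real ((1 + a) / 2) * (spiral_dir a)\<^sup>2)
    = of_real ((1 + a) / 2) * (- 1 / of_real ((cos (saddle_angle a / 2))\<^sup>2))"
    by (metis mult.left_commute)
  also have "\<dots> = of_real ((1 + a) / 2 * (- 1 / (cos (saddle_angle a / 2))\<^sup>2))" by simp
  also have "(1 + a) / 2 * (- 1 / (cos (saddle_angle a / 2))\<^sup>2) = - phase_curv a" by (simp add: phase_curv_def)
  finally show ?thesis by simp
qed

lemma exp_cubic_remainder:
  fixes x :: complex
  assumes "norm x \<le> R"
  shows "norm (exp x - (1 + x + x\<^sup>2 / 2)) \<le> exp R * norm x ^ 3"
proof -
  have "norm (exp x - (\<Sum>i\<le>2. x ^ i / fact i)) \<le> exp \<bar>Re x\<bar> * norm x ^ Suc 2 / fact 2" by (rule Taylor_exp)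
  also have "(\<Sum>i\<le>2. x ^ i / fact i) = 1 + x + x\<^sup>2 / 2" by (simp add: numeral_2_eq_2)
  also have "exp \<bar>Re x\<bar> * norm x ^ Suc 2 / fact 2 \<le> exp R * norm x ^ 3"
  proof -
    have "\<bar>Re x\<bar> \<le> R" using abs_Re_le_cmod[of x] assms by linarith
    hence "exp \<bar>Re x\<bar> * norm x ^ 3 \<le> exp R * norm x ^ 3" by (intro mult_right_mono) auto
    moreover have "exp \<bar>Re x\<bar> * norm x ^ 3 / 2 \<le> exp \<bar>Re x\<bar> * norm x ^ 3" by simp
    moreover have "Suc 2 = 3" "(fact 2 :: real) = 2" by simp_all
    ultimately show ?thesis by (simp only:)
  qed
  finally show ?thesis .
qed

lemma phase_drop_cubic:
  assumes a: "a > 0" and "R \<ge> 0"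
  obtains C where "C \<ge> 0" "\<And>\<eta>. \<bar>\<eta>\<bar> \<le> R \<Longrightarrow> norm (phase_drop a \<eta> + of_real (phase_curv a * \<eta>\<^sup>2)) \<le> C * \<bar>\<eta>\<bar> ^ 3"
proof -
  define k where "k = spiral_dir a"
  define r where "r = norm k * R"
  define C where "C = (exp r + exp (a * r) * a^2) * norm k ^ 3"
  show ?thesis
  proof (rule that[of C])
    show "C \<ge> 0" by (simp add: C_def)
    fix \<eta> :: real assume e: "\<bar>\<eta>\<bar> \<le> R"
    define x where "x = k * of_real \<eta>"
    define t where "t = \<bar>\<eta>\<bar>"
    have nx: "norm x = norm k * t" by (simp add: x_def t_def norm_mult)
    have nr: "norm x \<le> r" unfolding nx r_def t_def using e by (intro mult_left_mono) auto
    have 1: "norm (exp x - (1 + x + x\<^sup>2 / 2)) \<le> exp r * norm x ^ 3" by (rule exp_cubic_remainder[OF nr])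
    define y where "y = - of_real a * x"
    have ny: "norm y = a * norm x" using a by (simp add: y_def norm_mult)
    have 2: "norm (exp y - (1 + y + y\<^sup>2 / 2)) \<le> exp (a * r) * norm y ^ 3"
      by (rule exp_cubic_remainder) (use ny nr a in auto)
    have sq: "phase_curv a * \<eta>\<^sup>2 = (phase_curv a) * \<eta>\<^sup>2" ..
    have "complex_of_real (phase_curv a * \<eta>\<^sup>2) = - cis (saddle_angle a) * (of_real ((1 + a) / 2) * x\<^sup>2)"
      using phase_curv_eq[OF a] unfolding x_def k_def by (simp add: power_mult_distrib flip: mult.assoc)
    hence "phase_drop a \<eta> + of_real (phase_curv a * \<eta>\<^sup>2) = 
       cis (saddle_angle a) * ((exp x - (1 + x + x\<^sup>2 / 2)) + (exp y - (1 + y + y\<^sup>2 / 2)) / of_real a)"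
    proof -
      have "(exp y - (1 + y + y\<^sup>2 / 2)) / of_real a = exp y / of_real a - 1 / of_real a + x - of_real a * x\<^sup>2 / 2"
        unfolding y_def using a by (simp add: diff_divide_distrib add_divide_distrib power2_eq_square)
      moreover have "phase_drop a \<eta> = cis (saddle_angle a) * (exp x + exp y / of_real a - (1 + 1 / of_real a))"
        unfolding phase_drop_def spiral_phase_def y_def x_def k_def by simp
      moreover assume "complex_of_real (phase_curv a * \<eta>\<^sup>2)
        = - cis (saddle_angle a) * (of_real ((1 + a) / 2) * x\<^sup>2)"
      ultimately show ?thesis by (simp only:) (simp add: algebra_simps add_divide_distrib)
    qed
    also have "norm \<dots> = norm ((exp x - (1 + x + x\<^sup>2 / 2)) + (exp y - (1 + y + y\<^sup>2 / 2)) / of_real a)"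
      by (simp add: norm_mult)
    also have "\<dots> \<le> norm (exp x - (1 + x + x\<^sup>2 / 2)) + norm ((exp y - (1 + y + y\<^sup>2 / 2)) / of_real a)"
      by (rule norm_triangle_ineq)
    also have "norm ((exp y - (1 + y + y\<^sup>2 / 2)) / of_real a) = norm (exp y - (1 + y + y\<^sup>2 / 2)) / a"
      using a by (simp add: norm_divide)
    also have "norm (exp x - (1 + x + x\<^sup>2 / 2)) + \<dots> \<le> exp r * norm x ^ 3 + exp (a * r) * norm y ^ 3 / a"
      using a by (intro add_mono divide_right_mono 1 2) auto
    also have "\<dots> = C * \<bar>\<eta>\<bar> ^ 3" unfolding ny C_def t_def[symmetric]
      using a by (simp add: nx power_mult_distrib field_simps eval_nat_numeral)
    finally show "norm (phase_drop a \<eta> + of_real (phase_curv a * \<eta>\<^sup>2)) \<le> C * \<bar>\<eta>\<bar> ^ 3" .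
  qed
qed

lemma phase_drop_continuous: "continuous_on X (phase_drop a)"
  unfolding phase_drop_def spiral_phase_def divide_inverse by (intro continuous_intros)

text \<open>Near the saddle the quadratic term dominates the cubic remainder; away from it, strict negativity and
compactness give a uniform gap.\<close>

lemma Re_phase_drop_quadratic:
  assumes a: "a > 0" and e: "0 < \<eta>1" "\<eta>1 \<le> pi - saddle_angle a" "a * \<eta>1 \<le> pi"
  obtains m where "m > 0" "m \<le> phase_curv a"
    "\<And>\<eta>. \<eta> \<in> {- saddle_angle a..\<eta>1} \<Longrightarrow> Re (phase_drop a \<eta>) \<le> - m * \<eta>\<^sup>2"
proof -
  define \<psi> where "\<psi> = saddle_angle a"
  define R where "R = max \<psi> \<eta>1"
  have R: "R > 0" using e by (simp add: R_def)
  have inR: "\<bar>\<eta>\<bar> \<le> R" if "\<eta> \<in> {-\<psi>..\<eta>1}" for \<eta> using that by (auto simp: R_def)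
  obtain C where C: "C \<ge> 0" "\<And>\<eta>. \<bar>\<eta>\<bar> \<le> R \<Longrightarrow> norm (phase_drop a \<eta> + of_real (phase_curv a * \<eta>\<^sup>2)) \<le> C * \<bar>\<eta>\<bar> ^ 3"
    using phase_drop_cubic[OF a, of R] R by auto
  define B where "B = phase_curv a"
  have B: "B > 0" using phase_curv_pos[OF a] by (simp add: B_def)
  \<comment> \<open>For \<open>\<bar>\<eta>\<bar> \<le> \<delta>\<close> the cubic remainder is at most half of the quadratic term.\<close>
  define \<delta> where "\<delta> = B / (2 * (C + 1))"
  have \<delta>: "\<delta> > 0" using B C by (simp add: \<delta>_def)
  have near: "Re (phase_drop a \<eta>) \<le> - (B / 2) * \<eta>\<^sup>2" if "\<bar>\<eta>\<bar> \<le> R" "\<bar>\<eta>\<bar> \<le> \<delta>" for \<eta>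
  proof -
    have "Re (phase_drop a \<eta>) + B * \<eta>\<^sup>2 \<le> norm (phase_drop a \<eta> + of_real (B * \<eta>\<^sup>2))"
      using complex_Re_le_cmod[of "phase_drop a \<eta> + of_real (B * \<eta>\<^sup>2)"] by simp
    also have "\<dots> \<le> C * \<bar>\<eta>\<bar> ^ 3" using C(2)[OF that(1)] by (simp add: B_def)
    also have "\<dots> = C * \<bar>\<eta>\<bar> * \<eta>\<^sup>2" by (simp add: power3_eq_cube power2_eq_square)
    also have "\<dots> \<le> B / 2 * \<eta>\<^sup>2"
    proof (intro mult_right_mono)
      have "C * \<bar>\<eta>\<bar> \<le> (C + 1) * \<delta>" using that C by (intro mult_mono) auto
      moreover have "(C + 1) * \<delta> = B / 2" using C(1) by (simp add: \<delta>_def field_simps)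
      ultimately show "C * \<bar>\<eta>\<bar> \<le> B / 2" by linarith
    qed auto
    finally show ?thesis by simp
  qed
  define K where "K = {-\<psi>..\<eta>1} \<inter> {\<eta>. \<bar>\<eta>\<bar> \<ge> \<delta>}"
  have "compact K" unfolding K_def
    by (intro compact_Int_closed closed_Collect_le continuous_intros) auto
  have "\<exists>\<kappa>>0. \<forall>\<eta>\<in>K. Re (phase_drop a \<eta>) \<le> - \<kappa>"
  proof (cases "K = {}")
    case False
    then obtain y where y: "y \<in> K" "\<And>\<eta>. \<eta> \<in> K \<Longrightarrow> Re (phase_drop a \<eta>) \<le> Re (phase_drop a y)"
      using continuous_attains_sup[OF \<open>compact K\<close>, of "\<lambda>\<eta>. Re (phase_drop a \<eta>)"]
      by (auto intro!: continuous_intros phase_drop_continuous)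
    have ay: "a * y \<le> a * \<eta>1" using y a by (intro mult_left_mono) (auto simp: K_def)
    have "Re (phase_drop a y) < 0"
      by (rule Re_phase_drop_neg[OF a]) (use y e ay \<delta> in \<open>auto simp: K_def \<psi>_def\<close>)
    thus ?thesis using y(2) by (intro exI[of _ "- Re (phase_drop a y)"]) auto
  qed (auto intro: exI[of _ 1])
  then obtain \<kappa> where \<kappa>: "\<kappa> > 0" "\<And>\<eta>. \<eta> \<in> K \<Longrightarrow> Re (phase_drop a \<eta>) \<le> - \<kappa>" by blast
  define m where "m = min (B / 2) (\<kappa> / R\<^sup>2)"
  show ?thesis
  proof (rule that[of m])
    show "m > 0" using B \<kappa> R by (simp add: m_def)
    have "m \<le> B / 2" unfolding m_def by (rule min.cobounded1)
    thus "m \<le> phase_curv a" using B unfolding B_def by linarith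
    fix \<eta> assume "\<eta> \<in> {- saddle_angle a..\<eta>1}"
    hence et: "\<eta> \<in> {-\<psi>..\<eta>1}" by (simp add: \<psi>_def)
    show "Re (phase_drop a \<eta>) \<le> - m * \<eta>\<^sup>2"
    proof (cases "\<bar>\<eta>\<bar> \<le> \<delta>")
      case True
      have "m * \<eta>\<^sup>2 \<le> (B / 2) * \<eta>\<^sup>2" unfolding m_def by (intro mult_right_mono min.cobounded1) auto
      thus ?thesis using near[OF inR[OF et] True] by simp
    next
      case False
      have "\<bar>\<eta>\<bar>\<^sup>2 \<le> R\<^sup>2" using inR[OF et] by (intro power_mono) auto
      hence "m * \<eta>\<^sup>2 \<le> \<kappa> / R\<^sup>2 * R\<^sup>2"
        using \<kappa> R by (intro mult_mono) (auto simp: m_def)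
      hence "m * \<eta>\<^sup>2 \<le> \<kappa>" using R by simp
      moreover have "\<eta> \<in> K" using et False by (simp add: K_def)
      ultimately show ?thesis using \<kappa>(2)[of \<eta>] by simp
    qed
  qed
qed

section \<open>The contribution of one saddle point\<close>

text \<open>The modulus of the saddle points of \<open>c s powr (-a) + s l\<close>.\<close>

definition saddle_radius :: "real \<Rightarrow> real \<Rightarrow> real \<Rightarrow> real" where
  "saddle_radius c a l = (l / (a * (- c))) powr (- 1 / (1 + a))"

definition large_param :: "real \<Rightarrow> real \<Rightarrow> real \<Rightarrow> real" where
  "large_param c a l = saddle_radius c a l * l"

definition spiral :: "real \<Rightarrow> real \<Rightarrow> real \<Rightarrow> real \<Rightarrow> complex" where
  "spiral c a l \<eta> = of_real (saddle_radius c a l) * (cis (saddle_angle a) * exp (spiral_dir a * of_real \<eta>))"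

lemma saddle_radius_pos: "c < 0 \<Longrightarrow> a > 0 \<Longrightarrow> l > 0 \<Longrightarrow> saddle_radius c a l > 0"
  by (simp add: saddle_radius_def mult_pos_neg)

lemma saddle_radius_powr:
  assumes "c < 0" "a > 0" "l > 0"
  shows "- c * saddle_radius c a l powr (- a) = large_param c a l / a"
    and "a * (- c) * saddle_radius c a l powr (- a - 1) = l"
proof -
  let ?r = "saddle_radius c a l"
  have r: "?r > 0" by (rule saddle_radius_pos[OF assms])
  have b: "a * (- c) > 0" using assms by (simp add: mult_pos_neg)
  have "?r powr (- a - 1) = (l / (a * (- c))) powr (- 1 / (1 + a) * (- a - 1))"
    unfolding saddle_radius_def powr_powr ..
  also have "- 1 / (1 + a) * (- a - 1) = 1" using assms by (simp add: field_simps)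
  also have "(l / (a * (- c))) powr 1 = l / (a * (- c))"
    by (rule powr_one, intro divide_nonneg_pos) (use b assms in linarith)+
  finally have 1: "?r powr (- a - 1) = l / (a * (- c))" .
  have "a \<noteq> 0" "c \<noteq> 0" using assms by auto
  thus 2: "a * (- c) * ?r powr (- a - 1) = l" unfolding 1 by simp
  have "?r powr (- a) = ?r powr (- a - 1) * ?r" using r by (simp add: powr_diff)
  thus "- c * ?r powr (- a) = large_param c a l / a"
    unfolding 1 large_param_def using assms by (simp add: field_simps)
qed

lemma large_param_eq:
  assumes "c < 0" "a > 0" "l > 0"
  shows "large_param c a l = (a * (- c)) powr (1 / (1 + a)) * l powr (a / (1 + a))"
proof -
  define b where "b = a * (- c)"
  have b: "b > 0" using assms by (simp add: b_def mult_pos_neg)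
  have "large_param c a l = b powr (1 / (1 + a)) * (l powr (- 1 / (1 + a)) * l powr 1)"
    unfolding large_param_def saddle_radius_def b_def[symmetric] using b assms
    by (simp add: powr_divide powr_minus_divide field_simps)
  also have "l powr (- 1 / (1 + a)) * l powr 1 = l powr (a / (1 + a))"
    unfolding powr_add[symmetric] using assms by (simp add: field_simps)
  finally show ?thesis unfolding b_def .
qed

lemma spiral_polar:
  assumes "c < 0" "a > 0" "l > 0"
  shows "spiral c a l \<eta> = rcis (saddle_radius c a l * exp (tan (saddle_angle a / 2) * \<eta>)) (saddle_angle a + \<eta>)"
proof -
  have "spiral_dir a * of_real \<eta> = of_real (tan (saddle_angle a / 2) * \<eta>) + \<i> * of_real \<eta>"
    by (simp add: spiral_dir_def complex_eq_iff)
  thus ?thesis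
    by (simp add: spiral_def rcis_def exp_add cis_conv_exp algebra_simps flip: exp_of_real)
qed

lemma spiral_gapped:
  assumes "c < 0" "a > 0" "l > 0" and "- saddle_angle a \<le> \<eta>" "\<eta> < pi - saddle_angle a"
    and "saddle_radius c a l * exp (tan (saddle_angle a / 2) * \<eta>) < 1"
  shows "spiral c a l \<eta> \<in> gapped_plane"
proof (cases "\<eta> = - saddle_angle a")
  case True
  thus ?thesis unfolding spiral_polar[OF assms(1-3)] using assms saddle_radius_pos[OF assms(1-3)]
    by (simp add: gapped_plane_def)
next
  case False
  hence "sin (saddle_angle a + \<eta>) > 0" using assms by (intro sin_gt_zero) auto
  thus ?thesis unfolding spiral_polar[OF assms(1-3)] using saddle_radius_pos[OF assms(1-3)]
    by (simp add: gapped_plane_def)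
qed

text \<open>The restriction on \<open>\<eta>\<close> says that the point has principal argument \<open>\<psi> + \<eta>\<close>, so that the power can be
read off in the logarithmic coordinate.\<close>

lemma spiral_powr:
  assumes "c < 0" "a > 0" "l > 0" and "- saddle_angle a \<le> \<eta>" "\<eta> < pi - saddle_angle a"
  shows "of_real c * spiral c a l \<eta> powr of_real (- a) =
           of_real (large_param c a l) * (cis (saddle_angle a) * exp (- of_real a * (spiral_dir a
             * of_real \<eta>)) / of_real a)"
proof -
  let ?r = "saddle_radius c a l" and ?\<psi> = "saddle_angle a"
  note sa = saddle_angle_bounds[OF assms(2)]
  have r: "?r > 0" by (rule saddle_radius_pos[OF assms(1-3)])
  define w where "w = of_real (ln ?r) + (\<i> * of_real ?\<psi> + spiral_dir a * of_real \<eta>)"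
  have s: "spiral c a l \<eta> = exp w"
    using r by (simp add: w_def spiral_def exp_add cis_conv_exp exp_of_real)
  have imw: "Im w = ?\<psi> + \<eta>" by (simp add: w_def spiral_dir_def)
  have "Ln (spiral c a l \<eta>) = w"
    unfolding s by (rule Ln_exp) (use imw assms sa in auto)
  hence "spiral c a l \<eta> powr of_real (- a) = exp (of_real (- a) * w)"
    unfolding powr_def using s by simp
  also have "of_real (- a) * w = of_real (- a * ln ?r) + (\<i> * of_real (- (a * ?\<psi>)) + - of_real a
    * (spiral_dir a * of_real \<eta>))"
    by (simp add: w_def algebra_simps)
  also have "exp \<dots> = of_real (?r powr (- a)) * (cis (- (a * ?\<psi>)) * exp (- of_real a * (spiral_dir a * of_real \<eta>)))"
    using r by (simp only: exp_add cis_conv_exp powr_def exp_of_real) simp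
  also have "cis (- (a * ?\<psi>)) = - cis ?\<psi>"
    unfolding sa(3) by (simp add: complex_eq_iff)
  finally have e: "spiral c a l \<eta> powr of_real (- a) = 
     of_real (?r powr (- a)) * (- cis ?\<psi> * exp (- of_real a * (spiral_dir a * of_real \<eta>)))" .
  have "of_real c * spiral c a l \<eta> powr of_real (- a)
    = of_real (- c * ?r powr (- a)) * (cis ?\<psi> * exp (- of_real a * (spiral_dir a * of_real \<eta>)))"
    unfolding e by simp
  thus ?thesis unfolding saddle_radius_powr(1)[OF assms(1-3)] by simp
qed

lemma spiral_exponent:
  assumes "c < 0" "a > 0" "l > 0" and "- saddle_angle a \<le> \<eta>" "\<eta> < pi - saddle_angle a"
  shows "of_real c * spiral c a l \<eta> powr of_real (- a) + spiral c a l \<eta> * of_real l =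
      of_real (large_param c a l) * (cis (saddle_angle a) * of_real (1 + 1 / a)) + of_real (large_param c a l)
        * phase_drop a \<eta>"
proof -
  have sl: "spiral c a l \<eta> * of_real l = of_real (large_param c a l) * (cis (saddle_angle a)
    * exp (spiral_dir a * of_real \<eta>))"
    by (simp add: spiral_def large_param_def)
  show ?thesis
    unfolding spiral_powr[OF assms] sl phase_drop_def spiral_phase_def using assms(2)
    by (simp add: algebra_simps)
qed

lemma lindelof_on_spiral:
  assumes "c < 0" "a > 0" "Re L > 0" and "- saddle_angle a \<le> \<eta>" "\<eta> < pi - saddle_angle a"
  defines "l \<equiv> Re L"
  shows "lindelof c (- a) L (spiral c a l \<eta>) * spiral c a l \<eta> =
    exp (of_real (large_param c a l) * (cis (saddle_angle a) * of_real (1 + 1 / a)))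
    * (exp (of_real (large_param c a l) * phase_drop a \<eta>) * sine_factor (Im L) (spiral c a l \<eta>))"
proof -
  let ?s = "spiral c a l \<eta>" and ?N = "large_param c a l"
  have l: "l > 0" using assms by simp
  have L: "L = of_real l + \<i> * of_real (Im L)" by (simp add: complex_eq_iff l_def)
  have "of_real c * ?s powr of_real (- a) + ?s * of_real l = 
      of_real ?N * (cis (saddle_angle a) * of_real (1 + 1 / a)) + of_real ?N * phase_drop a \<eta>"
    by (rule spiral_exponent[OF assms(1,2) l assms(4,5)])
  hence "exp (of_real c * ?s powr of_real (- a)) * exp (?s * of_real l) = 
      exp (of_real ?N * (cis (saddle_angle a) * of_real (1 + 1 / a))) * exp (of_real ?N * phase_drop a \<eta>)"
    by (simp only: exp_add[symmetric])
  moreover have "exp (?s * L) = exp (?s * of_real l) * exp (\<i> * ?s * of_real (Im L))"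
    by (subst L) (simp add: exp_add[symmetric] algebra_simps)
  ultimately show ?thesis unfolding lindelof_def damp_def sine_factor_def
    by (simp add: mult_ac)
qed

lemma norm_exp_diff_le:
  fixes x y :: complex
  assumes "Re x \<le> r" "Re y \<le> r"
  shows "norm (exp x - exp y) \<le> exp r * norm (x - y)"
proof (rule field_differentiable_bound[where S = "{z. Re z \<le> r}" and f = exp and f' = exp])
  show "convex {z. Re z \<le> r}" by (rule convex_halfspace_Re_le)
qed (use assms in \<open>auto intro!: derivative_eq_intros\<close>)

text \<open>The leading term of Laplace's method on the spiral. The factor \<open>spiral_dir\<close> comes from \<open>ds / s\<close>.\<close>

definition saddle_contrib :: "real \<Rightarrow> real \<Rightarrow> real \<Rightarrow> complex" where
  "saddle_contrib c a l = exp (of_real (large_param c a l) * (cis (saddle_angle a) * of_real (1 + 1 / a)))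
     * (spiral_dir a * of_real (sqrt (pi / (large_param c a l * phase_curv a))))"

text \<open>The real part of the phase \<open>u - u powr (-a) / a\<close> at the saddle point.\<close>

definition saddle_height :: "real \<Rightarrow> real" where
  "saddle_height a = (1 + 1 / a) * cos (saddle_angle a)"

definition primitive_of :: "(complex \<Rightarrow> complex) \<Rightarrow> (complex \<Rightarrow> complex) \<Rightarrow> bool" where
  "primitive_of f \<Phi> \<longleftrightarrow> (\<forall>s\<in>gapped_plane. (\<Phi> has_field_derivative f s) (at s))"

text \<open>The integral from \<open>w\<close> to \<open>1/2 + i\<infinity>\<close> is \<open>X\<close> up to an error \<open>r\<close>, uniformly in \<open>Im L\<close>. Expressed through
a primitive, the statement involves no choice of a contour.\<close>

definition upper_integral_near ::
    "real \<Rightarrow> real \<Rightarrow> real \<Rightarrow> complex \<Rightarrow> complex \<Rightarrow> real \<Rightarrow> bool" where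
  "upper_integral_near c a l w X r \<longleftrightarrow> (\<forall>L\<in>log_strip. Re L = l \<longrightarrow>
     (\<forall>\<Phi>. primitive_of (lindelof c (- a) L) \<Phi> \<longrightarrow>
       (\<forall>\<^sub>F T in at_top. norm (\<Phi> (Complex (1/2) T) - \<Phi> w - X) \<le> r)))"

lemma spiral_has_vector_derivative:
  "(spiral c a l has_vector_derivative (spiral c a l \<eta> * spiral_dir a)) (at \<eta> within X)"
proof -
  have "((\<lambda>x. of_real (saddle_radius c a l) * (cis (saddle_angle a) * exp (spiral_dir a * x))) has_field_derivative
      (spiral c a l \<eta> * spiral_dir a)) (at (of_real \<eta>))"
    unfolding spiral_def by (auto intro!: derivative_eq_intros)
  from has_vector_derivative_real_field[OF this] show ?thesis
    unfolding spiral_def by (simp add: o_def)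
qed

text \<open>By \<open>lindelof_on_spiral\<close> the integral over the spiral is one of \<open>exp (N phase_drop)\<close> times a factor
\<open>1 + O(\<sigma>)\<close>, to which Laplace's method applies. The constant is uniform in \<open>\<bar>Im L\<bar> \<le> \<pi>\<close>.\<close>

lemma spiral_integral_estimate:
  assumes c: "c < 0" and a: "a > 0" and e: "0 < \<eta>1" "\<eta>1 < pi - saddle_angle a" "a * \<eta>1 \<le> pi"
  obtains C where "C \<ge> 0"
    "\<And>L \<Phi>. \<lbrakk>Re L > 0; \<bar>Im L\<bar> \<le> pi; large_param c a (Re L) \<ge> 1;
       saddle_radius c a (Re L) * exp (tan (saddle_angle a / 2) * \<eta>1)
         \<le> 1 / 2; primitive_of (lindelof c (- a) L) \<Phi>\<rbrakk> \<Longrightarrow>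
       norm (\<Phi> (spiral c a (Re L) \<eta>1) - \<Phi> (spiral c a (Re L) (- saddle_angle a)) - saddle_contrib c a (Re L))
       \<le> C * exp (large_param c a (Re L) * saddle_height a) *
           (1 / sqrt (large_param c a (Re L)) + saddle_radius c a (Re L)) / sqrt (large_param c a (Re L))"
proof -
  define \<psi> where "\<psi> = saddle_angle a"
  define \<tau> where "\<tau> = tan (\<psi> / 2)"
  define B where "B = phase_curv a"
  note sa = saddle_angle_bounds[OF a, folded \<psi>_def]
  have \<tau>: "\<tau> > 0" using sa by (simp add: \<tau>_def)
  obtain m where m: "m > 0" "m \<le> B" "\<And>\<eta>. \<eta> \<in> {- \<psi>..\<eta>1} \<Longrightarrow> Re (phase_drop a \<eta>) \<le> - m * \<eta>\<^sup>2"
    using Re_phase_drop_quadratic[OF a e(1) less_imp_le[OF e(2)] e(3)] unfolding B_def \<psi>_def by blast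
  define R where "R = max \<psi> \<eta>1"
  have R: "R \<ge> 0" using e by (simp add: R_def)
  obtain C1 where C1: "C1 \<ge> 0" "\<And>\<eta>. \<bar>\<eta>\<bar> \<le> R \<Longrightarrow> norm (phase_drop a \<eta> + of_real (B * \<eta>\<^sup>2)) \<le> C1 * \<bar>\<eta>\<bar> ^ 3"
    using phase_drop_cubic[OF a R] unfolding B_def by blast
  obtain C2 where C2: "C2 \<ge> 0" "\<And>s \<phi>. s \<noteq> 0 \<Longrightarrow> norm s \<le> 1/2 \<Longrightarrow> \<bar>\<phi>\<bar> \<le> pi \<Longrightarrow> norm (sine_factor \<phi> s - 1) \<le> C2 * norm s"
    by (rule sine_factor_near_1) blast
  obtain C3 where C3: "C3 \<ge> 0" 
    "\<And>(f :: real \<Rightarrow> complex) N \<rho>. \<lbrakk>N \<ge> 1; \<rho> \<ge> 0; continuous_on {-\<psi>..\<eta>1} f;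
       \<And>x. x \<in> {-\<psi>..\<eta>1} \<Longrightarrow> norm (f x - of_real (exp (- (N * B) * x\<^sup>2)))
         \<le> (C1 * N * \<bar>x\<bar> ^ 3 + \<rho>) * exp (- N * m * x\<^sup>2)\<rbrakk>
      \<Longrightarrow> norm (integral {-\<psi>..\<eta>1} f - of_real (sqrt (pi / (N * B)))) \<le> C3 * (1 / sqrt N + \<rho>) / sqrt N"
    by (rule laplace_method[of "-\<psi>" \<eta>1 m B C1]) (use sa e m C1 in auto)
  define D where "D = max 1 (C2 * exp (\<tau> * \<eta>1))"
  define C where "C = norm (spiral_dir a) * C3 * D"
  show ?thesis
  proof (rule that[of C])
    show "C \<ge> 0" using C3 by (simp add: C_def D_def)
    fix L \<Phi>
    assume l0: "Re L > 0" and im: "\<bar>Im L\<bar> \<le> pi" and N1: "large_param c a (Re L) \<ge> 1" 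
      and small0: "saddle_radius c a (Re L) * exp (tan (saddle_angle a / 2) * \<eta>1) \<le> 1 / 2"
      and prim: "primitive_of (lindelof c (- a) L) \<Phi>"
    define l where "l = Re L"
    define N where "N = large_param c a l"
    define \<sigma> where "\<sigma> = saddle_radius c a l"
    define s where "s = spiral c a l"
    define A where "A = exp (of_real N * (cis \<psi> * of_real (1 + 1 / a)))"
    have l: "l > 0" using l0 by (simp add: l_def)
    have \<sigma>: "\<sigma> > 0" unfolding \<sigma>_def by (rule saddle_radius_pos[OF c a l])
    have N: "N \<ge> 1" using N1 by (simp add: N_def l_def)
    have nA: "norm A = exp (N * saddle_height a)" by (simp add: A_def saddle_height_def \<psi>_def)
    have small: "\<sigma> * exp (\<tau> * \<eta>) \<le> \<sigma> * exp (\<tau> * \<eta>1)" "\<sigma> * exp (\<tau> * \<eta>) \<le> 1/2" if "\<eta> \<in> {-\<psi>..\<eta>1}" for \<eta>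
    proof -
      show "\<sigma> * exp (\<tau> * \<eta>) \<le> \<sigma> * exp (\<tau> * \<eta>1)" using that \<tau> \<sigma> by simp
      also have "\<dots> \<le> 1/2" using small0 by (simp add: \<sigma>_def \<tau>_def \<psi>_def l_def)
      finally show "\<sigma> * exp (\<tau> * \<eta>) \<le> 1/2" .
    qed
    have ns: "norm (s \<eta>) = \<sigma> * exp (\<tau> * \<eta>)" for \<eta>
      unfolding s_def spiral_polar[OF c a l] using \<sigma> by (simp add: rcis_def norm_mult \<sigma>_def \<tau>_def \<psi>_def)
    have gp: "s \<eta> \<in> gapped_plane" if "\<eta> \<in> {-\<psi>..\<eta>1}" for \<eta>
      unfolding s_def by (rule spiral_gapped[OF c a l]) (use that e small(2)[OF that] in \<open>auto simp: \<psi>_def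
        \<tau>_def \<sigma>_def\<close>)
    define f where "f = (\<lambda>\<eta>. exp (of_real N * phase_drop a \<eta>) * sine_factor (Im L) (s \<eta>))"
    have lf: "lindelof c (- a) L (s \<eta>) * s \<eta> = A * f \<eta>" if "\<eta> \<in> {-\<psi>..\<eta>1}" for \<eta>
      using lindelof_on_spiral[OF c a l0, of \<eta>] that e unfolding s_def l_def A_def f_def N_def \<psi>_def by auto
    have cs: "continuous_on X s" for X
      unfolding s_def spiral_def by (intro continuous_intros)
    have cf: "continuous_on {-\<psi>..\<eta>1} f"
    proof -
      have "s \<eta> \<noteq> 0" for \<eta> using ns[of \<eta>] \<sigma> by auto
      thus ?thesis
        unfolding f_def sine_factor_def using sin_pi_nonzero_gapped[OF gp]
        by (intro continuous_intros phase_drop_continuous cs) auto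
    qed
    have "((\<lambda>\<eta>. lindelof c (- a) L (s \<eta>) * (s \<eta> * spiral_dir a)) has_integral (\<Phi> (s \<eta>1) - \<Phi> (s (-\<psi>)))) {-\<psi>..\<eta>1}"
    proof (rule fundamental_theorem_of_calculus)
      show "-\<psi> \<le> \<eta>1" using e sa by simp
      fix \<eta> assume "\<eta> \<in> {-\<psi>..\<eta>1}"
      hence "(\<Phi> has_field_derivative lindelof c (- a) L (s \<eta>)) (at (s \<eta>))"
        using prim gp unfolding primitive_of_def by blast
      from field_vector_diff_chain_within[OF spiral_has_vector_derivative[of c a l \<eta>, folded s_def]
        has_field_derivative_at_within[OF this]]
      show "((\<lambda>x. \<Phi> (s x)) has_vector_derivative lindelof c (- a) L (s \<eta>) * (s \<eta>
        * spiral_dir a)) (at \<eta> within {- \<psi>..\<eta>1})"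
        by (simp add: o_def mult_ac)
    qed
    moreover have "((\<lambda>\<eta>. lindelof c (- a) L (s \<eta>) * (s \<eta> * spiral_dir a))
      has_integral (A * spiral_dir a * integral {-\<psi>..\<eta>1} f)) {-\<psi>..\<eta>1}"
    proof -
      have "(f has_integral integral {-\<psi>..\<eta>1} f) {-\<psi>..\<eta>1}"
        using cf by (intro integrable_integral integrable_continuous_real)
      from has_integral_mult_right[OF this, of "A * spiral_dir a"] show ?thesis
        by (rule has_integral_eq[rotated]) (use lf in \<open>simp add: mult_ac\<close>)
    qed
    ultimately have eq: "\<Phi> (s \<eta>1) - \<Phi> (s (-\<psi>)) = A * spiral_dir a * integral {-\<psi>..\<eta>1} f"
      by (rule has_integral_unique)
    define \<rho> where "\<rho> = C2 * (\<sigma> * exp (\<tau> * \<eta>1))"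
    have \<rho>: "\<rho> \<ge> 0" using C2 \<sigma> by (simp add: \<rho>_def)
    have "norm (integral {-\<psi>..\<eta>1} f - of_real (sqrt (pi / (N * B)))) \<le> C3 * (1 / sqrt N + \<rho>) / sqrt N"
    proof (rule C3(2)[OF N \<rho> cf])
      fix x assume x: "x \<in> {-\<psi>..\<eta>1}"
      define y where "y = of_real N * phase_drop a x"
      define y0 where "y0 = complex_of_real (- (N * B) * x\<^sup>2)"
      have "N * Re (phase_drop a x) \<le> N * (- m * x\<^sup>2)" using m(3)[OF x] N by (intro mult_left_mono) auto
      hence "Re y \<le> N * (- m * x\<^sup>2)" unfolding y_def by simp
      hence ry: "Re y \<le> - N * m * x\<^sup>2" by simp
      have "N * m * x\<^sup>2 \<le> N * B * x\<^sup>2" using N m by (intro mult_right_mono mult_left_mono) auto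
      hence ry0: "Re y0 \<le> - N * m * x\<^sup>2" by (simp add: y0_def)
      have "norm (y - y0) = N * norm (phase_drop a x + of_real (B * x\<^sup>2))"
      proof -
        have "y - y0 = of_real N * (phase_drop a x + of_real (B * x\<^sup>2))" by (simp add: y_def y0_def algebra_simps)
        thus ?thesis using N by (simp add: norm_mult)
      qed
      also have "\<dots> \<le> N * (C1 * \<bar>x\<bar>^3)" using N x by (intro mult_left_mono C1) (auto simp: R_def)
      finally have d: "norm (y - y0) \<le> C1 * N * \<bar>x\<bar>^3" by (simp add: mult_ac)
      have "norm (exp y - exp y0) \<le> exp (- N * m * x\<^sup>2) * norm (y - y0)"
        by (rule norm_exp_diff_le[OF ry ry0])
      also have "\<dots> \<le> exp (- N * m * x\<^sup>2) * (C1 * N * \<bar>x\<bar>^3)" by (intro mult_left_mono d) auto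
      finally have t1: "norm (exp y - exp y0) \<le> exp (- N * m * x\<^sup>2) * (C1 * N * \<bar>x\<bar>^3)" .
      have "norm (sine_factor (Im L) (s x) - 1) \<le> C2 * norm (s x)"
        by (rule C2(2)[OF _ _ im]) (use ns[of x] small(2)[OF x] \<sigma> in auto)
      also have "\<dots> \<le> \<rho>" unfolding \<rho>_def ns by (rule mult_left_mono[OF small(1)[OF x] C2(1)])
      finally have t2: "norm (sine_factor (Im L) (s x) - 1) \<le> \<rho>" .
      have t3: "norm (exp y) \<le> exp (- N * m * x\<^sup>2)" using ry by simp
      have "f x - of_real (exp (- (N * B) * x\<^sup>2)) = (exp y - exp y0) + exp y * (sine_factor (Im L) (s x) - 1)"
        unfolding f_def y_def[symmetric] y0_def exp_of_real[symmetric] by (simp add: algebra_simps)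
      also have "norm \<dots> \<le> norm (exp y - exp y0) + norm (exp y) * norm (sine_factor (Im L) (s x) - 1)"
        by (metis norm_mult norm_triangle_ineq)
      also have "\<dots> \<le> exp (- N * m * x\<^sup>2) * (C1 * N * \<bar>x\<bar>^3) + exp (- N * m * x\<^sup>2) * \<rho>"
        by (intro add_mono t1 mult_mono t2 t3) auto
      finally show "norm (f x - of_real (exp (- (N * B) * x\<^sup>2))) \<le> (C1 * N * \<bar>x\<bar> ^ 3 + \<rho>) * exp (- N * m * x\<^sup>2)"
        by (simp add: algebra_simps)
    qed
    also have "C3 * (1 / sqrt N + \<rho>) / sqrt N \<le> C3 * (D * (1 / sqrt N + \<sigma>)) / sqrt N"
    proof -
      have "\<rho> = C2 * exp (\<tau> * \<eta>1) * \<sigma>" by (simp add: \<rho>_def)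
      also have "\<dots> \<le> D * \<sigma>" unfolding D_def using \<sigma> by (intro mult_right_mono) auto
      finally have "\<rho> \<le> D * \<sigma>" .
      moreover have "1 / sqrt N \<le> D * (1 / sqrt N)"
        using mult_right_mono[of 1 D "1 / sqrt N"] N by (simp add: D_def)
      ultimately have "1 / sqrt N + \<rho> \<le> D * (1 / sqrt N + \<sigma>)" by (simp add: distrib_left)
      thus ?thesis using C3 N by (intro divide_right_mono mult_left_mono) auto
    qed
    finally have I: "norm (integral {-\<psi>..\<eta>1} f - of_real (sqrt (pi / (N * B))))
      \<le> C3 * (D * (1 / sqrt N + \<sigma>)) / sqrt N" .
    have "\<Phi> (s \<eta>1) - \<Phi> (s (-\<psi>)) - saddle_contrib c a l
      = A * spiral_dir a * (integral {-\<psi>..\<eta>1} f - of_real (sqrt (pi / (N * B))))"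
    proof -
      have sc: "saddle_contrib c a l = A * (spiral_dir a * of_real (sqrt (pi / (N * B))))"
        by (simp only: saddle_contrib_def A_def N_def B_def \<psi>_def)
      show ?thesis unfolding eq sc by (simp add: algebra_simps)
    qed
    hence "norm (\<Phi> (s \<eta>1) - \<Phi> (s (-\<psi>)) - saddle_contrib c a l) = 
       exp (N * saddle_height a) * norm (spiral_dir a) * norm (integral {-\<psi>..\<eta>1} f - of_real (sqrt (pi / (N
         * B))))"
      by (simp add: norm_mult nA)
    also have "\<dots> \<le> exp (N * saddle_height a) * norm (spiral_dir a) * (C3 * (D * (1 / sqrt N + \<sigma>)) / sqrt N)"
      by (intro mult_left_mono I) auto
    also have "\<dots> = C * exp (N * saddle_height a) * (1 / sqrt N + \<sigma>) / sqrt N" by (simp add: C_def mult_ac)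
    finally show "norm (\<Phi> (spiral c a (Re L) \<eta>1) - \<Phi> (spiral c a (Re L) (- saddle_angle a))
      - saddle_contrib c a (Re L))
       \<le> C * exp (large_param c a (Re L) * saddle_height a) *
           (1 / sqrt (large_param c a (Re L)) + saddle_radius c a (Re L)) / sqrt (large_param c a (Re L))"
      unfolding s_def l_def N_def \<sigma>_def \<psi>_def .
  qed
qed

section \<open>The rest of the contour\<close>

lemma primitive_segment_bound:
  assumes "primitive_of f \<Phi>" "closed_segment w z \<subseteq> gapped_plane" "\<And>s. s \<in> closed_segment w z \<Longrightarrow> norm (f s) \<le> K"
  shows "norm (\<Phi> z - \<Phi> w) \<le> K * norm (z - w)"
proof (rule field_differentiable_bound[where S = "closed_segment w z" and f' = f])
  fix s assume s: "s \<in> closed_segment w z"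
  hence "(\<Phi> has_field_derivative f s) (at s)" using assms(1,2) unfolding primitive_of_def by blast
  thus "(\<Phi> has_field_derivative f s) (at s within closed_segment w z)" by (rule has_field_derivative_at_within)
  show "norm (f s) \<le> K" using s by (rule assms(3))
qed simp_all

lemma closed_segment_vertical:
  assumes "s \<in> closed_segment (Complex x y1) (Complex x y2)"
  shows "Re s = x" "min y1 y2 \<le> Im s" "Im s \<le> max y1 y2"
  using assms by (auto simp: closed_segment_same_Re closed_segment_eq_real_ivl split: if_splits)

lemma closed_segment_horizontal:
  assumes "s \<in> closed_segment (Complex x1 y) (Complex x2 y)"
  shows "Im s = y" "min x1 x2 \<le> Re s" "Re s \<le> max x1 x2"
  using assms by (auto simp: closed_segment_same_Im closed_segment_eq_real_ivl split: if_splits)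

lemma norm_Complex_diff:
  "norm (Complex x y2 - Complex x y1) = \<bar>y2 - y1\<bar>" "norm (Complex x2 y - Complex x1 y) = \<bar>x2 - x1\<bar>"
  by (simp_all add: cmod_def)

text \<open>From \<open>x0 + i/2\<close> the contour goes left at height \<open>1/2\<close>, where \<open>exp (x l)\<close> alone is integrable; hence
this part is uniform up to \<open>\<bar>Im L\<bar> = \<pi>\<close>. Only the return to the line \<open>Re s = 1/2\<close> at height \<open>T\<close> needs
\<open>\<bar>Im L\<bar> < \<pi>\<close>, and its contribution disappears with \<open>T \<rightarrow> \<infinity>\<close> for each fixed \<open>L\<close>: hence the arbitrary \<open>\<delta>\<close>.\<close>

lemma tail_to_infinity:
  assumes "\<theta> < 0" "L \<in> log_strip" "Re L > 0" and prim: "primitive_of (lindelof c \<theta> L) \<Phi>" and x0: "x0 \<le> 1/2"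
    and \<delta>: "\<delta> > 0"
  shows "\<forall>\<^sub>F T in at_top. norm (\<Phi> (Complex (1/2) T) - \<Phi> (Complex x0 (1/2)))
    \<le> 4 * pi * damp_bound c \<theta> * exp (x0 * Re L) / Re L + \<delta>"
proof -
  define l where "l = Re L"
  define K where "K = 4 * pi * damp_bound c \<theta>"
  define d where "d = pi - \<bar>Im L\<bar>"
  have K: "K > 0" by (simp add: K_def damp_bound_pos)
  have l: "l > 0" using assms by (simp add: l_def)
  have d: "d > 0" using assms by (simp add: d_def log_strip_def)
  have b: "norm (lindelof c \<theta> L s) \<le> K * exp (Re s * l) * exp (- d * \<bar>Im s\<bar>)" if "\<bar>Im s\<bar> \<ge> 1/2" for s
    unfolding K_def l_def d_def
    by (rule norm_lindelof_le) (use assms that abs_Im_le_cmod[of s] in auto)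
  have ten: "((\<lambda>T. K * exp (- T * l) * T + K * exp (1/2 * l) * exp (- d * T) * (T + 1/2)) \<longlongrightarrow> 0) at_top"
  proof -
    define K2 where "K2 = K * exp (1/2 * l)"
    have "K2 > 0" using K by (simp add: K2_def)
    hence "((\<lambda>T. K * exp (- T * l) * T) \<longlongrightarrow> 0) at_top" "((\<lambda>T. K2 * exp (- d * T) * (T + 1/2)) \<longlongrightarrow> 0) at_top"
      using K l d by real_asymp+
    from tendsto_add[OF this] show ?thesis by (simp add: K2_def)
  qed
  have "\<forall>\<^sub>F T in at_top. K * exp (- T * l) * T + K * exp (1/2 * l) * exp (- d * T) * (T + 1/2) < \<delta>"
    by (rule order_tendstoD(2)[OF ten \<delta>])
  thus ?thesis using eventually_gt_at_top[of 1] eventually_gt_at_top[of "- x0"]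
  proof eventually_elim
    case (elim T)
    \<comment> \<open>From \<open>-T + i/2\<close> to \<open>x0 + i/2\<close>, with \<open>K exp (x l) / l\<close> as a majorizing primitive.\<close>
    have "norm (\<Phi> (Complex x0 (1/2)) - \<Phi> (Complex (-T) (1/2))) \<le> K * exp (x0 * l) / l - K * exp (- T * l) / l"
    proof (rule differentiable_bound_general[where f = "\<lambda>x. \<Phi> (Complex x (1/2))" and \<phi> = "\<lambda>x. K * exp (x * l) / l"
          and f' = "\<lambda>x. lindelof c \<theta> L (Complex x (1/2))" and \<phi>' = "\<lambda>x. K * exp (x * l)"])
      have D: "((\<lambda>x. \<Phi> (Complex x (1/2))) has_vector_derivative lindelof c \<theta> L (Complex x (1/2))) (at x)" for x
      proof -
        have 1: "((\<lambda>x. Complex x (1/2)) has_vector_derivative 1) (at x)"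
          unfolding Complex_eq by (auto intro!: derivative_eq_intros)
        have "(\<Phi> has_field_derivative lindelof c \<theta> L (Complex x (1/2))) (at (Complex x (1/2)))"
          using prim by (simp add: primitive_of_def gapped_plane_def)
        from field_vector_diff_chain_at[OF 1 this] show ?thesis by (simp add: o_def)
      qed
      show "continuous_on {- T..x0} (\<lambda>x. \<Phi> (Complex x (1/2)))"
        using D by (intro continuous_at_imp_continuous_on ballI has_vector_derivative_continuous)
      show "((\<lambda>x. \<Phi> (Complex x (1/2))) has_vector_derivative lindelof c \<theta> L (Complex x (1/2))) (at x)" for x
        by (rule D)
      show "((\<lambda>x. K * exp (x * l) / l) has_vector_derivative K * exp (x * l)) (at x)" for x
        unfolding has_real_derivative_iff_has_vector_derivative[symmetric] using l
        by (auto intro!: derivative_eq_intros)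
      show "norm (lindelof c \<theta> L (Complex x (1/2))) \<le> K * exp (x * l)" for x
      proof -
        have "norm (lindelof c \<theta> L (Complex x (1/2))) \<le> K * exp (x * l) * exp (- d * (1/2))"
          using b[of "Complex x (1/2)"] by simp
        also have "\<dots> \<le> K * exp (x * l) * 1" using K d by (intro mult_left_mono) auto
        finally show ?thesis by simp
      qed
    qed (use elim l in \<open>auto intro!: continuous_intros\<close>)
    also have "\<dots> \<le> K * exp (x0 * l) / l" using K l by simp
    finally have 1: "norm (\<Phi> (Complex x0 (1/2)) - \<Phi> (Complex (-T) (1/2))) \<le> K * exp (x0 * l) / l" .
    \<comment> \<open>Up from \<open>-T + i/2\<close> to \<open>-T + iT\<close>.\<close>
    have "norm (\<Phi> (Complex (-T) T) - \<Phi> (Complex (-T) (1/2)))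
      \<le> K * exp (- T * l) * norm (Complex (-T) T - Complex (-T) (1/2))"
    proof (rule primitive_segment_bound[OF prim])
      fix s assume s: "s \<in> closed_segment (Complex (-T) (1/2)) (Complex (-T) T)"
      note s' = closed_segment_vertical[OF s]
      have "norm (lindelof c \<theta> L s) \<le> K * exp (- T * l) * exp (- d * \<bar>Im s\<bar>)" using b[of s] s' elim by simp
      also have "\<dots> \<le> K * exp (- T * l) * 1" using K d by (intro mult_left_mono) auto
      finally show "norm (lindelof c \<theta> L s) \<le> K * exp (- T * l)" by simp
    qed (use elim closed_segment_vertical in \<open>fastforce simp: gapped_plane_def\<close>)
    also have "\<dots> \<le> K * exp (- T * l) * T" unfolding norm_Complex_diff using elim K by (intro mult_left_mono) auto
    finally have 2: "norm (\<Phi> (Complex (-T) T) - \<Phi> (Complex (-T) (1/2))) \<le> K * exp (- T * l) * T" .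
    \<comment> \<open>Right from \<open>-T + iT\<close> to \<open>1/2 + iT\<close>.\<close>
    have "norm (\<Phi> (Complex (1/2) T) - \<Phi> (Complex (-T) T))
      \<le> K * exp (1/2 * l) * exp (- d * T) * norm (Complex (1/2) T - Complex (-T) T)"
    proof (rule primitive_segment_bound[OF prim])
      fix s assume s: "s \<in> closed_segment (Complex (-T) T) (Complex (1/2) T)"
      note s' = closed_segment_horizontal[OF s]
      have "norm (lindelof c \<theta> L s) \<le> K * exp (Re s * l) * exp (- d * T)" using b[of s] s' elim by simp
      also have "\<dots> \<le> K * exp (1/2 * l) * exp (- d * T)"
        using K l s' elim by (intro mult_right_mono mult_left_mono) auto
      finally show "norm (lindelof c \<theta> L s) \<le> K * exp (1/2 * l) * exp (- d * T)" .
    qed (use elim closed_segment_horizontal in \<open>fastforce simp: gapped_plane_def\<close>)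
    also have "\<dots> = K * exp (1/2 * l) * exp (- d * T) * (T + 1/2)" unfolding norm_Complex_diff using elim by simp
    finally have 3: "norm (\<Phi> (Complex (1/2) T) - \<Phi> (Complex (-T) T))
      \<le> K * exp (1/2 * l) * exp (- d * T) * (T + 1/2)" .
    have "\<Phi> (Complex (1/2) T) - \<Phi> (Complex x0 (1/2)) = 
        (\<Phi> (Complex (1/2) T) - \<Phi> (Complex (-T) T)) + (\<Phi> (Complex (-T) T) - \<Phi> (Complex (-T) (1/2)))
          - (\<Phi> (Complex x0 (1/2)) - \<Phi> (Complex (-T) (1/2)))"
      by simp
    also have "norm \<dots> \<le> norm (\<Phi> (Complex (1/2) T) - \<Phi> (Complex (-T) T)) + norm (\<Phi> (Complex (-T) T)
      - \<Phi> (Complex (-T) (1/2)))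
        + norm (\<Phi> (Complex x0 (1/2)) - \<Phi> (Complex (-T) (1/2)))"
      by (rule order.trans[OF norm_triangle_ineq4 add_right_mono[OF norm_triangle_ineq]])
    also have "\<dots> \<le> K * exp (x0 * l) / l + \<delta>" using 1 2 3 elim by linarith
    finally show ?case unfolding K_def l_def .
  qed
qed

text \<open>The bound used where the contour is still close to the singularity at \<open>0\<close>, in terms of the height \<open>h\<close>
of the phase.\<close>

lemma norm_lindelof_near_0_le:
  assumes "\<bar>Re s\<bar> \<le> 1/2" "\<bar>Im s\<bar> \<le> 1/2" "r \<le> norm s" "r > 0" "\<bar>Im L\<bar> \<le> pi"
    and h: "Re (of_real c * s powr of_real \<theta>) + Re s * Re L \<le> h"
  shows "norm (lindelof c \<theta> L s) \<le> exp h * (exp (pi/2) * pi / (2 * r))"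
proof -
  have s0: "s \<noteq> 0" using assms by auto
  have "- (Im s * Im L) \<le> \<bar>Im s\<bar> * \<bar>Im L\<bar>" by (metis abs_ge_minus_self abs_mult)
  also have "\<dots> \<le> 1/2 * pi" by (intro mult_mono assms) auto
  finally have i: "- (Im s * Im L) \<le> pi/2" by simp
  have "norm (of_real pi / sin (of_real pi * s)) \<le> pi / (2 * norm s)"
    by (rule norm_pi_over_sin_le) fact+
  also have "\<dots> \<le> pi / (2 * r)" using assms s0 by (intro divide_left_mono mult_pos_pos) auto
  finally have 1: "norm (of_real pi / sin (of_real pi * s)) \<le> pi / (2 * r)" .
  have "norm (damp c \<theta> s * exp (s * L)) = exp (Re (of_real c * s powr of_real \<theta>) + Re s * Re L + (- (Im s
    * Im L)))"
    by (simp add: damp_def norm_mult exp_add[symmetric])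
  also have "\<dots> \<le> exp (h + pi/2)" using h i by (subst exp_le_cancel_iff) linarith
  finally have 2: "norm (damp c \<theta> s * exp (s * L)) \<le> exp (h + pi/2)" .
  have "norm (lindelof c \<theta> L s) \<le> exp (h + pi/2) * (pi / (2 * r))"
    unfolding lindelof_def norm_mult[of "damp c \<theta> s * exp (s * L)"] by (intro mult_mono 1 2) auto
  thus ?thesis by (simp add: exp_add)
qed

lemma saddle_radius_tendsto_0:
  assumes "c < 0" "a > 0"
  shows "(saddle_radius c a \<longlongrightarrow> 0) at_top"
proof -
  define b where "b = a * (- c)"
  have "b > 0" using assms by (simp add: b_def mult_pos_neg)
  moreover have "1 / (1 + a) > 0" using assms by simp
  ultimately have "((\<lambda>l. (l / b) powr (- (1 / (1 + a)))) \<longlongrightarrow> 0) at_top" by real_asymp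
  thus ?thesis unfolding saddle_radius_def[abs_def] b_def by simp
qed

lemma large_param_at_top:
  assumes "c < 0" "a > 0"
  shows "filterlim (large_param c a) at_top at_top"
proof -
  define b where "b = (a * (- c)) powr (1 / (1 + a))"
  have "b > 0" using assms by (simp add: b_def)
  moreover define p where "p = a / (1 + a)"
  have "p > 0" using assms by (simp add: p_def)
  ultimately have "filterlim (\<lambda>l. b * l powr p) at_top at_top" by real_asymp
  moreover have "\<forall>\<^sub>F l in at_top. b * l powr p = large_param c a l"
    using eventually_gt_at_top[of 0] by eventually_elim (simp only: b_def p_def large_param_eq[OF assms])
  ultimately show ?thesis by (rule filterlim_mono_eventually[OF _ order.refl order.refl])
qed

lemma eventually_saddle_small:
  assumes "c < 0" "a > 0" "\<epsilon> > 0"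
  shows "\<forall>\<^sub>F l in at_top. l \<ge> 1 \<and> large_param c a l \<ge> 1 \<and> saddle_radius c a l \<le> \<epsilon>"
  using eventually_ge_at_top[of 1] filterlim_at_top[THEN iffD1, OF large_param_at_top[OF assms(1,2)],
    rule_format, of 1]
    order_tendstoD(2)[OF saddle_radius_tendsto_0[OF assms(1,2)] assms(3)]
  by eventually_elim auto

text \<open>Leaving the spiral at parameter \<open>\<eta>1\<close>, the rest of the contour to \<open>1/2 + i\<infinity>\<close> contributes exponentially
less, in the scale \<open>N\<close>, than the saddle point. The limit is expressed by \<open>T\<close>, the height reached on the line
\<open>Re s = 1/2\<close>.\<close>

definition tail_negligible :: "real \<Rightarrow> real \<Rightarrow> real \<Rightarrow> bool" where
  "tail_negligible c a \<eta>1 \<longleftrightarrow> (\<exists>\<kappa>>0. \<exists>C\<ge>0. \<forall>\<^sub>F l in at_top.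
     upper_integral_near c a l (spiral c a l \<eta>1) 0
       (C * l * exp (large_param c a l * (saddle_height a - \<kappa>))))"

text \<open>For \<open>a > 1\<close> follow the spiral up to \<open>\<eta>1 = \<psi>/a\<close> and then go up vertically. There the real part of the
phase is at most \<open>X1 + 1/a\<close>, where \<open>X1\<close> is the abscissa of the vertical line in units of \<open>\<sigma>\<close>. On the spiral
the abscissa decreases at least at the rate \<open>tan (\<psi>/2)\<close>, and \<open>tan (\<psi>/2) \<eta>1 > (1 - cos \<psi>) / a\<close> because
\<open>sin \<psi> < \<psi>\<close>; this brings \<open>X1 + 1/a\<close> below the height \<open>(1 + 1/a) cos \<psi>\<close> of the saddle.\<close>

lemma tail_estimate_steep:
  assumes c: "c < 0" and a: "a > 1"
  defines "\<eta>1 \<equiv> saddle_angle a / a"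
  shows "0 < \<eta>1" "\<eta>1 < pi - saddle_angle a" "a * \<eta>1 \<le> pi"
    and "tail_negligible c a \<eta>1"
proof -
  define \<psi> where "\<psi> = saddle_angle a"
  have a0: "a > 0" using a by simp
  note sa = saddle_angle_bounds[OF a0, folded \<psi>_def]
  define \<beta> where "\<beta> = \<psi> / 2"
  define \<tau> where "\<tau> = tan \<beta>"
  have psi: "\<psi> = 2 * \<beta>" by (simp add: \<beta>_def)
  have bb: "0 < \<beta>" "\<beta> < pi/2" "cos \<beta> > 0" "sin \<beta> > 0" "\<tau> > 0" using sa by (auto simp: \<beta>_def \<tau>_def)
  show e0: "0 < \<eta>1" using sa a by (simp add: \<eta>1_def \<psi>_def)
  have lt: "\<psi> / a < a * \<psi>"
  proof -
    have 1: "1 * \<psi> < a * \<psi>" by (rule mult_strict_right_mono) (use sa(1) a in auto)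
    have "a * (1 * \<psi>) < a * (a * \<psi>)" by (rule mult_strict_left_mono[OF 1]) (use a in auto)
    with 1 have "\<psi> < a * (a * \<psi>)" by linarith
    thus ?thesis using a by (simp add: pos_divide_less_eq mult_ac)
  qed
  thus e1: "\<eta>1 < pi - saddle_angle a" using sa(3) unfolding \<eta>1_def \<psi>_def by linarith
  have "a * \<eta>1 = \<psi>" using a unfolding \<eta>1_def \<psi>_def
    by (simp only: nonzero_mult_div_cancel_left times_divide_eq_right)
  thus e2: "a * \<eta>1 \<le> pi" using sa by simp
  have e1': "\<eta>1 \<le> pi - 2 * \<beta>" using e1 psi by (simp add: \<psi>_def)
  define X1 where "X1 = exp (\<tau> * \<eta>1) * cos (\<psi> + \<eta>1)"
  define Y1 where "Y1 = exp (\<tau> * \<eta>1) * sin (\<psi> + \<eta>1)"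
  have "X1 + \<tau> * \<eta>1 \<le> exp (\<tau> * 0) * cos (\<psi> + 0) + \<tau> * 0"
    unfolding X1_def
  proof (rule DERIV_nonpos_imp_nonincreasing[where f = "\<lambda>x. exp (\<tau> * x) * cos (\<psi> + x) + \<tau> * x"])
    fix x assume x: "0 \<le> x" "x \<le> \<eta>1"
    have "((\<lambda>x. exp (\<tau> * x) * cos (\<psi> + x) + \<tau> * x) has_real_derivative 
       exp (\<tau> * x) * (\<tau> * cos (\<psi> + x) - sin (\<psi> + x)) + \<tau>) (at x)"
      by (auto intro!: derivative_eq_intros simp: algebra_simps)
    also have "exp (\<tau> * x) * (\<tau> * cos (\<psi> + x) - sin (\<psi> + x)) + \<tau> = (sin \<beta> - exp (\<tau> * x) * sin (\<beta> + x)) / cos \<beta>"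
      unfolding \<tau>_def psi tan_times_cos_minus_sin[OF bb(3)] by (simp add: tan_def diff_divide_distrib)
    finally have "((\<lambda>x. exp (\<tau> * x) * cos (\<psi> + x) + \<tau> * x)
      has_real_derivative (sin \<beta> - exp (\<tau> * x) * sin (\<beta> + x)) / cos \<beta>) (at x)" .
    moreover have "sin \<beta> \<le> exp (\<tau> * x) * sin (\<beta> + x)"
      by (rule exp_sin_ge) (use bb x e1' in auto)
    hence "(sin \<beta> - exp (\<tau> * x) * sin (\<beta> + x)) / cos \<beta> \<le> 0" using bb by (simp add: divide_nonpos_pos)
    ultimately show "\<exists>y. ((\<lambda>x. exp (\<tau> * x) * cos (\<psi> + x) + \<tau> * x) has_real_derivative y) (at x) \<and> y \<le> 0" by blast
  qed (use e0 in simp)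
  hence X1le: "X1 \<le> cos \<psi> - \<tau> * \<eta>1" by simp
  have "(1 - cos \<psi>) / a < \<tau> * \<eta>1"
  proof -
    have "cos \<beta> < cos 0" using bb by (intro cos_monotone_0_pi) auto
    hence "2 * sin \<beta> * cos \<beta> < 2 * sin \<beta> * 1" using bb by (intro mult_strict_left_mono) auto
    also have "\<dots> \<le> \<psi>" using sin_x_le_x[of \<beta>] bb unfolding psi by simp
    finally have "2 * sin \<beta> * cos \<beta> < \<psi>" .
    hence "2 * sin \<beta> < \<psi> / cos \<beta>" using bb by (simp add: field_simps)
    hence "sin \<beta> * (2 * sin \<beta>) < sin \<beta> * (\<psi> / cos \<beta>)" using bb by (intro mult_strict_left_mono) auto
    moreover have "1 - cos \<psi> = sin \<beta> * (2 * sin \<beta>)" unfolding psi by (simp add: cos_double_sin power2_eq_square)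
    ultimately have "1 - cos \<psi> < \<tau> * \<psi>" by (simp add: \<tau>_def tan_def)
    hence "(1 - cos \<psi>) / a < \<tau> * \<psi> / a" using a by (intro divide_strict_right_mono) auto
    thus ?thesis by (simp add: \<eta>1_def \<psi>_def)
  qed
  hence lower: "X1 + 1 / a < saddle_height a" using X1le a
    by (simp add: saddle_height_def \<psi>_def[symmetric] distrib_right diff_divide_distrib)
  define \<kappa> where "\<kappa> = saddle_height a - (X1 + 1 / a)"
  have \<kappa>: "\<kappa> > 0" using lower by (simp add: \<kappa>_def)
  have Y1: "Y1 > 0" unfolding Y1_def using sa e0 e1 \<psi>_def by (intro mult_pos_pos sin_gt_zero) auto
  define K where "K = 4 * pi * damp_bound c (- a)"
  have K: "K > 0" by (simp add: K_def damp_bound_pos)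
  define E1 where "E1 = exp (\<tau> * \<eta>1)"
  have E1: "E1 \<ge> 1" using bb e0 by (simp add: E1_def)
  define C where "C = exp (pi/2) * pi / 4 + K + 1"
  have C: "C \<ge> 0" using K by (simp add: C_def add_nonneg_nonneg)
  have "\<forall>\<^sub>F l in at_top. l \<ge> 1 \<and> large_param c a l \<ge> 1 \<and> saddle_radius c a l \<le> 1 / (2 * E1)"
    by (rule eventually_saddle_small[OF c a0]) (use E1 in auto)
  hence "\<forall>\<^sub>F l in at_top. upper_integral_near c a l (spiral c a l \<eta>1) 0 (C * l * exp (large_param c a l
    * (saddle_height a - \<kappa>)))"
  proof (eventually_elim, unfold upper_integral_near_def diff_zero, intro ballI impI allI)
    fix l L \<Phi> assume l0: "l \<ge> 1 \<and> large_param c a l \<ge> 1 \<and> saddle_radius c a l \<le> 1 / (2 * E1)"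
      and L: "L \<in> log_strip" "Re L = l" and prim: "primitive_of (lindelof c (- a) L) \<Phi>"
    define \<sigma> where "\<sigma> = saddle_radius c a l"
    define N where "N = large_param c a l"
    have l: "l \<ge> 1" and N1: "N \<ge> 1" and sE: "\<sigma> * E1 \<le> 1/2" using l0 E1 by (auto simp: N_def \<sigma>_def field_simps)
    have \<sigma>: "\<sigma> > 0" unfolding \<sigma>_def using l by (intro saddle_radius_pos c a0) auto
    have N: "N = \<sigma> * l" by (simp add: N_def \<sigma>_def large_param_def)
    have inv: "1 / \<sigma> \<le> l" using N1 \<sigma> unfolding N by (simp add: field_simps)
    have sp: "spiral c a l \<eta>1 = Complex (\<sigma> * X1) (\<sigma> * Y1)"
      using l by (subst spiral_polar[OF c a0]) (auto simp: complex_eq_iff X1_def Y1_def \<sigma>_def \<tau>_def \<beta>_def \<psi>_def)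
    have nsp: "norm (Complex (\<sigma> * X1) (\<sigma> * Y1)) = \<sigma> * E1"
      unfolding sp[symmetric] using l \<sigma>
        by (subst spiral_polar[OF c a0]) (auto simp: rcis_def norm_mult E1_def \<sigma>_def \<tau>_def \<beta>_def \<psi>_def)
    have x: "\<bar>\<sigma> * X1\<bar> \<le> 1/2" using abs_Re_le_cmod[of "Complex (\<sigma> * X1) (\<sigma> * Y1)"] sE unfolding nsp by simp
    have y: "\<sigma> * Y1 \<le> 1/2" using abs_Im_le_cmod[of "Complex (\<sigma> * X1) (\<sigma> * Y1)"] sE unfolding nsp by simp
    have y0: "\<sigma> * Y1 > 0" using \<sigma> Y1 by simp
    have hh: "N * (X1 + 1 / a) = N * (saddle_height a - \<kappa>)" by (simp add: \<kappa>_def)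
    have "norm (\<Phi> (Complex (\<sigma> * X1) (1/2)) - \<Phi> (Complex (\<sigma> * X1) (\<sigma> * Y1))) \<le> 
       exp (N * (X1 + 1 / a)) * (exp (pi/2) * pi / (2 * \<sigma>)) * norm (Complex (\<sigma> * X1) (1/2) - Complex (\<sigma>
         * X1) (\<sigma> * Y1))"
    proof (rule primitive_segment_bound[OF prim])
      show "closed_segment (Complex (\<sigma> * X1) (\<sigma> * Y1)) (Complex (\<sigma> * X1) (1 / 2)) \<subseteq> gapped_plane"
        using closed_segment_vertical(2) y0 by (fastforce simp: gapped_plane_def)
      fix s assume s: "s \<in> closed_segment (Complex (\<sigma> * X1) (\<sigma> * Y1)) (Complex (\<sigma> * X1) (1 / 2))"
      note s' = closed_segment_vertical[OF s]
      have im: "\<sigma> * Y1 \<le> Im s" "Im s \<le> 1/2" using s' y by auto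
      have "\<sigma> \<le> \<sigma> * E1" using \<sigma> E1 by simp
      also have "\<dots> \<le> norm s" unfolding nsp[symmetric] using s'(1) im y0
        by (auto simp: cmod_def intro!: power_mono)
      finally have ns: "\<sigma> \<le> norm s" .
      have "Re (of_real c * s powr of_real (- a)) \<le> norm (of_real c * s powr of_real (- a))"
        by (rule complex_Re_le_cmod)
      also have "\<dots> = - c * norm s powr (- a)" using c by (simp add: norm_mult norm_powr_real_powr')
      also have "\<dots> \<le> - c * \<sigma> powr (- a)" using ns \<sigma> c a0 by (intro mult_left_mono powr_mono2') auto
      also have "\<dots> = N / a" unfolding \<sigma>_def N_def using l by (intro saddle_radius_powr c a0) auto
      finally have "Re (of_real c * s powr of_real (- a)) + Re s * Re L \<le> N * (X1 + 1 / a)"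
        using s'(1) L N by (simp add: algebra_simps)
      thus "norm (lindelof c (- a) L s) \<le> exp (N * (X1 + 1 / a)) * (exp (pi/2) * pi / (2 * \<sigma>))"
        using L ns \<sigma> s'(1) x im y0 by (intro norm_lindelof_near_0_le) (auto simp: log_strip_def)
    qed
    also have "\<dots> \<le> exp (N * (X1 + 1 / a)) * (exp (pi/2) * pi / (2 * \<sigma>)) * (1/2)"
      unfolding norm_Complex_diff using y y0 \<sigma> by (intro mult_left_mono) auto
    also have "\<dots> = exp (pi/2) * pi / 4 * exp (N * (X1 + 1 / a)) * (1 / \<sigma>)" by simp
    also have "\<dots> \<le> exp (pi/2) * pi / 4 * exp (N * (X1 + 1 / a)) * l" by (intro mult_left_mono inv) auto
    finally have 1: "norm (\<Phi> (Complex (\<sigma> * X1) (1/2)) - \<Phi> (spiral c a l \<eta>1))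
      \<le> exp (pi/2) * pi / 4 * exp (N * (X1 + 1 / a)) * l"
      unfolding sp .
    have "\<forall>\<^sub>F T in at_top. norm (\<Phi> (Complex (1/2) T) - \<Phi> (Complex (\<sigma> * X1) (1/2))) \<le> 
       4 * pi * damp_bound c (- a) * exp (\<sigma> * X1 * Re L) / Re L + exp (N * (X1 + 1 / a))"
      by (rule tail_to_infinity[OF _ L(1) _ prim]) (use a0 L l x in auto)
    thus "\<forall>\<^sub>F T in at_top. norm (\<Phi> (Complex (1/2) T) - \<Phi> (spiral c a l \<eta>1))
      \<le> C * l * exp (large_param c a l * (saddle_height a - \<kappa>))"
    proof eventually_elim
      case (elim T)
      have "4 * pi * damp_bound c (- a) * exp (\<sigma> * X1 * Re L) / Re L = K * exp (N * X1) / l"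
        using L by (simp add: K_def N mult_ac)
      also have "\<dots> \<le> K * exp (N * (X1 + 1 / a)) * l"
      proof -
        have "K * exp (N * X1) / l \<le> K * exp (N * X1) / 1" using l K by (intro divide_left_mono) auto
        also have "\<dots> \<le> K * exp (N * (X1 + 1 / a)) * 1" using K N1 a0 by (simp add: mult_left_mono)
        also have "\<dots> \<le> K * exp (N * (X1 + 1 / a)) * l" using K l by (intro mult_left_mono) auto
        finally show ?thesis .
      qed
      finally have 2: "4 * pi * damp_bound c (- a) * exp (\<sigma> * X1 * Re L) / Re L \<le> K * exp (N * (X1 + 1 / a)) * l" .
      have 3: "exp (N * (X1 + 1 / a)) \<le> 1 * exp (N * (X1 + 1 / a)) * l" using l by simp
      have "norm (\<Phi> (Complex (1/2) T) - \<Phi> (spiral c a l \<eta>1)) \<le> 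
         norm (\<Phi> (Complex (1/2) T) - \<Phi> (Complex (\<sigma> * X1) (1/2))) + norm (\<Phi> (Complex (\<sigma> * X1) (1/2))
           - \<Phi> (spiral c a l \<eta>1))"
        by (rule order.trans[OF _ norm_triangle_ineq]) simp
      also have "\<dots> \<le> K * exp (N * (X1 + 1 / a)) * l + 1 * exp (N * (X1 + 1 / a)) * l + exp (pi/2) * pi / 4
        * exp (N * (X1 + 1 / a)) * l"
        using elim 1 2 3 by linarith
      also have "\<dots> = C * l * exp (N * (X1 + 1 / a))" by (simp add: C_def algebra_simps)
      finally show ?case unfolding hh by (simp only: N_def)
    qed
  qed
  thus "tail_negligible c a \<eta>1"
    unfolding tail_negligible_def using \<kappa> C by blast
qed

text \<open>The derivative of the exponent is \<open>l + a (-c) u powr (-a - 1)\<close>. The two terms have equal modulus on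
the circle through the saddle points; outside this circle the first one is larger, so that moving to the
left never increases the real part of the exponent.\<close>

lemma horizontal_exponent_mono:
  assumes c: "c < 0" and a: "a > 0" and l: "l > 0" and y: "y > 0" and x: "x \<le> x1" "x1 \<le> 0"
    and n: "saddle_radius c a l \<le> norm (Complex x1 y)"
  shows "Re (of_real c * Complex x y powr of_real (- a)) + x * l
    \<le> Re (of_real c * Complex x1 y powr of_real (- a)) + x1 * l"
proof -
  define f :: "complex \<Rightarrow> complex" where "f = (\<lambda>u. of_real c * u powr of_real (- a) + u * of_real l)"
  define f' :: "complex \<Rightarrow> complex" where "f' = (\<lambda>u. of_real c * (of_real (- a) * u powr (of_real (- a) - 1))
    + of_real l)"
  note seg = closed_segment_horizontal[of _ x y x1]
  have der: "(f has_field_derivative f' u) (at u)" if "u \<in> closed_segment (Complex x y) (Complex x1 y)" for u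
  proof -
    have "u \<notin> \<real>\<^sub>\<le>\<^sub>0" using seg(1)[OF that] y by (auto simp: complex_nonpos_Reals_iff)
    thus ?thesis unfolding f_def f'_def by (auto intro!: derivative_eq_intros)
  qed
  from complex_mvt_line[OF der] obtain u where u: "u \<in> closed_segment (Complex x y) (Complex x1 y)"
    and eq: "Re (f (Complex x1 y)) - Re (f (Complex x y)) = Re (f' u * (Complex x1 y - Complex x y))" by blast
  note u' = seg[OF u]
  have nu: "saddle_radius c a l \<le> norm u"
  proof -
    have "x1\<^sup>2 \<le> (Re u)\<^sup>2" using u' x by (intro abs_le_square_iff[THEN iffD1]) auto
    hence "norm (Complex x1 y) \<le> norm u" using u' by (simp add: cmod_def)
    thus ?thesis using n by simp
  qed
  have d: "Complex x1 y - Complex x y = of_real (x1 - x)" by (simp add: complex_eq_iff)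
  define w where "w = of_real c * (of_real (- a) * u powr (of_real (- a) - 1))"
  have "norm (u powr (of_real (- a) - 1)) = norm (u powr of_real (- a - 1))" by simp
  also have "\<dots> = norm u powr (- a - 1)"
    by (subst norm_powr_real_powr') (simp_all only: Reals_of_real Re_complex_of_real)
  finally have nu1: "norm (u powr (of_real (- a) - 1)) = norm u powr (- a - 1)" .
  have "norm w = a * (- c) * norm u powr (- a - 1)"
    unfolding w_def norm_mult nu1 using c a by simp
  also have "\<dots> \<le> a * (- c) * saddle_radius c a l powr (- a - 1)"
    using nu saddle_radius_pos[OF c a l] c a by (intro mult_left_mono powr_mono2') (auto simp: mult_nonneg_nonpos)
  also have "\<dots> = l" by (rule saddle_radius_powr(2)[OF c a l])
  finally have "norm w \<le> l" .
  moreover have "- Re w \<le> norm w" using abs_Re_le_cmod[of w] by linarith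
  ultimately have "Re w + l \<ge> 0" by linarith
  moreover have "f' u = w + of_real l" by (simp add: f'_def w_def)
  ultimately have "Re (f' u * (Complex x1 y - Complex x y)) \<ge> 0"
    unfolding d using x by simp
  thus ?thesis using eq by (simp add: f_def)
qed

text \<open>For \<open>a \<le> 1\<close> the saddle lies in the closed left half plane. From any later point of the spiral go
left, outside the circle through the saddle, to \<open>Re s = -1/2\<close>. There \<open>exp (-l/2)\<close> is negligible, as
\<open>N = o(l)\<close>, so the contour can rise to height \<open>1/2\<close> and thereby avoid the poles at the negative integers.\<close>

lemma tail_estimate_flat:
  assumes c: "c < 0" and a: "0 < a" "a \<le> 1"
  defines "\<eta>1 \<equiv> a * saddle_angle a / 2"
  shows "0 < \<eta>1" "\<eta>1 < pi - saddle_angle a" "a * \<eta>1 \<le> pi"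
    and "tail_negligible c a \<eta>1"
proof -
  note a0 = a(1)
  define \<psi> where "\<psi> = saddle_angle a"
  note sa = saddle_angle_bounds[OF a0, folded \<psi>_def]
  define \<tau> where "\<tau> = tan (\<psi> / 2)"
  have \<tau>: "\<tau> > 0" using sa by (simp add: \<tau>_def)
  have ap: "a * \<psi> > 0" using sa a by simp
  show e0: "0 < \<eta>1" using ap by (simp add: \<eta>1_def \<psi>_def)
  show e1: "\<eta>1 < pi - saddle_angle a" using ap sa(3) unfolding \<eta>1_def \<psi>_def by linarith
  show e2: "a * \<eta>1 \<le> pi"
  proof -
    have "a * \<eta>1 \<le> 1 * \<eta>1" using a e0 by (intro mult_right_mono) auto
    thus ?thesis using e1 sa unfolding \<psi>_def by linarith
  qed
  have psi_ge: "\<psi> \<ge> pi/2"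
  proof -
    have "a * \<psi> \<le> 1 * \<psi>" using a sa by (intro mult_right_mono) auto
    thus ?thesis using sa(3) by linarith
  qed
  have cos_le: "cos (\<psi> + \<eta>1) \<le> 0"
  proof -
    have "sin (\<psi> + \<eta>1 - pi/2) \<ge> 0" using psi_ge e0 e1 unfolding \<psi>_def by (intro sin_ge_zero) linarith+
    thus ?thesis by (simp add: sin_diff)
  qed
  define X1 where "X1 = exp (\<tau> * \<eta>1) * cos (\<psi> + \<eta>1)"
  define Y1 where "Y1 = exp (\<tau> * \<eta>1) * sin (\<psi> + \<eta>1)"
  have X1: "X1 \<le> 0" unfolding X1_def using cos_le by (simp add: mult_nonneg_nonpos)
  have Y1: "Y1 > 0" unfolding Y1_def using sa e0 e1 \<psi>_def by (intro mult_pos_pos sin_gt_zero) auto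
  define \<kappa> where "\<kappa> = - Re (phase_drop a \<eta>1)"
  have \<kappa>: "\<kappa> > 0"
    using Re_phase_drop_neg[OF a0, of \<eta>1] e0 e1 e2 sa unfolding \<kappa>_def \<psi>_def by auto
  define K where "K = 4 * pi * damp_bound c (- a)"
  have K: "K > 0" by (simp add: K_def damp_bound_pos)
  define E1 where "E1 = exp (\<tau> * \<eta>1)"
  have E1: "E1 \<ge> 1" using \<tau> e0 by (simp add: E1_def)
  \<comment> \<open>Once \<open>\<sigma> h \<le> 1/2\<close>, the term \<open>exp (-l/2)\<close> is below \<open>exp (N (saddle_height a - \<kappa>))\<close>, because \<open>N = \<sigma> l\<close>.\<close>
  define h where "h = \<bar>saddle_height a - \<kappa>\<bar> + 1"
  have h: "h > 0" by (simp add: h_def add_nonneg_pos)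
  define C where "C = exp (pi/2) * pi / 4 + 2 * K + 1"
  have C: "C \<ge> 0" using K by (simp add: C_def add_nonneg_nonneg)
  have "\<forall>\<^sub>F l in at_top. l \<ge> 1 \<and> large_param c a l \<ge> 1 \<and> saddle_radius c a l \<le> min (1 / (2 * E1)) (1 / (2 * h))"
    by (rule eventually_saddle_small[OF c a0]) (use E1 h in auto)
  hence "\<forall>\<^sub>F l in at_top. upper_integral_near c a l (spiral c a l \<eta>1) 0 (C * l * exp (large_param c a l
    * (saddle_height a - \<kappa>)))"
  proof (eventually_elim, unfold upper_integral_near_def diff_zero, intro ballI impI allI)
    fix l L \<Phi> assume l0: "l \<ge> 1 \<and> large_param c a l \<ge> 1 \<and> saddle_radius c a l \<le> min (1 / (2 * E1)) (1 / (2 * h))"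
      and L: "L \<in> log_strip" "Re L = l" and prim: "primitive_of (lindelof c (- a) L) \<Phi>"
    define \<sigma> where "\<sigma> = saddle_radius c a l"
    define N where "N = large_param c a l"
    have l: "l \<ge> 1" and N1: "N \<ge> 1" and sE: "\<sigma> * E1 \<le> 1/2" and sh: "\<sigma> * h \<le> 1/2"
      using l0 E1 h by (auto simp: N_def \<sigma>_def field_simps)
    have lp: "l > 0" using l by simp
    have \<sigma>: "\<sigma> > 0" unfolding \<sigma>_def by (rule saddle_radius_pos[OF c a0 lp])
    have N: "N = \<sigma> * l" by (simp add: N_def \<sigma>_def large_param_def)
    have inv: "1 / \<sigma> \<le> l" using N1 \<sigma> unfolding N by (simp add: field_simps)
    define Q where "Q = exp (N * (saddle_height a - \<kappa>))"
    have Q: "Q > 0" by (simp add: Q_def)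
    have expl: "exp (- l / 2) \<le> Q"
    proof -
      have "- (N * (saddle_height a - \<kappa>)) \<le> N * h" using N1 unfolding h_def by (simp flip: mult_minus_right)
      also have "\<dots> = (\<sigma> * h) * l" by (simp add: N)
      also have "\<dots> \<le> 1/2 * l" using sh l by (intro mult_right_mono) auto
      finally show ?thesis unfolding Q_def by simp
    qed
    have sp: "spiral c a l \<eta>1 = Complex (\<sigma> * X1) (\<sigma> * Y1)"
      using lp by (subst spiral_polar[OF c a0]) (auto simp: complex_eq_iff X1_def Y1_def \<sigma>_def \<tau>_def \<psi>_def)
    have nsp: "norm (Complex (\<sigma> * X1) (\<sigma> * Y1)) = \<sigma> * E1"
      unfolding sp[symmetric] using lp \<sigma>
        by (subst spiral_polar[OF c a0]) (auto simp: rcis_def norm_mult E1_def \<sigma>_def \<tau>_def \<psi>_def)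
    have x: "\<bar>\<sigma> * X1\<bar> \<le> 1/2" using abs_Re_le_cmod[of "Complex (\<sigma> * X1) (\<sigma> * Y1)"] sE unfolding nsp by simp
    have x0: "\<sigma> * X1 \<le> 0" using \<sigma> X1 by (simp add: mult_nonneg_nonpos)
    have y: "\<sigma> * Y1 \<le> 1/2" using abs_Im_le_cmod[of "Complex (\<sigma> * X1) (\<sigma> * Y1)"] sE unfolding nsp by simp
    have y0: "\<sigma> * Y1 > 0" using \<sigma> Y1 by simp
    have rn: "\<sigma> \<le> norm (Complex (\<sigma> * X1) (\<sigma> * Y1))" unfolding nsp using \<sigma> E1 by simp
    have top: "Re (of_real c * Complex (\<sigma> * X1) (\<sigma> * Y1) powr of_real (- a)) + (\<sigma> * X1) * l
      = N * (saddle_height a - \<kappa>)"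
    proof -
      have "Re (of_real c * spiral c a l \<eta>1 powr of_real (- a) + spiral c a l \<eta>1 * of_real l)
        = N * (saddle_height a - \<kappa>)"
        by (subst spiral_exponent[OF c a0 lp]) (use e0 e1 sa in \<open>auto simp: N_def saddle_height_def \<kappa>_def
          \<psi>_def algebra_simps\<close>)
      thus ?thesis unfolding sp by simp
    qed
    have "norm (\<Phi> (Complex (-1/2) (\<sigma> * Y1)) - \<Phi> (Complex (\<sigma> * X1) (\<sigma> * Y1))) \<le> 
       Q * (exp (pi/2) * pi / (2 * \<sigma>)) * norm (Complex (-1/2) (\<sigma> * Y1) - Complex (\<sigma> * X1) (\<sigma> * Y1))"
    proof (rule primitive_segment_bound[OF prim])
      show "closed_segment (Complex (\<sigma> * X1) (\<sigma> * Y1)) (Complex (-1/2) (\<sigma> * Y1)) \<subseteq> gapped_plane"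
        using closed_segment_horizontal(1) y0 by (fastforce simp: gapped_plane_def)
      fix s assume s: "s \<in> closed_segment (Complex (\<sigma> * X1) (\<sigma> * Y1)) (Complex (-1/2) (\<sigma> * Y1))"
      note s' = closed_segment_horizontal[OF s]
      have re: "-1/2 \<le> Re s" "Re s \<le> \<sigma> * X1" using s' x by auto
      have seq: "s = Complex (Re s) (\<sigma> * Y1)" using s' by (simp add: complex_eq_iff)
      have "(\<sigma> * X1)\<^sup>2 \<le> (Re s)\<^sup>2" using re x0 by (intro abs_le_square_iff[THEN iffD1]) auto
      hence "norm (Complex (\<sigma> * X1) (\<sigma> * Y1)) \<le> norm s" using s' by (simp add: cmod_def)
      hence ns: "\<sigma> \<le> norm s" using rn by simp
      have "Re (of_real c * Complex (Re s) (\<sigma> * Y1) powr of_real (- a)) + Re s * l \<le> N * (saddle_height a - \<kappa>)"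
        unfolding top[symmetric] by (rule horizontal_exponent_mono[OF c a0 lp y0 re(2) x0]) (use rn in \<open>simp
          only: \<sigma>_def\<close>)
      hence "Re (of_real c * s powr of_real (- a)) + Re s * Re L \<le> N * (saddle_height a - \<kappa>)"
        using seq L by simp
      thus "norm (lindelof c (- a) L s) \<le> Q * (exp (pi/2) * pi / (2 * \<sigma>))"
        unfolding Q_def using L ns \<sigma> s'(1) re x0 y y0 by (intro norm_lindelof_near_0_le) (auto simp: log_strip_def)
    qed
    also have "\<dots> \<le> Q * (exp (pi/2) * pi / (2 * \<sigma>)) * (1/2)"
    proof -
      have "\<bar>-1/2 - \<sigma> * X1\<bar> \<le> 1/2" using x x0 by linarith
      thus ?thesis unfolding norm_Complex_diff using \<sigma> Q by (intro mult_left_mono) auto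
    qed
    also have "\<dots> = exp (pi/2) * pi / 4 * Q * (1 / \<sigma>)" by simp
    also have "\<dots> \<le> exp (pi/2) * pi / 4 * Q * l" using Q by (intro mult_left_mono inv) auto
    finally have 1: "norm (\<Phi> (Complex (-1/2) (\<sigma> * Y1)) - \<Phi> (spiral c a l \<eta>1)) \<le> exp (pi/2) * pi / 4 * Q * l"
      unfolding sp .
    have "norm (\<Phi> (Complex (-1/2) (1/2)) - \<Phi> (Complex (-1/2) (\<sigma> * Y1))) \<le> 
       K * exp (- l / 2) * norm (Complex (-1/2) (1/2) - Complex (-1/2) (\<sigma> * Y1))"
    proof (rule primitive_segment_bound[OF prim])
      show "closed_segment (Complex (-1/2) (\<sigma> * Y1)) (Complex (-1/2) (1/2)) \<subseteq> gapped_plane"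
        using closed_segment_vertical(2) y0 by (fastforce simp: gapped_plane_def)
      fix s assume s: "s \<in> closed_segment (Complex (-1/2) (\<sigma> * Y1)) (Complex (-1/2) (1/2))"
      note s' = closed_segment_vertical[OF s]
      have "norm (lindelof c (- a) L s) \<le> 4 * pi * damp_bound c (- a) * exp (Re s * Re L) * exp (- (pi
        - \<bar>Im L\<bar>) * \<bar>Im s\<bar>)"
        by (rule norm_lindelof_le) (use a0 s'(1) abs_Re_le_cmod[of s] in auto)
      also have "\<dots> \<le> K * exp (- l / 2) * 1"
      proof -
        have "- (pi - \<bar>Im L\<bar>) * \<bar>Im s\<bar> \<le> 0" using L by (intro mult_nonpos_nonneg) (auto simp: log_strip_def)
        hence "exp (- (pi - \<bar>Im L\<bar>) * \<bar>Im s\<bar>) \<le> 1" by (simp only: exp_le_one_iff)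
        moreover have "Re s * Re L = - l / 2" using s'(1) L by simp
        ultimately show ?thesis unfolding K_def using damp_bound_pos[of c "- a"] by (intro mult_mono) auto
      qed
      finally show "norm (lindelof c (- a) L s) \<le> K * exp (- l / 2)" by simp
    qed
    also have "\<dots> \<le> K * exp (- l / 2) * 1" unfolding norm_Complex_diff using y y0 K by (intro mult_left_mono) auto
    also have "\<dots> \<le> K * Q * l" using K expl l Q by (intro mult_mono) auto
    finally have 2: "norm (\<Phi> (Complex (-1/2) (1/2)) - \<Phi> (Complex (-1/2) (\<sigma> * Y1))) \<le> K * Q * l" .
    have "\<forall>\<^sub>F T in at_top. norm (\<Phi> (Complex (1/2) T) - \<Phi> (Complex (-1/2) (1/2))) \<le> 
       4 * pi * damp_bound c (- a) * exp ((-1/2) * Re L) / Re L + Q"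
      by (rule tail_to_infinity[OF _ L(1) _ prim]) (use a0 L l Q in auto)
    thus "\<forall>\<^sub>F T in at_top. norm (\<Phi> (Complex (1/2) T) - \<Phi> (spiral c a l \<eta>1))
      \<le> C * l * exp (large_param c a l * (saddle_height a - \<kappa>))"
    proof eventually_elim
      case (elim T)
      have "4 * pi * damp_bound c (- a) * exp ((-1/2) * Re L) / Re L = K * exp (- l / 2) / l"
        using L by (simp add: K_def)
      also have "\<dots> \<le> K * exp (- l / 2) / 1" using l K by (intro divide_left_mono) auto
      also have "\<dots> \<le> K * Q * l" using mult_mono[of "K * exp (- l / 2)" "K * Q" 1 l] K expl l Q by simp
      finally have 3: "4 * pi * damp_bound c (- a) * exp ((-1/2) * Re L) / Re L \<le> K * Q * l" .
      have 4: "Q \<le> 1 * Q * l" using l Q by simp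
      have "\<Phi> (Complex (1/2) T) - \<Phi> (spiral c a l \<eta>1) = 
         (\<Phi> (Complex (1/2) T) - \<Phi> (Complex (-1/2) (1/2))) + (\<Phi> (Complex (-1/2) (1/2)) - \<Phi> (Complex (-1/2) (\<sigma>
           * Y1)))
         + (\<Phi> (Complex (-1/2) (\<sigma> * Y1)) - \<Phi> (spiral c a l \<eta>1))" by simp
      also have "norm \<dots> \<le> norm (\<Phi> (Complex (1/2) T) - \<Phi> (Complex (-1/2) (1/2)))
        + norm (\<Phi> (Complex (-1/2) (1/2)) - \<Phi> (Complex (-1/2) (\<sigma> * Y1)))
         + norm (\<Phi> (Complex (-1/2) (\<sigma> * Y1)) - \<Phi> (spiral c a l \<eta>1))"
        by (rule order.trans[OF norm_triangle_ineq add_right_mono[OF norm_triangle_ineq]])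
      also have "\<dots> \<le> (K * Q * l + 1 * Q * l) + K * Q * l + exp (pi/2) * pi / 4 * Q * l"
        using elim 1 2 3 4 by linarith
      also have "\<dots> = C * l * Q" by (simp add: C_def algebra_simps)
      finally show ?case unfolding Q_def N_def .
    qed
  qed
  thus "tail_negligible c a \<eta>1"
    unfolding tail_negligible_def using \<kappa> C by blast
qed

section \<open>Both half planes\<close>

text \<open>The size of the saddle point contribution times its relative error \<open>1 / sqrt N + \<sigma>\<close>.\<close>

definition error_scale :: "real \<Rightarrow> real \<Rightarrow> real \<Rightarrow> real" where
  "error_scale c a l = exp (large_param c a l * saddle_height a) *
     (1 / sqrt (large_param c a l) + saddle_radius c a l) / sqrt (large_param c a l)"

lemma upper_half_estimate:
  assumes c: "c < 0" and a: "a > 0"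
  shows "\<exists>C\<ge>0. \<forall>\<^sub>F l in at_top.
    upper_integral_near c a l (spiral c a l (- saddle_angle a)) (saddle_contrib c a l) (C * error_scale c a l)"
proof -
  have "\<exists>\<eta>1. 0 < \<eta>1 \<and> \<eta>1 < pi - saddle_angle a \<and> a * \<eta>1 \<le> pi \<and> tail_negligible c a \<eta>1"
  proof (cases "a > 1")
    case True thus ?thesis using tail_estimate_steep[OF c True] by blast
  next
    case False
    hence "a \<le> 1" by simp
    thus ?thesis using tail_estimate_flat[OF c a] by blast
  qed
  then obtain \<eta>1 \<kappa> C1 where e: "0 < \<eta>1" "\<eta>1 < pi - saddle_angle a" "a * \<eta>1 \<le> pi" and \<kappa>: "\<kappa> > 0" and C1: "C1 \<ge> 0"
    and tail: "\<forall>\<^sub>F l in at_top. upper_integral_near c a l (spiral c a l \<eta>1) 0 (C1 * l * exp (large_param c a l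
      * (saddle_height a - \<kappa>)))"
    unfolding tail_negligible_def by blast
  obtain C2 where C2: "C2 \<ge> 0" "\<And>L \<Phi>. \<lbrakk>Re L > 0; \<bar>Im L\<bar> \<le> pi; large_param c a (Re L) \<ge> 1;
       saddle_radius c a (Re L) * exp (tan (saddle_angle a / 2) * \<eta>1)
         \<le> 1 / 2; primitive_of (lindelof c (- a) L) \<Phi>\<rbrakk> \<Longrightarrow>
       norm (\<Phi> (spiral c a (Re L) \<eta>1) - \<Phi> (spiral c a (Re L) (- saddle_angle a)) - saddle_contrib c a (Re L))
       \<le> C2 * exp (large_param c a (Re L) * saddle_height a) *
           (1 / sqrt (large_param c a (Re L)) + saddle_radius c a (Re L)) / sqrt (large_param c a (Re L))"
    by (rule spiral_integral_estimate[OF c a e]) blast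
  define E1 where "E1 = exp (tan (saddle_angle a / 2) * \<eta>1)"
  have E1: "E1 > 0" by (simp add: E1_def)
  have sm: "\<forall>\<^sub>F l in at_top. l \<ge> 1 \<and> large_param c a l \<ge> 1 \<and> saddle_radius c a l \<le> 1 / (2 * E1)"
    by (rule eventually_saddle_small[OF c a]) (use E1 in auto)
  \<comment> \<open>\<open>N\<close> is a positive power of \<open>l\<close>, so the exponential gain outweighs the factors \<open>l\<close> and \<open>N\<close>.\<close>
  have "\<forall>\<^sub>F l in at_top. l * large_param c a l * exp (- \<kappa> * large_param c a l) \<le> 1"
  proof -
    define b where "b = (a * (- c)) powr (1 / (1 + a))"
    have b: "b > 0" using c a by (simp add: b_def mult_pos_neg)
    define p where "p = a / (1 + a)"
    have p: "p > 0" using a by (simp add: p_def)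
    have "((\<lambda>l. l * (b * l powr p) * exp (- \<kappa> * (b * l powr p))) \<longlongrightarrow> 0) at_top"
      using b p \<kappa> by real_asymp
    hence "\<forall>\<^sub>F l in at_top. l * (b * l powr p) * exp (- \<kappa> * (b * l powr p)) < 1"
      by (rule order_tendstoD) simp
    thus ?thesis using eventually_gt_at_top[of 0]
      by eventually_elim (simp only: large_param_eq[OF c a] b_def p_def less_imp_le)
  qed
  with sm tail have "\<forall>\<^sub>F l in at_top. upper_integral_near c a l (spiral c a l (- saddle_angle a))
    (saddle_contrib c a l) ((C1 + C2) * error_scale c a l)"
  proof (eventually_elim, unfold upper_integral_near_def[of _ _ _ _ "saddle_contrib _ _ _"],
      intro ballI impI allI)
    fix l L \<Phi>
    assume l0: "1 \<le> l \<and> 1 \<le> large_param c a l \<and> saddle_radius c a l \<le> 1 / (2 * E1)"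
      and tl: "upper_integral_near c a l (spiral c a l \<eta>1) 0 (C1 * l * exp (large_param c a l
        * (saddle_height a - \<kappa>)))"
      and small: "l * large_param c a l * exp (- \<kappa> * large_param c a l) \<le> 1"
      and L: "L \<in> log_strip" "Re L = l" and prim: "primitive_of (lindelof c (- a) L) \<Phi>"
    define N where "N = large_param c a l"
    define \<sigma> where "\<sigma> = saddle_radius c a l"
    have N1: "N \<ge> 1" using l0 by (simp add: N_def)
    have \<sigma>: "\<sigma> > 0" unfolding \<sigma>_def using l0 by (intro saddle_radius_pos c a) auto
    have sE: "saddle_radius c a (Re L) * exp (tan (saddle_angle a / 2) * \<eta>1) \<le> 1/2"
      using l0 E1 L unfolding E1_def[symmetric] by (simp add: field_simps)
    have "norm (\<Phi> (spiral c a (Re L) \<eta>1) - \<Phi> (spiral c a (Re L) (- saddle_angle a)) - saddle_contrib c a (Re L))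
       \<le> C2 * exp (large_param c a (Re L) * saddle_height a) *
           (1 / sqrt (large_param c a (Re L)) + saddle_radius c a (Re L)) / sqrt (large_param c a (Re L))"
      by (rule C2(2)[OF _ _ _ sE prim]) (use l0 L in \<open>auto simp: log_strip_def\<close>)
    hence 1: "norm (\<Phi> (spiral c a l \<eta>1) - \<Phi> (spiral c a l (- saddle_angle a)) - saddle_contrib c a l)
      \<le> C2 * error_scale c a l"
      using L by (simp add: error_scale_def mult_ac)
    have "\<forall>\<^sub>F T in at_top. norm (\<Phi> (Complex (1/2) T) - \<Phi> (spiral c a l \<eta>1))
      \<le> C1 * l * exp (N * (saddle_height a - \<kappa>))"
      using tl L prim unfolding N_def upper_integral_near_def diff_zero by blast
    thus "\<forall>\<^sub>F T in at_top. norm (\<Phi> (Complex (1/2) T) - \<Phi> (spiral c a l (- saddle_angle a))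
      - saddle_contrib c a l) \<le> (C1 + C2) * error_scale c a l"
    proof eventually_elim
      case (elim T)
      have "l * exp (N * (saddle_height a - \<kappa>)) = exp (N * saddle_height a) * (l * N * exp (- \<kappa> * N)) / N"
        using N1 by (simp add: field_simps exp_add[symmetric] exp_diff)
      also have "\<dots> \<le> exp (N * saddle_height a) * 1 / N"
        using small N1 unfolding N_def[symmetric] by (intro divide_right_mono mult_left_mono) auto
      also have "\<dots> = exp (N * saddle_height a) * (1 / sqrt N) / sqrt N" using N1 by simp
      also have "\<dots> \<le> exp (N * saddle_height a) * (1 / sqrt N + \<sigma>) / sqrt N"
        using N1 \<sigma> by (intro divide_right_mono mult_left_mono) auto
      also have "\<dots> = error_scale c a l" by (simp add: error_scale_def N_def \<sigma>_def)
      finally have "C1 * (l * exp (N * (saddle_height a - \<kappa>))) \<le> C1 * error_scale c a l"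
        using C1 by (intro mult_left_mono) auto
      hence 2: "norm (\<Phi> (Complex (1/2) T) - \<Phi> (spiral c a l \<eta>1)) \<le> C1 * error_scale c a l"
        using elim by (simp add: mult_ac)
      have "\<Phi> (Complex (1/2) T) - \<Phi> (spiral c a l (- saddle_angle a)) - saddle_contrib c a l = 
        (\<Phi> (Complex (1/2) T) - \<Phi> (spiral c a l \<eta>1)) + (\<Phi> (spiral c a l \<eta>1)
          - \<Phi> (spiral c a l (- saddle_angle a)) - saddle_contrib c a l)"
        by simp
      also have "norm \<dots> \<le> C1 * error_scale c a l + C2 * error_scale c a l"
        by (rule order.trans[OF norm_triangle_ineq add_mono[OF 2 1]])
      finally show ?case by (simp add: distrib_right)
    qed
  qed
  thus ?thesis using C1 C2(1) by (intro exI[of _ "C1 + C2"]) simp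
qed

lemma lindelof_cnj:
  assumes "s \<in> gapped_plane"
  shows "cnj (lindelof c \<theta> (cnj L) (cnj s)) = lindelof c \<theta> L s"
proof -
  have "cnj (cnj s powr of_real \<theta>) = s powr of_real \<theta>"
    by (subst cnj_powr) (use assms in \<open>auto simp: gapped_plane_def\<close>)
  thus ?thesis unfolding lindelof_def damp_def by (simp add: exp_cnj cnj_sin)
qed

text \<open>The reflection \<open>s \<mapsto> cnj s\<close> maps the lower half of the line to the upper half and \<open>L\<close> to \<open>cnj L\<close>, so
estimates in the upper half plane that are uniform in \<open>L\<close> suffice. The splitting point \<open>x0\<close> will be where
the spiral meets the real axis.\<close>

lemma vertical_integral_by_halves:
  assumes p1: "primitive_of (lindelof c \<theta> L) \<Phi>" and p2: "primitive_of (lindelof c \<theta> (cnj L)) \<Phi>'"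
    and x0: "0 < x0" "x0 < 1" and T: "T > 0"
  shows "\<i> * integral {-T..T} (lindelof_on_line c \<theta> L (1/2)) =
     (\<Phi> (Complex (1/2) T) - \<Phi> (of_real x0)) - cnj (\<Phi>' (Complex (1/2) T) - \<Phi>' (of_real x0))"
proof -
  define S where "S = {s. Re s > 0} \<inter> {s. Re s < 1}"
  have cS: "convex S" unfolding S_def by (intro convex_Int convex_halfspace_Re_gt convex_halfspace_Re_lt)
  have SG: "s \<in> gapped_plane" if "s \<in> S" for s using that by (auto simp: S_def gapped_plane_def)
  \<comment> \<open>Another primitive of the integrand for \<open>L\<close>, hence equal to \<open>\<Phi>\<close> up to a constant.\<close>
  define \<Psi> where "\<Psi> = cnj \<circ> \<Phi>' \<circ> cnj"
  have dPsi: "(\<Psi> has_field_derivative lindelof c \<theta> L s) (at s)" if "s \<in> S" for s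
  proof -
    have "cnj s \<in> gapped_plane" using that by (auto simp: S_def gapped_plane_def)
    hence "(\<Phi>' has_field_derivative lindelof c \<theta> (cnj L) (cnj s)) (at (cnj s))"
      using p2 by (simp add: primitive_of_def)
    from has_field_derivative_cnj_cnj[OF this] show ?thesis unfolding \<Psi>_def lindelof_cnj[OF SG[OF that]] .
  qed
  have dPhi: "(\<Phi> has_field_derivative lindelof c \<theta> L s) (at s)" if "s \<in> S" for s
    using p1 SG[OF that] by (simp add: primitive_of_def)
  have "\<exists>k. \<forall>s\<in>S. \<Phi> s - \<Psi> s = k"
  proof (rule has_field_derivative_zero_constant[OF cS])
    fix s assume s: "s \<in> S"
    have "((\<lambda>s. \<Phi> s - \<Psi> s) has_field_derivative (lindelof c \<theta> L s - lindelof c \<theta> L s)) (at s)"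
      by (intro DERIV_diff dPhi dPsi s)
    thus "((\<lambda>s. \<Phi> s - \<Psi> s) has_field_derivative 0) (at s within S)" by (simp add: has_field_derivative_at_within)
  qed
  then obtain k where k: "\<And>s. s \<in> S \<Longrightarrow> \<Phi> s = \<Psi> s + k" by (auto simp: algebra_simps)
  have "((\<lambda>t. lindelof c \<theta> L (Complex (1/2) t) * \<i>)
    has_integral (\<Phi> (Complex (1/2) T) - \<Phi> (Complex (1/2) (-T)))) {-T..T}"
  proof (rule fundamental_theorem_of_calculus)
    fix t
    have 1: "((\<lambda>t. Complex (1/2) t) has_vector_derivative \<i>) (at t within {-T..T})"
      unfolding Complex_eq by (auto intro!: derivative_eq_intros)
    have "(\<Phi> has_field_derivative lindelof c \<theta> L (Complex (1/2) t)) (at (Complex (1/2) t))"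
      by (rule dPhi) (simp add: S_def)
    from field_vector_diff_chain_within[OF 1 has_field_derivative_at_within[OF this]]
    show "((\<lambda>t. \<Phi> (Complex (1/2) t)) has_vector_derivative lindelof c \<theta> L (Complex (1/2) t)
      * \<i>) (at t within {-T..T})"
      by (simp add: o_def mult.commute)
  qed (use T in simp)
  hence "integral {-T..T} (\<lambda>t. lindelof c \<theta> L (Complex (1/2) t) * \<i>)
    = \<Phi> (Complex (1/2) T) - \<Phi> (Complex (1/2) (-T))"
    by (rule integral_unique)
  hence "\<i> * integral {-T..T} (lindelof_on_line c \<theta> L (1/2)) = \<Phi> (Complex (1/2) T) - \<Phi> (Complex (1/2) (-T))"
    by (simp add: lindelof_on_line_def[abs_def] mult.commute)
  also have "\<Phi> (Complex (1/2) (-T)) = \<Psi> (Complex (1/2) (-T)) + k" by (rule k) (simp add: S_def)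
  also have "\<Psi> (Complex (1/2) (-T)) = cnj (\<Phi>' (Complex (1/2) T))" by (simp add: \<Psi>_def complex_cnj)
  also have "k = \<Phi> (of_real x0) - cnj (\<Phi>' (of_real x0))" using k[of "of_real x0"] x0 by (simp add: S_def \<Psi>_def)
  finally show ?thesis by simp
qed

text \<open>The saddle points in the upper and in the lower half plane contribute \<open>X\<close> and \<open>- cnj X\<close>, which
together are purely imaginary.\<close>

lemma E_saddle_point:
  assumes c: "c < 0" and a: "a > 0"
  shows "\<exists>C\<ge>0. \<forall>\<^sub>F l in at_top. \<forall>z. z \<notin> \<real>\<^sub>\<le>\<^sub>0 \<longrightarrow> Re (Ln z) = l \<longrightarrow>
      norm (E z c (- a) - of_real (- Im (saddle_contrib c a l) / pi)) \<le> C * error_scale c a l"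
proof -
  obtain C where C: "C \<ge> 0" and ev: "\<forall>\<^sub>F l in at_top.
    upper_integral_near c a l (spiral c a l (- saddle_angle a)) (saddle_contrib c a l) (C * error_scale c a l)"
    using upper_half_estimate[OF c a] by blast
  have sm: "\<forall>\<^sub>F l in at_top. l \<ge> 1 \<and> large_param c a l \<ge> 1 \<and> saddle_radius c a l \<le> 1 / 2"
    by (rule eventually_saddle_small[OF c a]) auto
  from ev sm have "\<forall>\<^sub>F l in at_top. \<forall>z. z \<notin> \<real>\<^sub>\<le>\<^sub>0 \<longrightarrow> Re (Ln z) = l \<longrightarrow>
      norm (E z c (- a) - of_real (- Im (saddle_contrib c a l) / pi)) \<le> C * error_scale c a l"
  proof (eventually_elim, intro allI impI)
    fix l z
    assume est: "upper_integral_near c a l (spiral c a l (- saddle_angle a)) (saddle_contrib c a l) (C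
      * error_scale c a l)"
      and l0: "1 \<le> l \<and> 1 \<le> large_param c a l \<and> saddle_radius c a l \<le> 1 / 2"
      and z: "z \<notin> \<real>\<^sub>\<le>\<^sub>0" and l: "Re (Ln z) = l"
    define L where "L = Ln z"
    define X where "X = saddle_contrib c a l"
    define r where "r = C * error_scale c a l"
    \<comment> \<open>The spiral meets the positive real axis at \<open>x0\<close>.\<close>
    define x0 where "x0 = saddle_radius c a l * exp (tan (saddle_angle a / 2) * (- saddle_angle a))"
    note sa = saddle_angle_bounds[OF a]
    have lp: "l > 0" using l0 by simp
    have sr: "saddle_radius c a l > 0" by (rule saddle_radius_pos[OF c a lp])
    have sp: "spiral c a l (- saddle_angle a) = of_real x0"
      unfolding spiral_polar[OF c a lp] x0_def by (simp add: rcis_def)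
    have x0: "0 < x0" "x0 < 1"
    proof -
      show "0 < x0" using sr by (simp add: x0_def)
      have "exp (tan (saddle_angle a / 2) * (- saddle_angle a)) \<le> 1" using sa by simp
      hence "x0 \<le> saddle_radius c a l * 1" unfolding x0_def using sr by (intro mult_left_mono) auto
      thus "x0 < 1" using l0 by linarith
    qed
    have L: "L \<in> log_strip" "Re L = l" "cnj L \<in> log_strip" "Re (cnj L) = l"
      using Ln_in_log_strip[OF z] l by (auto simp: L_def log_strip_def)
    obtain \<Phi> where \<Phi>: "primitive_of (lindelof c (- a) L) \<Phi>"
      unfolding primitive_of_def by (metis lindelof_primitive)
    obtain \<Phi>' where \<Phi>': "primitive_of (lindelof c (- a) (cnj L)) \<Phi>'"
      unfolding primitive_of_def by (metis lindelof_primitive)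
    have e1: "\<forall>\<^sub>F T in at_top. norm (\<Phi> (Complex (1/2) T) - \<Phi> (of_real x0) - X) \<le> r"
      using est L \<Phi> unfolding upper_integral_near_def sp X_def r_def by blast
    have e2: "\<forall>\<^sub>F T in at_top. norm (\<Phi>' (Complex (1/2) T) - \<Phi>' (of_real x0) - X) \<le> r"
      using est L \<Phi>' unfolding upper_integral_near_def sp X_def r_def by blast
    define J where "J = lindelof_line_integral c (- a) 0 L"
    have "((\<lambda>T. integral {-T..T} (lindelof_on_line c (- a) L (1/2))) \<longlongrightarrow> J) at_top"
      using lindelof_on_line_tendsto[of "- a" L c 0] a L by (simp add: J_def)
    hence lim: "((\<lambda>T. norm (\<i> * integral {-T..T} (lindelof_on_line c (- a) L (1/2)) - (X - cnj X))) \<longlongrightarrow> norm (\<i>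
      * J - (X - cnj X))) at_top"
      by (intro tendsto_intros)
    have "norm (\<i> * J - (X - cnj X)) \<le> 2 * r"
    proof (rule tendsto_upperbound[OF lim])
      show "\<forall>\<^sub>F T in at_top. norm (\<i> * integral {-T..T} (lindelof_on_line c (- a) L (1/2)) - (X - cnj X)) \<le> 2 * r"
        using e1 e2 eventually_gt_at_top[of 0]
      proof eventually_elim
        case (elim T)
        have "\<i> * integral {-T..T} (lindelof_on_line c (- a) L (1/2)) - (X - cnj X) = 
           (\<Phi> (Complex (1/2) T) - \<Phi> (of_real x0) - X) - cnj (\<Phi>' (Complex (1/2) T) - \<Phi>' (of_real x0) - X)"
          unfolding vertical_integral_by_halves[OF \<Phi> \<Phi>' x0 elim(3)] by simp
        also have "norm \<dots> \<le> norm (\<Phi> (Complex (1/2) T) - \<Phi> (of_real x0) - X) + norm (cnj (\<Phi>' (Complex (1/2) T)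
          - \<Phi>' (of_real x0) - X))"
          by (rule norm_triangle_ineq4)
        also have "\<dots> \<le> r + r" unfolding complex_mod_cnj by (intro add_mono elim)
        finally show ?case by simp
      qed
    qed simp
    moreover have "X - cnj X = \<i> * of_real (2 * Im X)" by (simp add: complex_eq_iff)
    ultimately have "norm (\<i> * (J - of_real (2 * Im X))) \<le> 2 * r" by (simp add: right_diff_distrib)
    hence nJ: "norm (J - of_real (2 * Im X)) \<le> 2 * r" by (simp only: norm_mult) simp
    have "E z c (- a) - of_real (- Im X / pi) = - (J - of_real (2 * Im X)) / of_real (2 * pi)"
      using E_eq_line_integral[of "- a" z c] a z by (simp add: J_def L_def field_simps)
    hence "norm (E z c (- a) - of_real (- Im X / pi)) = norm (J - of_real (2 * Im X)) / (2 * pi)"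
      by (simp add: norm_divide norm_minus_commute norm_mult)
    also have "\<dots> \<le> 2 * r / (2 * pi)" by (intro divide_right_mono nJ) auto
    also have "\<dots> \<le> r"
    proof -
      have "r \<ge> 0" using order.trans[OF norm_ge_zero nJ] by simp
      hence "r * 1 \<le> r * pi" using pi_gt3 by (intro mult_left_mono) auto
      thus ?thesis by (simp add: field_simps)
    qed
    finally show "norm (E z c (- a) - of_real (- Im (saddle_contrib c a l) / pi)) \<le> C * error_scale c a l"
      unfolding X_def r_def .
  qed
  thus ?thesis using C by blast
qed

section \<open>The asymptotic formula\<close>

lemma Im_saddle_contrib:
  assumes c: "c < 0" and a: "a > 0" and l: "l > 0"
  defines "N \<equiv> large_param c a l"
  shows "- Im (saddle_contrib c a l) / pi = - (exp (N * saddle_height a) * sqrt (2 / (pi * (N * (1 + a))))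
     * cos (N * ((1 + 1 / a) * sin (saddle_angle a)) - saddle_angle a / 2))"
proof -
  define \<beta> where "\<beta> = saddle_angle a / 2"
  define A where "A = N * ((1 + 1 / a) * sin (saddle_angle a))"
  define e where "e = exp (N * saddle_height a)"
  define R where "R = sqrt (2 * pi / (N * (1 + a)))"
  have N: "N > 0" unfolding N_def large_param_def using saddle_radius_pos[OF c a l] l by simp
  have cb: "cos \<beta> > 0" using saddle_angle_bounds[OF a] by (simp add: \<beta>_def)
  have "pi / (N * phase_curv a) = 2 * pi / (N * (1 + a)) * (cos \<beta>)\<^sup>2"
    unfolding phase_curv_def \<beta>_def[symmetric] using cb by simp
  hence "sqrt (pi / (N * phase_curv a)) = R * cos \<beta>"
    using cb by (simp only: real_sqrt_mult R_def real_sqrt_abs abs_of_pos)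
  hence 1: "spiral_dir a * of_real (sqrt (pi / (N * phase_curv a))) = \<i> * cis (- \<beta>) * of_real R"
    unfolding spiral_dir_polar[OF a] \<beta>_def[symmetric] using cb by (simp add: \<beta>_def)
  have 2: "exp (of_real N * (cis (saddle_angle a) * of_real (1 + 1 / a))) = of_real e * cis A"
    unfolding exp_eq_polar by (simp add: e_def A_def saddle_height_def mult_ac)
  have "saddle_contrib c a l = of_real e * cis A * (\<i> * cis (- \<beta>) * of_real R)"
    unfolding saddle_contrib_def N_def[symmetric] 1 2 ..
  also have "\<dots> = of_real (e * R) * (\<i> * (cis A * cis (- \<beta>)))" by (simp add: mult_ac)
  finally have "Im (saddle_contrib c a l) = e * R * cos (A - \<beta>)" unfolding cis_mult by simp
  hence "- Im (saddle_contrib c a l) / pi = - (e * (R / pi) * cos (A - \<beta>))" by simp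
  also have "R / pi = sqrt (2 / (pi * (N * (1 + a))))"
  proof -
    have "2 / (pi * (N * (1 + a))) = 2 * pi / (N * (1 + a)) / pi\<^sup>2" by (simp add: power2_eq_square)
    thus ?thesis unfolding R_def by (simp only: real_sqrt_divide real_sqrt_abs) simp
  qed
  finally show ?thesis unfolding e_def A_def \<beta>_def .
qed

definition main_term :: "real \<Rightarrow> real \<Rightarrow> complex \<Rightarrow> complex" where
  "main_term c \<theta> L = of_real (A1 c \<theta>)
      * exp (of_real (A2 c \<theta>) * L powr of_real (\<theta> / (\<theta> - 1)))
      * L powr of_real (\<theta> / (2 * (1 - \<theta>)))
      * cos (of_real (A3 c \<theta>) * L powr of_real (\<theta> / (\<theta> - 1)) + of_real (A4 \<theta>))"

definition error_term :: "real \<Rightarrow> real \<Rightarrow> real \<Rightarrow> complex \<Rightarrow> complex" where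
  "error_term c \<theta> \<epsilon> L = exp (of_real (A2 c \<theta>) * L powr of_real (\<theta> / (\<theta> - 1)))
      * L powr of_real (\<theta> / (2 * (1 - \<theta>)) - \<mu> \<theta> \<epsilon>)"

lemma large_param_constants:
  assumes c: "c < 0" and a: "a > 0" and l: "l > 0"
  defines "p \<equiv> a / (1 + a)"
  shows "large_param c a l * saddle_height a = A2 c (- a) * l powr p"
    and "large_param c a l * ((1 + 1 / a) * sin (saddle_angle a)) = A3 c (- a) * l powr p"
    and "sqrt (2 / (pi * (large_param c a l * (1 + a)))) = - A1 c (- a) * l powr (- p / 2)"
proof -
  define b where "b = c * (- a)"
  have b: "b > 0" using c a by (simp add: b_def mult_neg_pos)
  have N: "large_param c a l = b powr (1 / (1 + a)) * l powr p"
    unfolding large_param_eq[OF c a l] b_def p_def by (simp add: mult.commute)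
  have i: "1 - inverse (- a) = 1 + 1 / a" "1 - - a = 1 + a" by (simp_all add: inverse_eq_divide)
  show "large_param c a l * saddle_height a = A2 c (- a) * l powr p"
    unfolding A2_def i b_def[symmetric] N saddle_height_def saddle_angle_def by (simp add: mult_ac)
  show "large_param c a l * ((1 + 1 / a) * sin (saddle_angle a)) = A3 c (- a) * l powr p"
    unfolding A3_def i b_def[symmetric] N saddle_angle_def by (simp add: mult_ac)
  have e: "1 / (2 * (- a - 1)) = - (1 / (1 + a) / 2)" using a by (simp add: field_simps)
  have "2 / (pi * (large_param c a l * (1 + a))) = 2 / (pi * (1 + a)) * (1 / large_param c a l)" by simp
  hence "sqrt (2 / (pi * (large_param c a l * (1 + a))))
    = sqrt (2 / (pi * (1 + a))) * sqrt (1 / large_param c a l)"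
    by (simp only: real_sqrt_mult)
  also have "sqrt (1 / large_param c a l) = large_param c a l powr (- (1 / 2))"
    using b l unfolding N by (simp add: powr_half_sqrt powr_minus real_sqrt_divide field_simps)
  also have "\<dots> = b powr (- (1 / (1 + a) / 2)) * l powr (- p / 2)"
    unfolding N using b l by (simp add: powr_mult powr_powr)
  finally show "sqrt (2 / (pi * (large_param c a l * (1 + a)))) = - A1 c (- a) * l powr (- p / 2)"
    unfolding A1_def i e b_def[symmetric] by (simp add: mult_ac)
qed

lemma main_term_real:
  assumes c: "c < 0" and a: "a > 0" and l: "l > 0"
  shows "main_term c (- a) (of_real l) = of_real (- Im (saddle_contrib c a l) / pi)"
proof -
  have p: "- a / (- a - 1) = a / (1 + a)" using a by (simp add: field_simps)
  have q: "- a / (2 * (1 - - a)) = - (a / (1 + a)) / 2" using a by (simp add: field_simps)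
  have A4: "A4 (- a) = - (saddle_angle a / 2)" using a by (simp add: A4_def saddle_angle_def field_simps)
  have pw: "of_real l powr of_real r = complex_of_real (l powr r)" for r using l by (simp add: powr_of_real)
  have "main_term c (- a) (of_real l) = of_real (A1 c (- a) * exp (A2 c (- a) * l powr (a / (1 + a)))
    * l powr (- (a / (1 + a)) / 2)
       * cos (A3 c (- a) * l powr (a / (1 + a)) + A4 (- a)))"
    unfolding main_term_def p q pw by (simp only: of_real_mult exp_of_real cos_of_real of_real_add flip:
      of_real_mult of_real_add)
  also have "A1 c (- a) * exp (A2 c (- a) * l powr (a / (1 + a))) * l powr (- (a / (1 + a)) / 2)
       * cos (A3 c (- a) * l powr (a / (1 + a)) + A4 (- a)) = - Im (saddle_contrib c a l) / pi"
    unfolding Im_saddle_contrib[OF c a l] large_param_constants[OF c a l] A4 by simp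
  finally show ?thesis .
qed

text \<open>For \<open>q \<le> 1\<close> the derivative of \<open>L powr q\<close> on the half plane \<open>Re L \<ge> l\<close> is largest on its boundary.
With \<open>q = p < 1\<close> the difference tends to \<open>0\<close>; this is why the imaginary part of \<open>Ln z\<close> is invisible in the
exponential.\<close>

lemma powr_near_real:
  assumes "Re L > 0" "\<bar>Im L\<bar> \<le> pi" "q \<le> 1"
  shows "norm (L powr of_real q - of_real (Re L powr q)) \<le> \<bar>q\<bar> * pi * Re L powr (q - 1)"
proof -
  define l where "l = Re L"
  have l: "l > 0" using assms by (simp add: l_def)
  have "norm (L powr of_real q - of_real l powr of_real q) \<le> \<bar>q\<bar> * l powr (q - 1) * norm (L - of_real l)"
  proof (rule field_differentiable_bound[where S = "{z. Re z \<ge> l}"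
    and f' = "\<lambda>z. of_real q * z powr (of_real q - 1)"])
    show "convex {z. Re z \<ge> l}" by (rule convex_halfspace_Re_ge)
    fix z assume z: "z \<in> {z. Re z \<ge> l}"
    hence "z \<notin> \<real>\<^sub>\<le>\<^sub>0" using l by (auto simp: complex_nonpos_Reals_iff)
    thus "((\<lambda>z. z powr of_real q) has_field_derivative of_real q * z powr (of_real q
      - 1)) (at z within {z. Re z \<ge> l})"
      by (rule has_field_derivative_at_within[OF has_field_derivative_powr])
    have "l \<le> norm z" using z complex_Re_le_cmod[of z] by simp
    hence "norm z powr (q - 1) \<le> l powr (q - 1)" using l assms by (intro powr_mono2') auto
    hence "\<bar>q\<bar> * norm z powr (q - 1) \<le> \<bar>q\<bar> * l powr (q - 1)" by (rule mult_left_mono) simp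
    moreover have "norm (z powr of_real (q - 1)) = norm z powr (q - 1)"
      by (subst norm_powr_real_powr') (simp_all only: Reals_of_real Re_complex_of_real)
    ultimately show "norm (of_real q * z powr (of_real q - 1)) \<le> \<bar>q\<bar> * l powr (q - 1)"
      by (simp only: norm_mult norm_of_real of_real_diff of_real_1)
  qed (auto simp: l_def)
  also have "norm (L - of_real l) \<le> pi"
  proof -
    have "L - of_real l = \<i> * of_real (Im L)" by (simp add: complex_eq_iff l_def)
    thus ?thesis using assms by (simp add: norm_mult)
  qed
  hence "\<bar>q\<bar> * l powr (q - 1) * norm (L - of_real l) \<le> \<bar>q\<bar> * l powr (q - 1) * pi" by (intro mult_left_mono) auto
  finally show ?thesis using l unfolding l_def[symmetric] by (simp add: powr_of_real mult_ac)
qed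

lemma norm_cos_diff_le:
  assumes "\<bar>Im w\<bar> \<le> R" "\<bar>Im w0\<bar> \<le> R"
  shows "norm (cos w - cos w0) \<le> exp R * norm (w - w0)"
proof -
  have 1: "norm (exp (\<i> * w) - exp (\<i> * w0)) \<le> exp R * norm (\<i> * w - \<i> * w0)"
    by (rule norm_exp_diff_le) (use assms in auto)
  have 2: "norm (exp (- (\<i> * w)) - exp (- (\<i> * w0))) \<le> exp R * norm (- (\<i> * w) - - (\<i> * w0))"
    by (rule norm_exp_diff_le) (use assms in auto)
  have n: "norm (\<i> * w - \<i> * w0) = norm (w - w0)" "norm (- (\<i> * w) - - (\<i> * w0)) = norm (w - w0)"
    by (simp_all add: norm_mult norm_minus_commute flip: right_diff_distrib)
  have "cos w - cos w0 = ((exp (\<i> * w) - exp (\<i> * w0)) + (exp (- (\<i> * w)) - exp (- (\<i> * w0)))) / 2"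
    by (simp add: cos_exp_eq diff_divide_distrib add_divide_distrib)
  hence "norm (cos w - cos w0) = norm ((exp (\<i> * w) - exp (\<i> * w0)) + (exp (- (\<i> * w)) - exp (- (\<i> * w0)))) / 2"
    by (simp only: norm_divide norm_numeral)
  also have "\<dots> \<le> (exp R * norm (w - w0) + exp R * norm (w - w0)) / 2"
    by (intro divide_right_mono order.trans[OF norm_triangle_ineq add_mono] 1[unfolded n] 2[unfolded n]) auto
  finally show ?thesis by simp
qed

lemma main_term_near_real:
  assumes th: "\<theta> < 0"
  defines "p \<equiv> \<theta> / (\<theta> - 1)"
  shows "\<exists>C\<ge>0. \<forall>L. Re L \<ge> 1 \<longrightarrow> \<bar>Im L\<bar> \<le> pi \<longrightarrow> norm (main_term c \<theta> L - main_term c \<theta> (of_real (Re L)))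
     \<le> C * (exp (A2 c \<theta> * Re L powr p) * Re L powr (- p / 2) * Re L powr (p - 1))"
proof -
  have p: "0 < p" "p < 1" using th by (auto simp: p_def divide_simps)
  have q: "\<theta> / (2 * (1 - \<theta>)) = - p / 2" using th by (simp add: p_def field_simps)
  define K1 where "K1 = exp (\<bar>A2 c \<theta>\<bar> * pi) * (\<bar>A2 c \<theta>\<bar> * pi)"
  define K2 where "K2 = exp (\<bar>A3 c \<theta>\<bar> * pi) * (\<bar>A3 c \<theta>\<bar> * pi)"
  define K where "K = K1 * (1 + pi) * (1 + K2) + pi * (1 + K2) + K2"
  have K1: "K1 \<ge> 0" and K2: "K2 \<ge> 0" by (simp_all add: K1_def K2_def)
  have K: "K \<ge> 0" using K1 K2 by (simp add: K_def)
  show ?thesis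
  proof (intro exI[of _ "\<bar>A1 c \<theta>\<bar> * K"] conjI allI impI)
    show "\<bar>A1 c \<theta>\<bar> * K \<ge> 0" using K by simp
    fix L assume L: "Re L \<ge> 1" "\<bar>Im L\<bar> \<le> pi"
    define l where "l = Re L"
    have l: "l \<ge> 1" using L by (simp add: l_def)
    have lp: "Re L > 0" using L by simp
    define u where "u = l powr (p - 1)"
    have u: "0 < u" "u \<le> 1" using l p powr_mono2'[of "p - 1" 1 l] by (auto simp: u_def)
    define P where "P = L powr of_real p"
    define P0 where "P0 = l powr p"
    define e where "e = exp (of_real (A2 c \<theta>) * P)"
    define e0 where "e0 = exp (A2 c \<theta> * P0)"
    define b where "b = L powr of_real (- p / 2)"
    define b0 where "b0 = l powr (- p / 2)"
    define w where "w = of_real (A3 c \<theta>) * P + of_real (A4 \<theta>)"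
    define w0 where "w0 = A3 c \<theta> * P0 + A4 \<theta>"
    have b0: "b0 > 0" using l by (simp add: b0_def)
    have "norm (P - of_real P0) \<le> \<bar>p\<bar> * pi * u"
      using powr_near_real[OF lp L(2), of p] p by (simp add: P_def P0_def u_def l_def)
    also have "\<dots> \<le> 1 * pi * u" using p u by (intro mult_right_mono) auto
    finally have dP: "norm (P - of_real P0) \<le> pi * u" by simp
    have dP1: "norm (P - of_real P0) \<le> pi" using dP mult_left_mono[OF u(2) pi_ge_zero] by linarith
    have de: "norm (e - of_real e0) \<le> e0 * (K1 * u)"
    proof -
      define x where "x = of_real (A2 c \<theta>) * (P - of_real P0)"
      have nx: "norm x \<le> \<bar>A2 c \<theta>\<bar> * (pi * u)" "norm x \<le> \<bar>A2 c \<theta>\<bar> * pi"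
        unfolding x_def norm_mult using dP dP1 by (auto intro!: mult_left_mono)
      have "norm (exp x - (\<Sum>k\<le>0. x^k / fact k)) \<le> exp \<bar>Re x\<bar> * norm x ^ Suc 0 / fact 0" by (rule Taylor_exp)
      hence "norm (exp x - 1) \<le> exp \<bar>Re x\<bar> * norm x" by simp
      also have "\<dots> \<le> exp (\<bar>A2 c \<theta>\<bar> * pi) * (\<bar>A2 c \<theta>\<bar> * (pi * u))"
        using nx abs_Re_le_cmod[of x] by (intro mult_mono) auto
      finally have "norm (exp x - 1) \<le> K1 * u" by (simp add: K1_def mult_ac)
      moreover have "e - of_real e0 = of_real e0 * (exp x - 1)"
        unfolding e_def e0_def x_def by (simp add: exp_of_real[symmetric] algebra_simps flip: exp_add)
      ultimately show ?thesis by (simp add: norm_mult e0_def)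
    qed
    have dw: "norm (cos w - cos (of_real w0)) \<le> K2 * u"
    proof -
      have "w - of_real w0 = of_real (A3 c \<theta>) * (P - of_real P0)" by (simp add: w_def w0_def algebra_simps)
      hence nw: "norm (w - of_real w0) \<le> \<bar>A3 c \<theta>\<bar> * (pi * u)" "norm (w - of_real w0) \<le> \<bar>A3 c \<theta>\<bar> * pi"
        using dP dP1 by (auto simp: norm_mult intro!: mult_left_mono)
      have "\<bar>Im w\<bar> \<le> \<bar>A3 c \<theta>\<bar> * pi" using abs_Im_le_cmod[of "w - of_real w0"] nw by simp
      hence "norm (cos w - cos (of_real w0)) \<le> exp (\<bar>A3 c \<theta>\<bar> * pi) * norm (w - of_real w0)"
        by (intro norm_cos_diff_le) auto
      also have "\<dots> \<le> exp (\<bar>A3 c \<theta>\<bar> * pi) * (\<bar>A3 c \<theta>\<bar> * (pi * u))" by (intro mult_left_mono nw) auto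
      finally show ?thesis by (simp add: K2_def mult_ac)
    qed
    have db: "norm (b - of_real b0) \<le> b0 * (pi * u)"
    proof -
      have "norm (b - of_real b0) \<le> \<bar>- p / 2\<bar> * pi * l powr (- p / 2 - 1)"
        using powr_near_real[OF lp L(2), of "- p / 2"] p by (simp add: b_def b0_def l_def)
      also have "l powr (- p / 2 - 1) = b0 * l powr (- 1)" by (simp only: b0_def diff_conv_add_uminus powr_add)
      also have "\<bar>- p / 2\<bar> * pi * (b0 * l powr (- 1)) \<le> 1 * pi * (b0 * u)"
      proof -
        have "l powr (- 1) \<le> u" unfolding u_def using p l by (intro powr_mono) auto
        hence 1: "b0 * l powr (- 1) \<le> b0 * u" using b0 by (intro mult_left_mono) auto
        have 2: "\<bar>- p / 2\<bar> * pi \<le> 1 * pi" using p by (intro mult_right_mono) auto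
        show ?thesis by (rule mult_mono[OF 2 1]) (use b0 in simp_all)
      qed
      finally show ?thesis by (simp add: mult_ac)
    qed
    have nc0: "norm (cos (complex_of_real w0)) \<le> 1" unfolding cos_of_real norm_of_real by (rule abs_cos_le_one)
    have nc: "norm (cos w) \<le> 1 + K2"
    proof -
      have "norm (cos w) \<le> norm (cos (complex_of_real w0)) + norm (cos w - cos (of_real w0))"
        using norm_triangle_ineq[of "cos (complex_of_real w0)" "cos w - cos (of_real w0)"] by simp
      also have "\<dots> \<le> 1 + K2 * 1" using dw u K2 by (intro add_mono nc0 order.trans[OF dw] mult_left_mono) auto
      finally show ?thesis by simp
    qed
    have nb: "norm b \<le> b0 * (1 + pi)"
    proof -
      have "norm b \<le> norm (complex_of_real b0) + norm (b - of_real b0)"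
        using norm_triangle_ineq[of "complex_of_real b0" "b - of_real b0"] by simp
      also have "\<dots> \<le> b0 + b0 * (pi * 1)" using b0 u by (intro add_mono order.trans[OF db] mult_left_mono) auto
      finally show ?thesis by (simp add: algebra_simps)
    qed
    have e0: "e0 > 0" by (simp add: e0_def)
    have "e * b * cos w - of_real e0 * of_real b0 * cos (of_real w0) = 
        (e - of_real e0) * (b * cos w) + of_real e0 * ((b - of_real b0) * cos w) + of_real e0 * (of_real b0
          * (cos w - cos (of_real w0)))"
      by (simp add: algebra_simps)
    also have "norm \<dots> \<le> norm ((e - of_real e0) * (b * cos w)) + norm (of_real e0 * ((b - of_real b0) * cos w))
      + norm (of_real e0 * (of_real b0 * (cos w - cos (of_real w0))))"
      by (rule order.trans[OF norm_triangle_ineq add_right_mono[OF norm_triangle_ineq]])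
    also have "\<dots> = norm (e - of_real e0) * (norm b * norm (cos w)) + e0 * (norm (b - of_real b0)
      * norm (cos w)) + e0 * (b0 * norm (cos w - cos (of_real w0)))"
      using e0 b0 by (simp add: norm_mult)
    also have "\<dots> \<le> (e0 * (K1 * u)) * ((b0 * (1 + pi)) * (1 + K2)) + e0 * ((b0 * (pi * u)) * (1 + K2)) + e0
      * (b0 * (K2 * u))"
      using e0 b0 K1 K2 u by (intro add_mono mult_mono de nb nc db dw order.refl mult_nonneg_nonneg) auto
    also have "\<dots> = K * (e0 * b0 * u)" by (simp add: K_def algebra_simps)
    finally have fin: "norm (e * b * cos w - of_real e0 * of_real b0 * cos (of_real w0)) \<le> K * (e0 * b0 * u)" .
    have m1: "main_term c \<theta> L = of_real (A1 c \<theta>) * (e * b * cos w)"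
      unfolding main_term_def q p_def[symmetric] e_def b_def w_def P_def by (simp only: mult.assoc)
    have pw: "of_real l powr of_real r = complex_of_real (l powr r)" for r using l by (simp add: powr_of_real)
    have m2: "main_term c \<theta> (of_real l) = of_real (A1 c \<theta>) * (of_real e0 * of_real b0 * cos (of_real w0))"
      unfolding main_term_def q p_def[symmetric] pw e0_def b0_def w0_def P0_def
        by (simp add: exp_of_real[symmetric] mult.assoc)
    have "norm (main_term c \<theta> L - main_term c \<theta> (of_real l))
      = \<bar>A1 c \<theta>\<bar> * norm (e * b * cos w - of_real e0 * of_real b0 * cos (of_real w0))"
      unfolding m1 m2 right_diff_distrib[symmetric] norm_mult by simp
    also have "\<dots> \<le> \<bar>A1 c \<theta>\<bar> * (K * (e0 * b0 * u))" by (intro mult_left_mono fin) auto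
    finally show "norm (main_term c \<theta> L - main_term c \<theta> (of_real (Re L)))
     \<le> \<bar>A1 c \<theta>\<bar> * K * (exp (A2 c \<theta> * Re L powr p) * Re L powr (- p / 2) * Re L powr (p - 1))"
      by (simp add: e0_def b0_def u_def P0_def l_def mult.assoc)
  qed
qed

text \<open>In the error bound, too, \<open>Ln z\<close> may be replaced by its real part, at the expense of a constant.\<close>

lemma error_scale_lower_bound:
  assumes p: "0 < p" "p < 1"
  shows "\<exists>k>0. \<forall>L. Re L \<ge> 1 \<longrightarrow> \<bar>Im L\<bar> \<le> pi \<longrightarrow>
     k * (exp (A * Re L powr p) * Re L powr q) \<le> norm (exp (of_real A * L powr of_real p) * L powr of_real q)"
proof (intro exI[of _ "exp (- \<bar>A\<bar> * pi) * 5 powr (- \<bar>q\<bar>)"] conjI allI impI)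
  fix L assume L: "Re L \<ge> 1" "\<bar>Im L\<bar> \<le> pi"
  define l where "l = Re L"
  have l: "l \<ge> 1" using L by (simp add: l_def)
  have lp: "Re L > 0" using L by simp
  define P where "P = L powr of_real p"
  have "norm (P - of_real (l powr p)) \<le> \<bar>p\<bar> * pi * l powr (p - 1)"
    using powr_near_real[OF lp L(2), of p] p by (simp add: P_def l_def)
  also have "\<dots> \<le> 1 * pi * 1" using p l powr_mono2'[of "p - 1" 1 l] by (intro mult_mono) auto
  finally have "norm (P - of_real (l powr p)) \<le> pi" by simp
  hence "\<bar>Re P - l powr p\<bar> \<le> pi" using abs_Re_le_cmod[of "P - of_real (l powr p)"] by simp
  hence "\<bar>A\<bar> * \<bar>Re P - l powr p\<bar> \<le> \<bar>A\<bar> * pi" by (intro mult_left_mono) auto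
  hence "\<bar>A * Re P - A * l powr p\<bar> \<le> \<bar>A\<bar> * pi" by (simp add: abs_mult right_diff_distrib flip: abs_mult)
  hence "A * l powr p - \<bar>A\<bar> * pi \<le> A * Re P" by linarith
  hence "exp (A * l powr p - \<bar>A\<bar> * pi) \<le> norm (exp (of_real A * P))" by simp
  hence 1: "exp (- \<bar>A\<bar> * pi) * exp (A * l powr p) \<le> norm (exp (of_real A * P))"
    by (simp add: exp_diff exp_minus field_simps)
  \<comment> \<open>\<open>1 \<le> \<bar>L\<bar> / l \<le> 5\<close>, since \<open>\<pi> < 4 \<le> 4 l\<close>.\<close>
  define t where "t = norm L / l"
  have "l \<le> norm L" unfolding l_def by (rule complex_Re_le_cmod)
  moreover have "norm L \<le> 5 * l"
  proof -
    have "norm L \<le> \<bar>Re L\<bar> + \<bar>Im L\<bar>" by (rule cmod_le)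
    also have "\<dots> \<le> l + 4" using L l pi_less_4 by (simp add: l_def)
    finally show ?thesis using l by simp
  qed
  ultimately have t: "1 \<le> t" "t \<le> 5" using l by (auto simp: t_def field_simps)
  have "5 powr (- \<bar>q\<bar>) \<le> t powr (- \<bar>q\<bar>)" using t by (intro powr_mono2') auto
  also have "\<dots> \<le> t powr q" using t by (intro powr_mono) auto
  finally have "5 powr (- \<bar>q\<bar>) * l powr q \<le> t powr q * l powr q" using l by (intro mult_right_mono) auto
  also have "\<dots> = norm L powr q" using t l by (simp add: t_def powr_divide)
  also have "\<dots> = norm (L powr of_real q)" by (simp add: norm_powr_real_powr')
  finally have 2: "5 powr (- \<bar>q\<bar>) * l powr q \<le> norm (L powr of_real q)" .
  have "(exp (- \<bar>A\<bar> * pi) * exp (A * l powr p)) * (5 powr (- \<bar>q\<bar>) * l powr q)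
    \<le> norm (exp (of_real A * P)) * norm (L powr of_real q)"
    by (intro mult_mono 1 2) auto
  thus "exp (- \<bar>A\<bar> * pi) * 5 powr (- \<bar>q\<bar>) * (exp (A * Re L powr p) * Re L powr q)
    \<le> norm (exp (of_real A * L powr of_real p) * L powr of_real q)"
    unfolding norm_mult P_def l_def by (simp only: mult_ac)
qed simp

lemma error_scale_le:
  assumes c: "c < 0" and a: "a > 0"
  defines "p \<equiv> a / (1 + a)"
  shows "\<exists>C\<ge>0. \<forall>l>0. error_scale c a l \<le> C * (exp (A2 c (- a) * l powr p) * l powr (- p / 2)
    * (l powr (- p / 2) + l powr (p - 1)))"
proof -
  define b where "b = (a * (- c)) powr (1 / (1 + a))"
  have b: "b > 0" using c a by (simp add: b_def mult_pos_neg)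
  define C where "C = max (1 / sqrt b) b / sqrt b"
  show ?thesis
  proof (intro exI[of _ C] conjI allI impI)
    show "C \<ge> 0" using b by (simp add: C_def le_max_iff_disj)
    fix l :: real assume l: "l > 0"
    have N: "large_param c a l = b * l powr p" unfolding large_param_eq[OF c a l] b_def p_def ..
    have "saddle_radius c a l = large_param c a l / l" using l by (simp add: large_param_def)
    hence s: "saddle_radius c a l = b * l powr (p - 1)" unfolding N using l by (simp add: powr_diff)
    have h: "sqrt (l powr p) = l powr (p / 2)" using l by (simp add: powr_half_sqrt[symmetric] powr_powr)
    have "- p / 2 = - (p / 2)" by simp
    hence "l powr (- p / 2) = 1 / l powr (p / 2)" by (simp only: powr_minus_divide)
    hence sq: "1 / sqrt (large_param c a l) = 1 / sqrt b * l powr (- p / 2)"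
      unfolding N by (simp only: real_sqrt_mult h) simp
    have "1 / sqrt b * l powr (- p / 2) + b * l powr (p - 1)
      \<le> max (1 / sqrt b) b * l powr (- p / 2) + max (1 / sqrt b) b * l powr (p - 1)"
      by (intro add_mono mult_right_mono) auto
    hence m: "1 / sqrt b * l powr (- p / 2) + b * l powr (p - 1)
      \<le> max (1 / sqrt b) b * (l powr (- p / 2) + l powr (p - 1))"
      by (simp add: distrib_left)
    have "error_scale c a l = exp (A2 c (- a) * l powr p) * (1 / sqrt b * l powr (- p / 2) + b * l powr (p
      - 1)) * (1 / sqrt b * l powr (- p / 2))"
      unfolding error_scale_def large_param_constants(1)[OF c a l] p_def[symmetric] s sq[symmetric] by simp
    also have "\<dots> \<le> exp (A2 c (- a) * l powr p) * (max (1 / sqrt b) b * (l powr (- p / 2) + l powr (p - 1)))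
      * (1 / sqrt b * l powr (- p / 2))"
      using b by (intro mult_right_mono mult_left_mono m) auto
    also have "\<dots> = C * (exp (A2 c (- a) * l powr p) * l powr (- p / 2) * (l powr (- p / 2) + l powr (p - 1)))"
      by (simp add: C_def mult_ac)
    finally show "error_scale c a l \<le> C * (exp (A2 c (- a) * l powr p) * l powr (- p / 2) * (l powr (- p / 2)
      + l powr (p - 1)))" .
  qed
qed

text \<open>The case distinction in \<open>\<mu>\<close> at \<open>\<theta> = -2\<close> is where \<open>p/2\<close> and \<open>1 - p\<close> change order.\<close>

lemma exponent_le_\<mu>:
  assumes th: "\<theta> < 0" and "\<epsilon> > 0"
  defines "p \<equiv> \<theta> / (\<theta> - 1)"
  shows "\<mu> \<theta> \<epsilon> \<le> p / 2" "\<mu> \<theta> \<epsilon> \<le> 1 - p"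
proof -
  have e: "\<theta> / (2 * (\<theta> - 1)) = p / 2" "1 / (1 - \<theta>) = 1 - p" using th by (auto simp: p_def field_simps)
  have "p / 2 \<le> 1 - p \<longleftrightarrow> 1 / 3 \<le> 1 - p" by linarith
  also have "\<dots> \<longleftrightarrow> \<theta> \<ge> - 2" unfolding e(2)[symmetric] using th by (simp add: field_simps) linarith
  finally have "p / 2 \<le> 1 - p \<longleftrightarrow> \<theta> \<ge> - 2" .
  thus "\<mu> \<theta> \<epsilon> \<le> p / 2" "\<mu> \<theta> \<epsilon> \<le> 1 - p" unfolding \<mu>_def e using assms by auto
qed

lemma E_asymptotics:
  assumes c: "c < 0" and th: "\<theta> < 0" and eps: "\<epsilon> > 0"
  shows "\<exists>C. \<forall>\<^sub>F l in at_top. \<forall>z. z \<notin> \<real>\<^sub>\<le>\<^sub>0 \<longrightarrow> Re (Ln z) = l \<longrightarrow>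
     norm (E z c \<theta> - main_term c \<theta> (Ln z)) \<le> C * norm (error_term c \<theta> \<epsilon> (Ln z))"
proof -
  define a where "a = - \<theta>"
  have a: "a > 0" and th_a: "\<theta> = - a" using th by (auto simp: a_def)
  define p where "p = \<theta> / (\<theta> - 1)"
  have p: "0 < p" "p < 1" using th by (auto simp: p_def divide_simps)
  have pa: "p = a / (1 + a)" using a by (simp add: p_def th_a field_simps)
  define q where "q = \<theta> / (2 * (1 - \<theta>)) - \<mu> \<theta> \<epsilon>"
  have q: "q = - p / 2 - \<mu> \<theta> \<epsilon>" using th by (simp add: q_def p_def field_simps)
  note mu = exponent_le_\<mu>[OF th eps, folded p_def]
  obtain C1 where C1: "C1 \<ge> 0" "\<forall>\<^sub>F l in at_top. \<forall>z. z \<notin> \<real>\<^sub>\<le>\<^sub>0 \<longrightarrow> Re (Ln z) = l \<longrightarrow>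
      norm (E z c \<theta> - of_real (- Im (saddle_contrib c a l) / pi)) \<le> C1 * error_scale c a l"
    using E_saddle_point[OF c a] unfolding th_a by blast
  obtain C2 where C2: "C2 \<ge> 0" "\<And>l. l > 0 \<Longrightarrow> error_scale c a l
    \<le> C2 * (exp (A2 c \<theta> * l powr p) * l powr (- p / 2) * (l powr (- p / 2) + l powr (p - 1)))"
    using error_scale_le[OF c a] unfolding th_a pa by blast
  obtain C3 where C3: "C3 \<ge> 0" "\<And>L. Re L \<ge> 1 \<Longrightarrow> \<bar>Im L\<bar> \<le> pi
    \<Longrightarrow> norm (main_term c \<theta> L - main_term c \<theta> (of_real (Re L)))
     \<le> C3 * (exp (A2 c \<theta> * Re L powr p) * Re L powr (- p / 2) * Re L powr (p - 1))"
    using main_term_near_real[OF th, of c] unfolding p_def by blast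
  obtain k where k: "k > 0" "\<And>L. Re L \<ge> 1 \<Longrightarrow> \<bar>Im L\<bar> \<le> pi \<Longrightarrow>
     k * (exp (A2 c \<theta> * Re L powr p) * Re L powr q)
       \<le> norm (exp (of_real (A2 c \<theta>) * L powr of_real p) * L powr of_real q)"
    using error_scale_lower_bound[OF p, of "A2 c \<theta>" q] by blast
  define C where "C = C1 * (C2 * 2) + C3"
  have C: "C \<ge> 0" using C1 C2 C3 by (simp add: C_def)
  have "\<forall>\<^sub>F l in at_top. \<forall>z. z \<notin> \<real>\<^sub>\<le>\<^sub>0 \<longrightarrow> Re (Ln z) = l \<longrightarrow>
     norm (E z c \<theta> - main_term c \<theta> (Ln z)) \<le> C / k * norm (exp (of_real (A2 c \<theta>) * Ln z powr of_real p)
       * Ln z powr of_real q)"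
    using C1(2) eventually_ge_at_top[of 1]
  proof (eventually_elim, intro allI impI)
    fix l z
    assume est: "\<forall>z. z \<notin> \<real>\<^sub>\<le>\<^sub>0 \<longrightarrow> Re (Ln z) = l \<longrightarrow>
      norm (E z c \<theta> - of_real (- Im (saddle_contrib c a l) / pi)) \<le> C1 * error_scale c a l"
      and l: "1 \<le> l" and z: "z \<notin> \<real>\<^sub>\<le>\<^sub>0" "Re (Ln z) = l"
    define L where "L = Ln z"
    have L: "Re L \<ge> 1" "Re L = l" "\<bar>Im L\<bar> \<le> pi"
      using Ln_in_log_strip[OF z(1)] z l by (auto simp: L_def log_strip_def)
    have lp: "l > 0" using l by simp
    define s where "s = exp (A2 c \<theta> * l powr p) * l powr (- p / 2)"
    have s: "s > 0" using l by (simp add: s_def)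
    define v where "v = l powr (- \<mu> \<theta> \<epsilon>)"
    have v: "l powr (- p / 2) \<le> v" "l powr (p - 1) \<le> v" using mu l unfolding v_def by (auto intro!: powr_mono)
    have "error_scale c a l \<le> C2 * (s * (l powr (- p / 2) + l powr (p - 1)))"
      unfolding s_def by (rule C2(2)[OF lp])
    also have "\<dots> \<le> C2 * (s * (v + v))" using C2(1) s by (intro mult_left_mono add_mono v) auto
    finally have "C1 * error_scale c a l \<le> C1 * (C2 * (s * (v + v)))" using C1(1) by (intro mult_left_mono)
    moreover have "norm (E z c \<theta> - main_term c \<theta> (of_real l)) \<le> C1 * error_scale c a l"
      using est z main_term_real[OF c a lp] unfolding th_a by simp
    ultimately have 1: "norm (E z c \<theta> - main_term c \<theta> (of_real l)) \<le> C1 * (C2 * 2) * (s * v)"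
      by (simp add: mult_ac)
    have "norm (main_term c \<theta> L - main_term c \<theta> (of_real l)) \<le> C3 * (s * l powr (p - 1))"
      using C3(2)[OF L(1,3)] L(2) by (simp add: s_def)
    also have "\<dots> \<le> C3 * (s * v)" using C3(1) s by (intro mult_left_mono v) auto
    finally have 2: "norm (main_term c \<theta> L - main_term c \<theta> (of_real l)) \<le> C3 * (s * v)" .
    have "E z c \<theta> - main_term c \<theta> L = (E z c \<theta> - main_term c \<theta> (of_real l)) - (main_term c \<theta> L
      - main_term c \<theta> (of_real l))" by simp
    also have "norm \<dots> \<le> C1 * (C2 * 2) * (s * v) + C3 * (s * v)"
      by (rule order.trans[OF norm_triangle_ineq4 add_mono[OF 1 2]])
    also have "\<dots> = C * (s * v)" by (simp only: C_def distrib_right)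
    also have "\<dots> = C / k * (k * (s * v))" using k(1) by simp
    also have "s * v = exp (A2 c \<theta> * l powr p) * l powr q"
      unfolding s_def v_def q mult.assoc powr_add[symmetric] by simp
    also have "C / k * (k * (exp (A2 c \<theta> * l powr p) * l powr q))
      \<le> C / k * norm (exp (of_real (A2 c \<theta>) * L powr of_real p) * L powr of_real q)"
      using k(2)[OF L(1,3)] L(2) C k(1) by (intro mult_left_mono) auto
    finally show "norm (E z c \<theta> - main_term c \<theta> (Ln z))
      \<le> C / k * norm (exp (of_real (A2 c \<theta>) * Ln z powr of_real p) * Ln z powr of_real q)"
      unfolding L_def .
  qed
  thus ?thesis unfolding error_term_def p_def q_def by blast
qed

lemma sector_avoids_nonpos:
  assumes "sector \<alpha> \<beta> \<inter> complex_of_real ` {..<0} = {}" "z \<in> sector \<alpha> \<beta>"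
  shows "z \<notin> \<real>\<^sub>\<le>\<^sub>0"
proof
  assume "z \<in> \<real>\<^sub>\<le>\<^sub>0"
  then obtain x where x: "z = of_real x" "x \<le> 0" by (auto elim!: nonpos_Reals_cases)
  have "z \<noteq> 0" using assms(2) by (auto simp: sector_def)
  hence "x < 0" using x by auto
  thus False using assms x by auto
qed

lemma A2_sign:
  assumes "c < 0" "\<theta> < 0"
  shows "-1 < \<theta> \<Longrightarrow> A2 c \<theta> < 0" "\<theta> = -1 \<Longrightarrow> A2 c \<theta> = 0" "\<theta> < -1 \<Longrightarrow> A2 c \<theta> > 0"
proof -
  have "c * \<theta> > 0" using assms by (simp add: mult_neg_neg)
  hence pos: "(1 - inverse \<theta>) * (c * \<theta>) powr (1 / (1 - \<theta>)) > 0"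
    using assms by (intro mult_pos_pos) (auto simp: field_simps)
  show "A2 c \<theta> = 0" if "\<theta> = -1" using that by (simp add: A2_def)
  show "A2 c \<theta> > 0" if "\<theta> < -1"
  proof -
    have "pi / (1 - \<theta>) < pi / 2" using that by (intro divide_strict_left_mono) auto
    moreover have "pi / (1 - \<theta>) > 0" using that by simp
    ultimately have "cos (pi / (1 - \<theta>)) > 0" by (intro cos_gt_zero) auto
    thus ?thesis unfolding A2_def by (rule mult_pos_pos[OF pos])
  qed
  show "A2 c \<theta> < 0" if "-1 < \<theta>"
  proof -
    have "pi / 2 < pi / (1 - \<theta>)" using that assms by (intro divide_strict_left_mono) auto
    moreover have "pi / (1 - \<theta>) < pi" using assms by (simp add: pos_divide_less_eq algebra_simps mult_pos_neg)
    ultimately have "cos (pi / (1 - \<theta>)) < cos (pi / 2)" by (intro cos_monotone_0_pi) auto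
    hence "cos (pi / (1 - \<theta>)) < 0" by simp
    thus ?thesis unfolding A2_def by (rule mult_pos_neg[OF pos])
  qed
qed

theorem theorem4:
  fixes c \<theta> \<epsilon> \<alpha> \<beta> :: real
  assumes "c < 0" and "\<theta> < 0" and "\<epsilon> > 0"
    and "\<alpha> < \<beta>" and "sector \<alpha> \<beta> \<inter> complex_of_real ` {..<0} = {}"
  shows "((\<lambda>z. E z c \<theta> -
            of_real (A1 c \<theta>)
            * exp (of_real (A2 c \<theta>) * Ln z powr of_real (\<theta> / (\<theta> - 1)))
            * Ln z powr of_real (\<theta> / (2 * (1 - \<theta>)))
            * cos (of_real (A3 c \<theta>) * Ln z powr of_real (\<theta> / (\<theta> - 1)) + of_real (A4 \<theta>)))
         \<in> O[inf at_infinity (principal (sector \<alpha> \<beta>))](\<lambda>z.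
            exp (of_real (A2 c \<theta>) * Ln z powr of_real (\<theta> / (\<theta> - 1)))
            * Ln z powr of_real (\<theta> / (2 * (1 - \<theta>)) - \<mu> \<theta> \<epsilon>))) \<and>
         (-1 < \<theta> \<longrightarrow> A2 c \<theta> < 0) \<and>
         (\<theta> = -1 \<longrightarrow> A2 c \<theta> = 0) \<and>
         (\<theta> < -1 \<longrightarrow> A2 c \<theta> > 0)"
proof (intro conjI impI)
  obtain C where ev: "\<forall>\<^sub>F l in at_top. \<forall>z. z \<notin> \<real>\<^sub>\<le>\<^sub>0 \<longrightarrow> Re (Ln z) = l \<longrightarrow>
     norm (E z c \<theta> - main_term c \<theta> (Ln z)) \<le> C * norm (error_term c \<theta> \<epsilon> (Ln z))"
    using E_asymptotics[OF assms(1-3)] by blast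
  have "filterlim (\<lambda>z::complex. ln (norm z)) at_top at_infinity"
    by (rule filterlim_compose[OF ln_at_top filterlim_norm_at_top])
  from eventually_compose_filterlim[OF ev this]
  have "\<forall>\<^sub>F z in at_infinity. z \<in> sector \<alpha> \<beta> \<longrightarrow> norm (E z c \<theta> - main_term c \<theta> (Ln z))
    \<le> C * norm (error_term c \<theta> \<epsilon> (Ln z))"
  proof (rule eventually_mono, intro impI)
    fix z assume *: "\<forall>w. w \<notin> \<real>\<^sub>\<le>\<^sub>0 \<longrightarrow> Re (Ln w) = ln (norm z) \<longrightarrow>
     norm (E w c \<theta> - main_term c \<theta> (Ln w)) \<le> C * norm (error_term c \<theta> \<epsilon> (Ln w))" and z: "z \<in> sector \<alpha> \<beta>"
    have np: "z \<notin> \<real>\<^sub>\<le>\<^sub>0" by (rule sector_avoids_nonpos[OF assms(5) z])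
    hence "Re (Ln z) = ln (norm z)" by (intro Re_Ln) auto
    with * np show "norm (E z c \<theta> - main_term c \<theta> (Ln z)) \<le> C * norm (error_term c \<theta> \<epsilon> (Ln z))" by blast
  qed
  thus "(\<lambda>z. E z c \<theta> -
            of_real (A1 c \<theta>)
            * exp (of_real (A2 c \<theta>) * Ln z powr of_real (\<theta> / (\<theta> - 1)))
            * Ln z powr of_real (\<theta> / (2 * (1 - \<theta>)))
            * cos (of_real (A3 c \<theta>) * Ln z powr of_real (\<theta> / (\<theta> - 1)) + of_real (A4 \<theta>)))
         \<in> O[inf at_infinity (principal (sector \<alpha> \<beta>))](\<lambda>z.
            exp (of_real (A2 c \<theta>) * Ln z powr of_real (\<theta> / (\<theta> - 1)))
            * Ln z powr of_real (\<theta> / (2 * (1 - \<theta>)) - \<mu> \<theta> \<epsilon>))"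
    unfolding main_term_def error_term_def by (intro bigoI[of _ C]) (simp only: eventually_inf_principal)
qed (use A2_sign[OF assms(1,2)] in auto)

end
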